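(* For the two-hop, two-user interference channel with delayed CSI-S, $\mathbf{d}^{\rm dCSI}=\tfrac{4}{3}$.
   Context: Two-hop, two-user interference channel: sources $S_1,S_2$, relays $R_1,R_2$, destinations $D_1,D_2$. At channel use $t$, $Y_{R_i}(t)=H_{i1}(t)X_{S_1}(t)+H_{i2}(t)X_{S_2}(t)+Z_{R_i}(t)$ and $Y_{D_i}(t)=G_{i1}(t)X_{R_1}(t)+G_{i2}(t)X_{R_2}(t)+Z_{D_i}(t)$, $i=1,2$, with complex signals, power constraint $P$ on every transmitted signal, and all $H_{ij}(t),G_{ij}(t),Z_{R_i}(t),Z_{D_i}(t)$ i.i.d. $\mathcal{CN}(0,1)$ across $i,j,t$. Relays transmit causal functions of their past received signals and available side information. Destinations know all channel coefficients. Source $S_i$ sends message $\mathcal{M}_i$ at rate $r_i$ to $D_i$; achievability means vanishing error probability at each destination as blocklength grows; $C_{\rm sum}(P)$ is the maximal sum rate and DoF $=\lim_{P\to\infty}C_{\rm sum}(P)/\log_2P$. Delayed CSI-S: at time $t+1$ the sources know all coefficients $\{H_{ij}(t),G_{ij}(t)\}_{i,j}$ of time $t$; the relays have no side information whatsoever (no channel knowledge). $\mathbf{d}^{\rm dCSI}$ denotes the DoF under this model. *)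

theory Defs
  imports "HOL-Probability.Probability"
begin

text \<open>
Randomness: an element w :: nat => nat => complex; w t k is the k-th random
variable of channel use t, with
  k = 0,1,2,3   : H11, H12, H21, H22
  k = 4,5,6,7   : G11, G12, G21, G22
  k = 8,9       : Z_R1, Z_R2
  k = 10,11     : Z_D1, Z_D2.
All of them are i.i.d. circularly symmetric CN(0,1).
\<close>

definition CN01 :: "complex measure" where
  "CN01 = density lborel (\<lambda>z. ennreal (exp (- (cmod z)\<^sup>2) / pi))"

definition chan_meas :: "(nat \<Rightarrow> nat \<Rightarrow> complex) measure" where
  "chan_meas = PiM UNIV (\<lambda>t. PiM {..<12} (\<lambda>k. CN01))"

definition Hc :: "nat \<Rightarrow> nat \<Rightarrow> nat \<Rightarrow> (nat \<Rightarrow> nat \<Rightarrow> complex) \<Rightarrow> complex" where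
  "Hc i j t w = w t (2 * (i - 1) + (j - 1))"

definition Gc :: "nat \<Rightarrow> nat \<Rightarrow> nat \<Rightarrow> (nat \<Rightarrow> nat \<Rightarrow> complex) \<Rightarrow> complex" where
  "Gc i j t w = w t (4 + 2 * (i - 1) + (j - 1))"

definition ZR :: "nat \<Rightarrow> nat \<Rightarrow> (nat \<Rightarrow> nat \<Rightarrow> complex) \<Rightarrow> complex" where
  "ZR i t w = w t (7 + i)"

definition ZD :: "nat \<Rightarrow> nat \<Rightarrow> (nat \<Rightarrow> nat \<Rightarrow> complex) \<Rightarrow> complex" where
  "ZD i t w = w t (9 + i)"

definition csi :: "(nat \<Rightarrow> nat \<Rightarrow> complex) \<Rightarrow> nat \<Rightarrow> nat \<Rightarrow> complex" where
  "csi w s = restrict (w s) {..<8}"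

definition csi_past :: "(nat \<Rightarrow> nat \<Rightarrow> complex) \<Rightarrow> nat \<Rightarrow> nat \<Rightarrow> nat \<Rightarrow> complex" where
  "csi_past w t = restrict (\<lambda>s. csi w s) {..<t}"

definition csi_space :: "nat \<Rightarrow> (nat \<Rightarrow> nat \<Rightarrow> complex) measure" where
  "csi_space t = PiM {..<t} (\<lambda>_. PiM {..<8} (\<lambda>_. (borel :: complex measure)))"

definition sig_space :: "nat \<Rightarrow> (nat \<Rightarrow> complex) measure" where
  "sig_space t = PiM {..<t} (\<lambda>_. (borel :: complex measure))"

text \<open>A code. Users/nodes are indexed by i \<in> {1,2}, channel uses by t < blen,
messages of source i by m < nmsg i.
  enc i t m (csi of uses < t)      = X_{S_i}(t)   (delayed CSI at the sources)
  rel i t (Y_{R_i} of uses < t)    = X_{R_i}(t)   (no side information at relays)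
  dec i (all csi of the block, Y_{D_i} of the block) = decoded message.\<close>
record code =
  blen :: nat
  nmsg :: "nat \<Rightarrow> nat"
  enc :: "nat \<Rightarrow> nat \<Rightarrow> nat \<Rightarrow> (nat \<Rightarrow> nat \<Rightarrow> complex) \<Rightarrow> complex"
  rel :: "nat \<Rightarrow> nat \<Rightarrow> (nat \<Rightarrow> complex) \<Rightarrow> complex"
  dec :: "nat \<Rightarrow> (nat \<Rightarrow> nat \<Rightarrow> complex) \<times> (nat \<Rightarrow> complex) \<Rightarrow> nat"

definition XS :: "code \<Rightarrow> nat \<Rightarrow> nat \<Rightarrow> nat \<Rightarrow> (nat \<Rightarrow> nat \<Rightarrow> complex) \<Rightarrow> complex" where
  "XS c i m t w = enc c i t m (csi_past w t)"

definition YR :: "code \<Rightarrow> nat \<Rightarrow> nat \<Rightarrow> nat \<Rightarrow> nat \<Rightarrow> (nat \<Rightarrow> nat \<Rightarrow> complex) \<Rightarrow> complex" where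
  "YR c i m1 m2 t w = Hc i 1 t w * XS c 1 m1 t w + Hc i 2 t w * XS c 2 m2 t w + ZR i t w"

definition XR :: "code \<Rightarrow> nat \<Rightarrow> nat \<Rightarrow> nat \<Rightarrow> nat \<Rightarrow> (nat \<Rightarrow> nat \<Rightarrow> complex) \<Rightarrow> complex" where
  "XR c i m1 m2 t w = rel c i t (restrict (\<lambda>s. YR c i m1 m2 s w) {..<t})"

definition YD :: "code \<Rightarrow> nat \<Rightarrow> nat \<Rightarrow> nat \<Rightarrow> nat \<Rightarrow> (nat \<Rightarrow> nat \<Rightarrow> complex) \<Rightarrow> complex" where
  "YD c i m1 m2 t w = Gc i 1 t w * XR c 1 m1 m2 t w + Gc i 2 t w * XR c 2 m1 m2 t w + ZD i t w"

definition decoded :: "code \<Rightarrow> nat \<Rightarrow> nat \<Rightarrow> nat \<Rightarrow> (nat \<Rightarrow> nat \<Rightarrow> complex) \<Rightarrow> nat" where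
  "decoded c i m1 m2 w =
     dec c i (csi_past w (blen c), restrict (\<lambda>s. YD c i m1 m2 s w) {..<blen c})"

definition err_prob :: "code \<Rightarrow> nat \<Rightarrow> real" where
  "err_prob c i =
     (\<Sum>m1<nmsg c 1. \<Sum>m2<nmsg c 2.
        measure chan_meas {w \<in> space chan_meas.
           decoded c i m1 m2 w \<noteq> (if i = 1 then m1 else m2)})
     / (real (nmsg c 1) * real (nmsg c 2))"

definition valid_code :: "real \<Rightarrow> code \<Rightarrow> bool" where
  "valid_code P c \<longleftrightarrow>
     blen c \<ge> 1 \<and> nmsg c 1 \<ge> 1 \<and> nmsg c 2 \<ge> 1 \<and>
     (\<forall>i\<in>{1,2}. \<forall>t<blen c. \<forall>m<nmsg c i.
        enc c i t m \<in> borel_measurable (csi_space t)) \<and>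
     (\<forall>i\<in>{1,2}. \<forall>t<blen c. rel c i t \<in> borel_measurable (sig_space t)) \<and>
     (\<forall>i\<in>{1,2}. dec c i \<in> measurable (csi_space (blen c) \<Otimes>\<^sub>M sig_space (blen c))
                                   (count_space UNIV)) \<and>
     (\<forall>i\<in>{1,2}.
        (\<Sum>m<nmsg c i. \<Sum>t<blen c. \<integral>\<^sup>+ w. ennreal ((cmod (XS c i m t w))\<^sup>2) \<partial>chan_meas)
          \<le> ennreal (real (nmsg c i) * real (blen c) * P)) \<and>
     (\<forall>i\<in>{1,2}.
        (\<Sum>m1<nmsg c 1. \<Sum>m2<nmsg c 2. \<Sum>t<blen c.
            \<integral>\<^sup>+ w. ennreal ((cmod (XR c i m1 m2 t w))\<^sup>2) \<partial>chan_meas)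
          \<le> ennreal (real (nmsg c 1) * real (nmsg c 2) * real (blen c) * P))"

definition achievable :: "real \<Rightarrow> real \<Rightarrow> real \<Rightarrow> bool" where
  "achievable P r1 r2 \<longleftrightarrow> r1 \<ge> 0 \<and> r2 \<ge> 0 \<and>
     (\<exists>C :: nat \<Rightarrow> code.
        (\<forall>n\<ge>1. valid_code P (C n) \<and> blen (C n) = n \<and>
                 real (nmsg (C n) 1) \<ge> 2 powr (real n * r1) \<and>
                 real (nmsg (C n) 2) \<ge> 2 powr (real n * r2)) \<and>
        (\<lambda>n. err_prob (C n) 1) \<longlonglongrightarrow> 0 \<and>
        (\<lambda>n. err_prob (C n) 2) \<longlonglongrightarrow> 0)"

definition Csum :: "real \<Rightarrow> real" where
  "Csum P = Sup {r1 + r2 | r1 r2. achievable P r1 r2}"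

definition DoF_dCSI_is :: "real \<Rightarrow> bool" where
  "DoF_dCSI_is d \<longleftrightarrow> ((\<lambda>P. Csum P / log 2 P) \<longlongrightarrow> d) at_top"

end

theory Submission
  imports Defs "HOL-Real_Asymp.Real_Asymp"
begin

text \<open>
Converse. Give the relay noises to the destinations. Then the relay signals at time \<open>t\<close> are determined
by the two messages and the past, and, given everything except the destination noises, the received
signals have finite mixtures of Gaussians as densities. As nothing that is transmitted depends on the
current channel to the destinations, the destinations are statistically equivalent given the past: their
joint conditional entropy is at most twice the conditional entropy of one output.
As for the broadcast channel with delayed feedback this gives \<open>2 r\<^sub>1 + r\<^sub>2 \<le> 2 log P + O(1)\<close> and, by
symmetry, \<open>r\<^sub>1 + 2 r\<^sub>2 \<le> 2 log P + O(1)\<close>. No entropies are needed: every information inequality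
is an instance of \<open>E (ln R) \<le> E R - 1 \<le> 0\<close> for a suitable likelihood ratio \<open>R\<close>.

Achievability. Each source sends two symbols in two channel uses. Relay 1 forwards its first and relay 2
its second observation in one common channel use, so each destination gets an equation in its own two
symbols plus interference from the other two. The interference caused by source \<open>i\<close> is
a combination of its own two symbols, known to it from the delayed channel coefficients, and is also
an equation useful to destination \<open>i\<close>. Both sources send their combination in a third channel use, and
the relays forward what they receive twice. So four symbols are delivered per three channel uses.
With uncoded QAM symbols of minimal distance \<open>P\<close> to a small power, zero forcing fails with small
probability as \<open>P\<close> grows; the remaining symbol errors are corrected by a Gilbert-Varshamov outer code of
rate close to 1, since blocks that are far apart are independent and Chebyshev's inequality applies.
\<close>

section \<open>Gaussian noise and resampling of coordinates\<close>

text \<open>With outputs Y_d, Y_e and messages W_d, W_e, all given the channel and the relay noises,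
  the chain behind a weighted bound is, up to o(n): n r_d \<le> h(Y_d) - h(Y_d | W_d); n r_e \<le>
  h(Y_d, Y_e | W_d) - h(noise); and h(Y_d, Y_e | W_d) \<le> 2 h(Y_d | W_d) through one-step
  conditional entropies given the past of both receivers. Twice the first plus the second leaves 2
  h(Y_d). Message sets are finite, so every mixture lies between a Gaussian component divided by
  their size and that size; its logarithm is dominated by the noise energy whatever encoders and
  relays do. The obstacle for the scheme is causality. The combination repeated by a source involves
  the channel of the third use of its block, hence is known only in the fourth, where the next block
  already starts; it waits for use \<open>T + 5\<close>. A block thus spreads over eight uses while
  consuming three, and blocks overlap, interleaved by time mod 3. The zero-forced noise is a
  quotient whose denominator may be near 0, so only its almost sure finiteness is used; its law is
  independent of \<open>P\<close>, while the symbol spacing grows with \<open>P\<close>.\<close>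

definition Ndens :: "complex \<Rightarrow> real" where
  "Ndens z = exp (- (cmod z)\<^sup>2) / pi"

lemma Ndens_pos [simp]: "Ndens z > 0"
  by (simp add: Ndens_def)

lemma Ndens_nonneg [simp]: "Ndens z \<ge> 0"
  by (simp add: Ndens_def)

text \<open>The unit-variance complex Gaussian density peaks at 1 / pi < 1. The upper bounds on
  likelihoods and mixtures and the sign of the noise entropy rest on this.\<close>

lemma Ndens_le_1: "Ndens z \<le> 1"
proof -
  have "exp (- (cmod z)\<^sup>2) \<le> 1" by simp
  also have "1 \<le> pi" using pi_gt3 by linarith
  finally show ?thesis by (simp add: Ndens_def)
qed

lemma Ndens_measurable [measurable]: "Ndens \<in> borel_measurable borel"
  unfolding Ndens_def by measurable

lemma CN01_eq: "CN01 = density lborel (\<lambda>z. ennreal (Ndens z))"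
  by (simp add: CN01_def Ndens_def)

lemma sets_CN01 [measurable_cong, simp]: "sets CN01 = sets borel"
  by (simp add: CN01_eq)

lemma space_CN01 [simp]: "space CN01 = UNIV"
  by (simp add: CN01_eq)

lemma nn_integral_complex_prod:
  assumes [measurable]: "f \<in> borel_measurable borel" "g \<in> borel_measurable borel"
    and "\<And>x. 0 \<le> f x" "\<And>x. 0 \<le> g x"
  shows "(\<integral>\<^sup>+ z. ennreal (f (Re z) * g (Im z)) \<partial>lborel)
       = (\<integral>\<^sup>+ x. ennreal (f x) \<partial>lborel) * (\<integral>\<^sup>+ x. ennreal (g x) \<partial>lborel)"
proof -
  define F where "F b x = ennreal (if b = (1::complex) then f x else g x)" for b x
  have "(\<integral>\<^sup>+ z. (\<Prod>b\<in>Basis. F b (z \<bullet> b)) \<partial>lborel) = (\<Prod>b\<in>Basis. \<integral>\<^sup>+ x. F b x \<partial>lborel)"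
    by (rule nn_integral_lborel_prod) (auto simp: F_def)
  then show ?thesis
    using assms(3,4) by (simp add: Basis_complex_def F_def inner_complex_def ennreal_mult)
qed

lemma sqrt_half_normal: "normal_density 0 (sqrt (1/2)) x = exp (- x\<^sup>2) / sqrt pi"
  by (simp add: normal_density_def)

lemma nn_integral_Ndens: "(\<integral>\<^sup>+ z. ennreal (Ndens z) \<partial>lborel) = 1"
proof -
  let ?f = "normal_density 0 (sqrt (1/2))"
  have n: "(\<integral>\<^sup>+ x. ennreal (?f x) \<partial>lborel) = 1"
    using integral_normal_density[of "sqrt (1/2)" 0]
    by (subst nn_integral_eq_integral) auto
  have "Ndens z = ?f (Re z) * ?f (Im z)" for z
    unfolding sqrt_half_normal Ndens_def cmod_power2 by (simp add: exp_add [symmetric])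
  then show ?thesis
    using nn_integral_complex_prod[of ?f ?f] n by simp
qed

lemma prob_space_CN01: "prob_space CN01"
  by (rule prob_spaceI) (simp add: CN01_eq emeasure_density nn_integral_Ndens)

interpretation CN01: prob_space CN01
  by (rule prob_space_CN01)

lemma nn_integral_CN01:
  "f \<in> borel_measurable borel \<Longrightarrow>
    (\<integral>\<^sup>+ z. f z \<partial>CN01) = (\<integral>\<^sup>+ z. ennreal (Ndens z) * f z \<partial>lborel)"
  by (simp add: CN01_eq nn_integral_density)

text \<open>Substitution \<open>y = z + s\<close>: if \<open>s\<close> is the signal, an expectation
  over the noise becomes a Lebesgue integral over the received value.\<close>

lemma nn_integral_CN01_shift:
  assumes [measurable]: "f \<in> borel_measurable borel"
  shows "(\<integral>\<^sup>+ z. f z \<partial>CN01) = (\<integral>\<^sup>+ y. ennreal (Ndens (y - s)) * f (y - s) \<partial>lborel)"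
proof -
  have "(\<integral>\<^sup>+ z. f z \<partial>CN01) = (\<integral>\<^sup>+ z. ennreal (Ndens z) * f z \<partial>distr lborel borel ((+) (-s)))"
    by (simp add: nn_integral_CN01 lborel_distr_plus)
  also have "\<dots> = (\<integral>\<^sup>+ y. ennreal (Ndens (y - s)) * f (y - s) \<partial>lborel)"
    by (subst nn_integral_distr) auto
  finally show ?thesis .
qed

lemma nn_integral_Ndens_shift: "(\<integral>\<^sup>+ y. ennreal (Ndens (y - s)) \<partial>lborel) = 1"
  using nn_integral_CN01_shift[of "\<lambda>_. 1" s] CN01.emeasure_space_1 by simp

lemma second_moment_CN01: "(\<integral>\<^sup>+ z. ennreal ((cmod z)\<^sup>2) \<partial>CN01) = 1"
proof -
  let ?f = "normal_density 0 (sqrt (1/2))"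
  have n: "(\<integral>\<^sup>+ x. ennreal (?f x) \<partial>lborel) = 1"
    using integral_normal_density[of "sqrt (1/2)" 0]
    by (subst nn_integral_eq_integral) auto
  have m: "(\<integral>\<^sup>+ x. ennreal (?f x * x\<^sup>2) \<partial>lborel) = ennreal (1/2)"
  proof -
    have "has_bochner_integral lborel (\<lambda>x. ?f x * x\<^sup>2) (1/2)"
      using normal_moment_even[of "sqrt (1/2)" 0 1] by simp
    then show ?thesis
      by (simp only: has_bochner_integral_iff nn_integral_eq_integral
          AE_I2[OF mult_nonneg_nonneg[OF normal_density_nonneg zero_le_power2]])
  qed
  have eq: "Ndens z * (cmod z)\<^sup>2
      = (?f (Re z) * (Re z)\<^sup>2) * ?f (Im z) + ?f (Re z) * (?f (Im z) * (Im z)\<^sup>2)" for z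
    unfolding sqrt_half_normal Ndens_def cmod_power2
    by (simp add: exp_diff exp_minus field_simps)
  have "(\<integral>\<^sup>+ z. ennreal ((cmod z)\<^sup>2) \<partial>CN01) = (\<integral>\<^sup>+ z. ennreal (Ndens z * (cmod z)\<^sup>2) \<partial>lborel)"
    by (subst nn_integral_CN01) (simp_all add: ennreal_mult)
  also have "\<dots> = (\<integral>\<^sup>+ z. ennreal ((?f (Re z) * (Re z)\<^sup>2) * ?f (Im z)) \<partial>lborel)
      + (\<integral>\<^sup>+ z. ennreal (?f (Re z) * (?f (Im z) * (Im z)\<^sup>2)) \<partial>lborel)"
    unfolding eq by (subst nn_integral_add[symmetric]) (auto simp: ennreal_plus)
  also have "\<dots> = ennreal (1/2) + ennreal (1/2)"
    by (subst nn_integral_complex_prod[of "\<lambda>x. ?f x * x\<^sup>2" ?f],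
        simp_all, subst nn_integral_complex_prod[of ?f "\<lambda>x. ?f x * x\<^sup>2"], simp_all add: n m)
  also have "\<dots> = ennreal (1/2 + 1/2)" by (rule ennreal_plus[symmetric]) simp_all
  also have "\<dots> = 1" by simp
  finally show ?thesis .
qed

section \<open>The channel space and the replacement of coordinates by fresh copies\<close>

abbreviation slot_meas :: "(nat \<Rightarrow> complex) measure" where
  "slot_meas \<equiv> PiM {..<12} (\<lambda>k. CN01)"

interpretation slot: prob_space slot_meas
  by (intro prob_space_PiM) (rule prob_space_CN01)

interpretation chan: prob_space chan_meas
  unfolding chan_meas_def by (rule prob_space_PiM) (rule slot.prob_space_axioms)

lemma sets_chan [measurable_cong]:
  "sets chan_meas = sets (PiM UNIV (\<lambda>t::nat. PiM {..<12::nat} (\<lambda>k. borel :: complex measure)))"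
  unfolding chan_meas_def by (intro sets_PiM_cong refl) simp

lemma space_chan: "space chan_meas = {w. \<forall>t. w t \<in> extensional {..<12}}"
  by (auto simp: chan_meas_def space_PiM PiE_def extensional_def)

lemma measurable_chan_coord [measurable]: "k < 12 \<Longrightarrow> (\<lambda>w. w t k) \<in> borel_measurable chan_meas"
  unfolding measurable_cong_sets[OF sets_chan refl]
  by (rule measurable_compose[OF measurable_component_singleton[of t] measurable_component_singleton[of k]]) auto

lemma measurable_chan_slot [measurable]: "(\<lambda>w. w t) \<in> measurable chan_meas slot_meas"
  unfolding chan_meas_def by measurable

text \<open>Coordinate \<open>i\<close> is independent of the others, so a fresh copy may overwrite
  it. Keeping the old value inside \<open>w\<close> avoids splitting the index set in later
  applications, and infinite \<open>I\<close> is covered.\<close>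

lemma nn_integral_PiM_resample:
  assumes M: "\<And>i. i \<in> I \<Longrightarrow> prob_space (M i)" and i: "i \<in> I"
    and F [measurable]: "F \<in> borel_measurable (PiM I M)"
  shows "(\<integral>\<^sup>+ w. F w \<partial>PiM I M) = (\<integral>\<^sup>+ w. \<integral>\<^sup>+ v. F (w(i := v)) \<partial>M i \<partial>PiM I M)"
proof -
  define J where "J = I - {i}"
  have ins: "insert i J = I" using i by (auto simp: J_def)
  interpret Mi: prob_space "M i" by (rule M[OF i])
  interpret I: prob_space "PiM I M" using M by (rule prob_space_PiM)
  interpret J: prob_space "PiM J M" using M by (intro prob_space_PiM) (auto simp: J_def)
  interpret PJ: pair_sigma_finite "M i" "PiM J M" ..
  have d: "distr (M i \<Otimes>\<^sub>M PiM J M) (PiM I M) (\<lambda>(x, X). X(i := x)) = PiM I M"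
    using distr_pair_PiM_eq_PiM[of J M i] M i unfolding ins by (auto simp: J_def)
  have m: "(\<lambda>(x, X). X(i := x)) \<in> measurable (M i \<Otimes>\<^sub>M PiM J M) (PiM I M)"
    using i by (subst ins[symmetric]) measurable
  have m1: "(\<lambda>(X, x). X(i := x)) \<in> measurable (PiM I M \<Otimes>\<^sub>M M i) (PiM I M)"
  proof (rule measurable_PiM_single')
    fix j assume j: "j \<in> I"
    show "(\<lambda>p. (case p of (X, x) \<Rightarrow> X(i := x)) j) \<in> measurable (PiM I M \<Otimes>\<^sub>M M i) (M j)"
      using j by (cases "j = i") (auto simp: split_beta)
  next
    show "(\<lambda>p. (case p of (X, x) \<Rightarrow> X(i := x))) \<in> space (PiM I M \<Otimes>\<^sub>M M i) \<rightarrow> (\<Pi>\<^sub>E j\<in>I. space (M j))"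
      using i by (auto simp: space_pair_measure space_PiM PiE_def extensional_def)
  qed
  have m': "(\<lambda>X. \<integral>\<^sup>+ v. F (X(i := v)) \<partial>M i) \<in> borel_measurable (PiM I M)"
    using measurable_compose[OF m1 F] by (intro Mi.borel_measurable_nn_integral) (simp add: split_beta')
  have "(\<integral>\<^sup>+ w. F w \<partial>PiM I M) = (\<integral>\<^sup>+ p. F (case p of (x, X) \<Rightarrow> X(i := x)) \<partial>(M i \<Otimes>\<^sub>M PiM J M))"
    by (subst d[symmetric], subst nn_integral_distr[OF m]) simp_all
  also have "\<dots> = (\<integral>\<^sup>+ X. \<integral>\<^sup>+ v. F (X(i := v)) \<partial>M i \<partial>PiM J M)"
    using measurable_compose[OF m F] by (subst PJ.nn_integral_snd[symmetric]) (simp_all add: split_beta')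
  \<comment> \<open>A dummy integral of total mass 1 over the coordinate about to be overwritten; it
    restores an integral over the whole product.\<close>
  also have "\<dots> = (\<integral>\<^sup>+ x. \<integral>\<^sup>+ X. \<integral>\<^sup>+ v. F (X(i := v)) \<partial>M i \<partial>PiM J M \<partial>M i)"
    using Mi.emeasure_space_1 by simp
  also have "\<dots> = (\<integral>\<^sup>+ X. \<integral>\<^sup>+ x. \<integral>\<^sup>+ v. F ((X(i := x))(i := v)) \<partial>M i \<partial>M i \<partial>PiM J M)"
    using Mi.emeasure_space_1 by simp
  also have "\<dots> = (\<integral>\<^sup>+ p. (\<lambda>X. \<integral>\<^sup>+ v. F (X(i := v)) \<partial>M i) (case p of (x, X) \<Rightarrow> X(i := x)) \<partial>(M i \<Otimes>\<^sub>M PiM J M))"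
    using measurable_compose[OF m m'] by (subst PJ.nn_integral_snd[symmetric]) (simp_all add: split_beta')
  also have "\<dots> = (\<integral>\<^sup>+ w. \<integral>\<^sup>+ v. F (w(i := v)) \<partial>M i \<partial>PiM I M)"
    using nn_integral_distr[OF m, of "\<lambda>X. \<integral>\<^sup>+ v. F (X(i := v)) \<partial>M i"] m' unfolding d by simp
  finally show ?thesis .
qed

lemma measurable_chan_upd [measurable (raw)]:
  assumes "f \<in> measurable N chan_meas" "g \<in> measurable N slot_meas"
  shows "(\<lambda>x. (f x)(t := g x)) \<in> measurable N chan_meas"
  unfolding chan_meas_def
proof (rule measurable_PiM_single')
  fix i :: nat assume "i \<in> UNIV"
  show "(\<lambda>x. ((f x)(t := g x)) i) \<in> measurable N slot_meas"
    using assms(2) measurable_compose[OF assms(1) measurable_chan_slot] by (cases "i = t") auto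
next
  show "(\<lambda>x. (f x)(t := g x)) \<in> space N \<rightarrow> UNIV \<rightarrow>\<^sub>E space slot_meas"
    using measurable_space[OF assms(1)] measurable_space[OF assms(2)]
    by (simp add: chan_meas_def space_PiM Pi_iff PiE_iff)
qed

lemma measurable_slot_upd [measurable (raw)]:
  assumes "k < 12" "f \<in> measurable N slot_meas" "g \<in> borel_measurable N"
  shows "(\<lambda>x. (f x)(k := g x)) \<in> measurable N slot_meas"
proof (rule measurable_PiM_single')
  fix i :: nat assume i: "i \<in> {..<12}"
  have "(\<lambda>v. v i) \<in> measurable slot_meas CN01" using i by measurable
  then show "(\<lambda>x. ((f x)(k := g x)) i) \<in> measurable N CN01"
    using assms(3) measurable_compose[OF assms(2)]
    by (cases "i = k") (auto simp: measurable_cong_sets[OF refl sets_CN01])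
next
  show "(\<lambda>x. (f x)(k := g x)) \<in> space N \<rightarrow> {..<12} \<rightarrow>\<^sub>E space CN01"
    using measurable_space[OF assms(2)] assms(1)
    by (auto simp: space_PiM PiE_def extensional_def)
qed

definition chan_upd :: "nat \<Rightarrow> nat \<Rightarrow> (nat \<Rightarrow> nat \<Rightarrow> complex) \<Rightarrow> complex \<Rightarrow> nat \<Rightarrow> nat \<Rightarrow> complex" where
  "chan_upd t k w z = w(t := (w t)(k := z))"

lemma measurable_chan_upd_coord [measurable (raw)]:
  assumes "k < 12" and [measurable]: "f \<in> measurable N chan_meas" "g \<in> borel_measurable N"
  shows "(\<lambda>x. chan_upd t k (f x) (g x)) \<in> measurable N chan_meas"
  unfolding chan_upd_def using assms(1) by measurable

lemma nn_integral_chan_slot: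
  assumes [measurable]: "F \<in> borel_measurable chan_meas"
  shows "(\<integral>\<^sup>+ w. F w \<partial>chan_meas) = (\<integral>\<^sup>+ w. \<integral>\<^sup>+ v. F (w(t := v)) \<partial>slot_meas \<partial>chan_meas)"
  unfolding chan_meas_def
  by (rule nn_integral_PiM_resample) (use assms in \<open>auto simp: chan_meas_def intro: slot.prob_space_axioms\<close>)

lemma nn_integral_chan_coord:
  assumes F [measurable]: "F \<in> borel_measurable chan_meas" and k [simp]: "k < 12"
  shows "(\<integral>\<^sup>+ w. F w \<partial>chan_meas) = (\<integral>\<^sup>+ w. \<integral>\<^sup>+ z. F (chan_upd t k w z) \<partial>CN01 \<partial>chan_meas)"
proof -
  have "(\<integral>\<^sup>+ w. F w \<partial>chan_meas) = (\<integral>\<^sup>+ w. \<integral>\<^sup>+ v. F (w(t := v)) \<partial>slot_meas \<partial>chan_meas)"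
    by (rule nn_integral_chan_slot) fact
  also have "\<dots> = (\<integral>\<^sup>+ w. \<integral>\<^sup>+ v. \<integral>\<^sup>+ z. F (w(t := v(k := z))) \<partial>CN01 \<partial>slot_meas \<partial>chan_meas)"
  proof (rule nn_integral_cong)
    fix w assume w[simp]: "w \<in> space chan_meas"
    have "(\<lambda>v. F (w(t := v))) \<in> borel_measurable slot_meas" by measurable
    then show "(\<integral>\<^sup>+ v. F (w(t := v)) \<partial>slot_meas) = (\<integral>\<^sup>+ v. \<integral>\<^sup>+ z. F (w(t := v(k := z))) \<partial>CN01 \<partial>slot_meas)"
      by (intro nn_integral_PiM_resample) (auto intro: prob_space_CN01)
  qed
  also have "\<dots> = (\<integral>\<^sup>+ w. \<integral>\<^sup>+ v. \<integral>\<^sup>+ z. F (chan_upd t k (w(t := v)) z) \<partial>CN01 \<partial>slot_meas \<partial>chan_meas)"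
    by (simp add: chan_upd_def)
  also have "\<dots> = (\<integral>\<^sup>+ w. \<integral>\<^sup>+ z. F (chan_upd t k w z) \<partial>CN01 \<partial>chan_meas)"
    by (rule nn_integral_chan_slot[symmetric]) simp
  finally show ?thesis .
qed

lemma measurable_chanI:
  assumes "\<And>t k. k < 12 \<Longrightarrow> (\<lambda>x. f x t k) \<in> borel_measurable N"
    and "\<And>x t. x \<in> space N \<Longrightarrow> f x t \<in> extensional {..<12}"
  shows "f \<in> measurable N chan_meas"
  unfolding chan_meas_def
proof (rule measurable_PiM_single')
  fix t :: nat
  show "(\<lambda>x. f x t) \<in> measurable N slot_meas"
    by (rule measurable_PiM_single')
      (use assms in \<open>auto simp: PiE_def measurable_cong_sets[OF refl sets_CN01]\<close>)
qed (use assms in \<open>auto simp: space_PiM PiE_def\<close>)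

definition chan_updJ :: "(nat \<times> nat) set \<Rightarrow> (nat \<Rightarrow> nat \<Rightarrow> complex) \<Rightarrow> (nat \<times> nat \<Rightarrow> complex) \<Rightarrow> nat \<Rightarrow> nat \<Rightarrow> complex" where
  "chan_updJ J w y = (\<lambda>t k. if (t, k) \<in> J then y (t, k) else w t k)"

lemma measurable_chan_updJ:
  assumes "J \<subseteq> UNIV \<times> {..<12}"
    and f: "f \<in> measurable N chan_meas"
    and y: "\<And>j. j \<in> J \<Longrightarrow> (\<lambda>x. y x j) \<in> borel_measurable N"
  shows "(\<lambda>x. chan_updJ J (f x) (y x)) \<in> measurable N chan_meas"
proof (rule measurable_chanI)
  fix t k :: nat assume k: "k < 12"
  show "(\<lambda>x. chan_updJ J (f x) (y x) t k) \<in> borel_measurable N"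
    using y measurable_compose[OF f measurable_chan_coord[OF k]]
    by (cases "(t, k) \<in> J") (auto simp: chan_updJ_def)
next
  fix x t assume "x \<in> space N"
  then show "chan_updJ J (f x) (y x) t \<in> extensional {..<12}"
    using measurable_space[OF f] assms(1)
    by (auto simp: space_chan chan_updJ_def extensional_def)
qed

abbreviation leb :: "(nat \<times> nat) set \<Rightarrow> (nat \<times> nat \<Rightarrow> complex) measure" where
  "leb J \<equiv> PiM J (\<lambda>_. lborel)"

interpretation lb: product_sigma_finite "\<lambda>_ :: nat \<times> nat. lborel :: complex measure"
  by standard

lemma measurable_PiM_lborel_coord:
  "j \<in> J \<Longrightarrow> (\<lambda>y. y j) \<in> borel_measurable (PiM J (\<lambda>_. lborel :: complex measure))"
  using measurable_component_singleton[of j J "\<lambda>_. lborel :: complex measure"] by simp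

text \<open>Overwriting the noises at \<open>J\<close> by \<open>y - s\<close> makes
  \<open>y\<close> the family of outputs, integrated against shifted Gaussian densities. This is
  legitimate because the signals do not depend on coordinates in \<open>K\<close>; the fixed
  superset \<open>K\<close> keeps that invariance available while the induction adds the elements of
  \<open>J\<close> one by one.\<close>

lemma nn_integral_chan_resample:
  assumes J: "finite J" "J \<subseteq> K" and K: "K \<subseteq> UNIV \<times> {..<12}"
    and F [measurable]: "F \<in> borel_measurable chan_meas"
    and s: "\<And>j. j \<in> K \<Longrightarrow> s j \<in> borel_measurable chan_meas"
    and inv: "\<And>j t k w z. j \<in> K \<Longrightarrow> (t, k) \<in> K \<Longrightarrow> s j (chan_upd t k w z) = s j w"
  shows "(\<integral>\<^sup>+ w. F w \<partial>chan_meas) =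
    (\<integral>\<^sup>+ w. \<integral>\<^sup>+ y. ennreal (\<Prod>j\<in>J. Ndens (y j - s j w)) * F (chan_updJ J w (\<lambda>j. y j - s j w))
       \<partial>leb J \<partial>chan_meas)"
  using J
proof (induction J rule: finite_induct)
  case empty
  have "chan_updJ {} w y = w" for w y by (simp add: chan_updJ_def)
  then show ?case
    by (simp add: PiM_empty nn_integral_count_space_finite)
next
  case (insert j J)
  obtain t k where j: "j = (t, k)" by (cases j)
  then have k: "k < 12" and jK: "(t, k) \<in> K" "j \<in> K" and JK: "J \<subseteq> K" using insert K by auto
  have [measurable]: "s j \<in> borel_measurable chan_meas" using s jK by simp
  define G where "G = (\<lambda>w y. ennreal (\<Prod>j\<in>J. Ndens (y j - s j w)) * F (chan_updJ J w (\<lambda>j. y j - s j w)))"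
  define \<Phi> where "\<Phi> w = (\<integral>\<^sup>+ y. G w y \<partial>leb J)" for w
  interpret Jf: sigma_finite_measure "PiM J (\<lambda>_. lborel :: complex measure)"
    using insert by (intro lb.sigma_finite) simp
  have c [measurable]: "(\<lambda>p. snd p i - s i (fst p)) \<in> borel_measurable (chan_meas \<Otimes>\<^sub>M leb J)"
    if "i \<in> J" for i
    using s[OF subsetD[OF JK that]] measurable_PiM_lborel_coord[OF that]
    by (intro borel_measurable_diff measurable_compose[OF measurable_fst]
        measurable_compose[OF measurable_snd]) auto
  have u [measurable]: "(\<lambda>p. chan_updJ J (fst p) (\<lambda>j. snd p j - s j (fst p)))
      \<in> measurable (chan_meas \<Otimes>\<^sub>M leb J) chan_meas"
    using JK K c by (intro measurable_chan_updJ) auto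
  have "(\<lambda>p. G (fst p) (snd p)) \<in> borel_measurable (chan_meas \<Otimes>\<^sub>M leb J)"
    unfolding G_def
    by (intro borel_measurable_times_ennreal measurable_compose[OF _ measurable_ennreal]
        borel_measurable_prod measurable_compose[OF c Ndens_measurable] measurable_compose[OF u F])
  then have [measurable]: "\<Phi> \<in> borel_measurable chan_meas"
    unfolding \<Phi>_def by (intro Jf.borel_measurable_nn_integral) (simp add: split_beta')
  have IH: "(\<integral>\<^sup>+ w. F w \<partial>chan_meas) = (\<integral>\<^sup>+ w. \<Phi> w \<partial>chan_meas)"
    using insert JK by (simp add: \<Phi>_def G_def)
  also have "\<dots> = (\<integral>\<^sup>+ w. \<integral>\<^sup>+ z. \<Phi> (chan_upd t k w z) \<partial>CN01 \<partial>chan_meas)"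
    by (rule nn_integral_chan_coord) (use k in auto)
  also have "\<dots> = (\<integral>\<^sup>+ w. \<integral>\<^sup>+ y. ennreal (\<Prod>i\<in>insert j J. Ndens (y i - s i w))
        * F (chan_updJ (insert j J) w (\<lambda>i. y i - s i w)) \<partial>PiM (insert j J) (\<lambda>_. lborel) \<partial>chan_meas)"
  proof (rule nn_integral_cong)
    fix w assume w [simp]: "w \<in> space chan_meas"
    have [measurable]: "(\<lambda>z. \<Phi> (chan_upd t k w z)) \<in> borel_measurable borel"
      using k by measurable
    have "(\<integral>\<^sup>+ z. \<Phi> (chan_upd t k w z) \<partial>CN01)
      = (\<integral>\<^sup>+ u. ennreal (Ndens (u - s j w)) * \<Phi> (chan_upd t k w (u - s j w)) \<partial>lborel)"
      by (rule nn_integral_CN01_shift) measurable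
    also have "\<dots> = (\<integral>\<^sup>+ u. \<integral>\<^sup>+ y. ennreal (\<Prod>i\<in>insert j J. Ndens ((y(j := u)) i - s i w))
        * F (chan_updJ (insert j J) w (\<lambda>i. (y(j := u)) i - s i w)) \<partial>leb J \<partial>lborel)"
    proof (rule nn_integral_cong)
      fix u :: complex
      let ?w = "chan_upd t k w (u - s j w)"
      have w': "?w \<in> space chan_meas"
        using w k by (auto simp: space_chan chan_upd_def extensional_def)
      \<comment> \<open>The coordinate just replaced does not influence the remaining signals, so
        the successive substitutions do not disturb each other.\<close>
      have sw: "i \<in> J \<Longrightarrow> s i ?w = s i w" for i
        using inv[of i t k] jK JK by (meson subsetD)
      have G_meas: "G ?w \<in> borel_measurable (leb J)"
        unfolding G_def
        using measurable_compose[OF measurable_Pair1'[OF w'] u] measurable_compose[OF measurable_Pair1'[OF w'] c]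
        by (intro borel_measurable_times_ennreal measurable_compose[OF _ measurable_ennreal]
            borel_measurable_prod measurable_compose[OF _ Ndens_measurable] measurable_compose[OF _ F]) auto
      have e: "ennreal (Ndens (u - s j w)) * G ?w y =
        ennreal (\<Prod>i\<in>insert j J. Ndens ((y(j := u)) i - s i w))
        * F (chan_updJ (insert j J) w (\<lambda>i. (y(j := u)) i - s i w))" for y
      proof -
        have "chan_updJ J ?w (\<lambda>i. y i - s i ?w) = chan_updJ (insert j J) w (\<lambda>i. (y(j := u)) i - s i w)"
        proof (intro ext)
          fix a b
          show "chan_updJ J ?w (\<lambda>i. y i - s i ?w) a b = chan_updJ (insert j J) w (\<lambda>i. (y(j := u)) i - s i w) a b"
            using insert(2) sw[of "(a, b)"] by (cases "(a, b) \<in> J") (auto simp: chan_updJ_def j, auto simp: chan_upd_def j)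
        qed
        moreover have "(\<Prod>i\<in>J. Ndens (y i - s i ?w)) = (\<Prod>i\<in>J. Ndens ((y(j := u)) i - s i w))"
          using insert(2) by (intro prod.cong refl) (auto simp: sw)
        ultimately show ?thesis
          using insert(1,2) by (simp add: G_def ennreal_mult prod_nonneg mult.assoc)
      qed
      show "ennreal (Ndens (u - s j w)) * \<Phi> ?w =
        (\<integral>\<^sup>+ y. ennreal (\<Prod>i\<in>insert j J. Ndens ((y(j := u)) i - s i w))
        * F (chan_updJ (insert j J) w (\<lambda>i. (y(j := u)) i - s i w)) \<partial>leb J)"
        unfolding e[symmetric] \<Phi>_def using G_meas by (rule nn_integral_cmult[symmetric])
    qed
    also have "\<dots> = (\<integral>\<^sup>+ y. ennreal (\<Prod>i\<in>insert j J. Ndens (y i - s i w))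
        * F (chan_updJ (insert j J) w (\<lambda>i. y i - s i w)) \<partial>PiM (insert j J) (\<lambda>_. lborel))"
    proof (rule lb.product_nn_integral_insert_rev[symmetric, OF insert(1,2)])
      have c: "(\<lambda>y. y i - s i w) \<in> borel_measurable (PiM (insert j J) (\<lambda>_. lborel))" if "i \<in> insert j J" for i
        using measurable_PiM_lborel_coord[OF that] by (intro borel_measurable_diff) auto
      moreover have "(\<lambda>y. chan_updJ (insert j J) w (\<lambda>i. y i - s i w)) \<in> measurable (PiM (insert j J) (\<lambda>_. lborel)) chan_meas"
        using insert(4) K by (intro measurable_chan_updJ c) (auto intro!: measurable_const)
      ultimately show "(\<lambda>y. ennreal (\<Prod>i\<in>insert j J. Ndens (y i - s i w))
        * F (chan_updJ (insert j J) w (\<lambda>i. y i - s i w))) \<in> borel_measurable (PiM (insert j J) (\<lambda>_. lborel))"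
        by (intro borel_measurable_times_ennreal measurable_compose[OF _ measurable_ennreal]
            borel_measurable_prod measurable_compose[OF _ Ndens_measurable] measurable_compose[OF _ F])
    qed
    finally show "(\<integral>\<^sup>+ z. \<Phi> (chan_upd t k w z) \<partial>CN01) = \<dots>" .
  qed
  finally show ?case .
qed

section \<open>Causality and measurability of the signals of a code\<close>

lemma measurable_csi_past: "(\<lambda>w. csi_past w t) \<in> measurable chan_meas (csi_space t)"
proof -
  have "(\<lambda>w. csi w s) \<in> measurable chan_meas (PiM {..<8} (\<lambda>_. borel))" for s
    unfolding csi_def by (rule measurable_restrict) (use measurable_chan_coord in auto)
  then show ?thesis
    unfolding csi_past_def csi_space_def by (intro measurable_restrict) auto
qed

lemma csi_past_cong:
  assumes "\<And>s k. s < t \<Longrightarrow> k < 8 \<Longrightarrow> w s k = w' s k"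
  shows "csi_past w t = csi_past w' t"
  using assms by (auto simp: csi_past_def csi_def restrict_def fun_eq_iff)

lemma XS_cong:
  assumes "\<And>s k. s < t \<Longrightarrow> k < 8 \<Longrightarrow> w s k = w' s k"
  shows "XS c i m t w = XS c i m t w'"
  using csi_past_cong[of t w w'] assms by (simp add: XS_def)

lemma YR_cong:
  assumes "\<And>s k. s \<le> t \<Longrightarrow> k < 10 \<Longrightarrow> w s k = w' s k" and "i \<in> {1, 2}"
  shows "YR c i m1 m2 t w = YR c i m1 m2 t w'"
proof -
  have "XS c l m t w = XS c l m t w'" for l m
    by (rule XS_cong) (use assms in auto)
  then show ?thesis
    using assms(1)[of t] assms(2) by (auto simp: YR_def Hc_def ZR_def)
qed

text \<open>The bounds \<open>s < t\<close> and \<open>k < 10\<close> contain the two facts behind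
  the converse: a relay input depends neither on the channel of its own use nor on any receiver
  noise.\<close>

lemma XR_cong:
  assumes "\<And>s k. s < t \<Longrightarrow> k < 10 \<Longrightarrow> w s k = w' s k" and i: "i \<in> {1, 2}"
  shows "XR c i m1 m2 t w = XR c i m1 m2 t w'"
proof -
  have "restrict (\<lambda>s. YR c i m1 m2 s w) {..<t} = restrict (\<lambda>s. YR c i m1 m2 s w') {..<t}"
    by (intro restrict_ext YR_cong i) (use assms in auto)
  then show ?thesis by (simp add: XR_def)
qed

lemma Hc_measurable: "i \<in> {1,2} \<Longrightarrow> j \<in> {1,2} \<Longrightarrow> Hc i j t \<in> borel_measurable chan_meas"
  unfolding Hc_def[abs_def] by (rule measurable_chan_coord) auto

lemma Gc_measurable: "i \<in> {1,2} \<Longrightarrow> j \<in> {1,2} \<Longrightarrow> Gc i j t \<in> borel_measurable chan_meas"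
  unfolding Gc_def[abs_def] by (rule measurable_chan_coord) auto

lemma ZR_measurable: "i \<in> {1,2} \<Longrightarrow> ZR i t \<in> borel_measurable chan_meas"
  unfolding ZR_def[abs_def] by (rule measurable_chan_coord) auto

lemma ZD_measurable: "i \<in> {1,2} \<Longrightarrow> ZD i t \<in> borel_measurable chan_meas"
  unfolding ZD_def[abs_def] by (rule measurable_chan_coord) auto

context
  fixes c :: code and P :: real
  assumes valid: "valid_code P c"
begin

lemma XS_measurable:
  assumes "i \<in> {1,2}" "t < blen c" "m < nmsg c i"
  shows "XS c i m t \<in> borel_measurable chan_meas"
proof -
  have "enc c i t m \<in> borel_measurable (csi_space t)"
    using valid assms unfolding valid_code_def by blast
  then show ?thesis
    unfolding XS_def[abs_def] by (rule measurable_compose[OF measurable_csi_past])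
qed

lemma YR_measurable:
  assumes "i \<in> {1,2}" "t < blen c" "m1 < nmsg c 1" "m2 < nmsg c 2"
  shows "YR c i m1 m2 t \<in> borel_measurable chan_meas"
  unfolding YR_def[abs_def] using assms
  by (intro borel_measurable_add borel_measurable_times Hc_measurable ZR_measurable XS_measurable) auto

lemma XR_measurable:
  assumes "i \<in> {1,2}" "t < blen c" "m1 < nmsg c 1" "m2 < nmsg c 2"
  shows "XR c i m1 m2 t \<in> borel_measurable chan_meas"
proof -
  have "rel c i t \<in> borel_measurable (sig_space t)"
    using valid assms unfolding valid_code_def by blast
  moreover have "(\<lambda>w. restrict (\<lambda>s. YR c i m1 m2 s w) {..<t}) \<in> measurable chan_meas (sig_space t)"
    unfolding sig_space_def using assms by (intro measurable_restrict YR_measurable) auto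
  ultimately show ?thesis
    unfolding XR_def[abs_def] by (rule measurable_compose[rotated])
qed

lemma YD_measurable:
  assumes "i \<in> {1,2}" "t < blen c" "m1 < nmsg c 1" "m2 < nmsg c 2"
  shows "YD c i m1 m2 t \<in> borel_measurable chan_meas"
  unfolding YD_def[abs_def] using assms
  by (intro borel_measurable_add borel_measurable_times Gc_measurable ZD_measurable XR_measurable) auto

text \<open>Stated for arbitrary observations \<open>y\<close>, because the converse also applies
  the decoder to integration variables in place of channel outputs.\<close>

lemma dec_measurable:
  assumes "i \<in> {1,2}"
    and "\<And>t. t < blen c \<Longrightarrow> (\<lambda>x. y x t) \<in> borel_measurable N"
    and "(\<lambda>x. csi_past (f x) (blen c)) \<in> measurable N (csi_space (blen c))"
  shows "(\<lambda>x. dec c i (csi_past (f x) (blen c), restrict (y x) {..<blen c})) \<in> measurable N (count_space UNIV)"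
proof -
  have "dec c i \<in> measurable (csi_space (blen c) \<Otimes>\<^sub>M sig_space (blen c)) (count_space UNIV)"
    using valid assms(1) unfolding valid_code_def by blast
  moreover have "(\<lambda>x. restrict (y x) {..<blen c}) \<in> measurable N (sig_space (blen c))"
    unfolding sig_space_def using assms(2) by (intro measurable_restrict) auto
  ultimately show ?thesis
    using assms(3) by (intro measurable_compose[OF measurable_Pair, of _ _ _ _ _ "dec c i"]) auto
qed

lemma decoded_measurable:
  assumes "i \<in> {1,2}" "m1 < nmsg c 1" "m2 < nmsg c 2"
  shows "decoded c i m1 m2 \<in> measurable chan_meas (count_space UNIV)"
  unfolding decoded_def[abs_def]
  by (rule dec_measurable) (use assms YD_measurable measurable_csi_past in auto)

end

section \<open>Mixtures of Gaussian densities\<close>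

text \<open>Likelihood of the outputs before time \<open>t\<close> at the receiver with noise
  coordinate \<open>p\<close> under hypothesis \<open>b\<close>, whose noiseless signal is
  \<open>\<sigma> s b\<close>.\<close>

definition wt1 :: "nat \<Rightarrow> (nat \<Rightarrow> nat \<Rightarrow> complex) \<Rightarrow> nat \<Rightarrow> nat \<Rightarrow> (nat \<times> nat \<Rightarrow> complex) \<Rightarrow> real" where
  "wt1 p \<sigma> t b y = (\<Prod>s<t. Ndens (y (s, p) - \<sigma> s b))"

definition wt2 :: "nat \<Rightarrow> nat \<Rightarrow> (nat \<Rightarrow> nat \<Rightarrow> complex) \<Rightarrow> (nat \<Rightarrow> nat \<Rightarrow> complex) \<Rightarrow> nat \<Rightarrow> nat \<Rightarrow> (nat \<times> nat \<Rightarrow> complex) \<Rightarrow> real" where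
  "wt2 p q \<sigma> \<tau> t b y = (\<Prod>s<t. Ndens (y (s, p) - \<sigma> s b) * Ndens (y (s, q) - \<tau> s b))"

text \<open>A sum, not an average, over the \<open>M\<close> equally likely hypotheses:
  \<open>M\<close> times a probability density. This is the origin of the factors
  \<open>real M\<close> in later ratios.\<close>

definition mix1 :: "nat \<Rightarrow> (nat \<Rightarrow> nat \<Rightarrow> complex) \<Rightarrow> nat \<Rightarrow> nat \<Rightarrow> (nat \<times> nat \<Rightarrow> complex) \<Rightarrow> real" where
  "mix1 p \<sigma> M t y = (\<Sum>b<M. wt1 p \<sigma> t b y)"

definition mix2 :: "nat \<Rightarrow> nat \<Rightarrow> (nat \<Rightarrow> nat \<Rightarrow> complex) \<Rightarrow> (nat \<Rightarrow> nat \<Rightarrow> complex) \<Rightarrow> nat \<Rightarrow> nat \<Rightarrow> (nat \<times> nat \<Rightarrow> complex) \<Rightarrow> real" where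
  "mix2 p q \<sigma> \<tau> M t y = (\<Sum>b<M. wt2 p q \<sigma> \<tau> t b y)"

text \<open>The predictive density of the output at coordinate \<open>r\<close> (with signal \<open>\<rho>\<close>) at time \<open>t\<close>, given
  all earlier outputs at both receivers.\<close>

definition predictive :: "nat \<Rightarrow> nat \<Rightarrow> (nat \<Rightarrow> nat \<Rightarrow> complex) \<Rightarrow> (nat \<Rightarrow> nat \<Rightarrow> complex) \<Rightarrow> nat \<Rightarrow> (nat \<Rightarrow> nat \<Rightarrow> complex) \<Rightarrow> nat \<Rightarrow> nat \<Rightarrow> (nat \<times> nat \<Rightarrow> complex) \<Rightarrow> real" where
  "predictive p q \<sigma> \<tau> r \<rho> M t y = (\<Sum>b<M. wt2 p q \<sigma> \<tau> t b y * Ndens (y (t, r) - \<rho> t b)) / mix2 p q \<sigma> \<tau> M t y"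

lemma wt1_pos [simp]: "wt1 p \<sigma> t b y > 0"
  by (simp add: wt1_def prod_pos)

lemma wt2_pos [simp]: "wt2 p q \<sigma> \<tau> t b y > 0"
  by (simp add: wt2_def prod_pos)

lemma wt1_nonneg [simp]: "wt1 p \<sigma> t b y \<ge> 0"
  using wt1_pos less_imp_le by blast

lemma wt2_nonneg [simp]: "wt2 p q \<sigma> \<tau> t b y \<ge> 0"
  using wt2_pos less_imp_le by blast

lemma wt1_le_1: "wt1 p \<sigma> t b y \<le> 1"
  by (auto simp: wt1_def Ndens_le_1 intro!: prod_le_1)

lemma wt2_le_wt1: "wt2 p q \<sigma> \<tau> t b y \<le> wt1 p \<sigma> t b y"
  unfolding wt2_def wt1_def
  by (intro prod_mono) (simp add: mult_left_le Ndens_le_1)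

lemma wt2_le_1: "wt2 p q \<sigma> \<tau> t b y \<le> 1"
  using wt2_le_wt1 wt1_le_1 order_trans by blast

lemma wt2_Suc: "wt2 p q \<sigma> \<tau> (Suc t) b y = wt2 p q \<sigma> \<tau> t b y * (Ndens (y (t, p) - \<sigma> t b) * Ndens (y (t, q) - \<tau> t b))"
  by (simp add: wt2_def)

lemma wt1_Suc: "wt1 p \<sigma> (Suc t) b y = wt1 p \<sigma> t b y * Ndens (y (t, p) - \<sigma> t b)"
  by (simp add: wt1_def)

lemma wt2_antimono: "s \<le> t \<Longrightarrow> wt2 p q \<sigma> \<tau> t b y \<le> wt2 p q \<sigma> \<tau> s b y"
proof (induction t)
  case (Suc t)
  have "wt2 p q \<sigma> \<tau> (Suc t) b y \<le> wt2 p q \<sigma> \<tau> t b y"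
    unfolding wt2_Suc by (simp add: mult_le_one Ndens_le_1 mult_left_le)
  then show ?case using Suc by (cases "s = Suc t") auto
qed simp

lemma mix1_pos: "M > 0 \<Longrightarrow> mix1 p \<sigma> M t y > 0"
  unfolding mix1_def by (rule sum_pos) auto

lemma mix2_pos: "M > 0 \<Longrightarrow> mix2 p q \<sigma> \<tau> M t y > 0"
  unfolding mix2_def by (rule sum_pos) auto

lemma mix1_le: "mix1 p \<sigma> M t y \<le> real M"
  unfolding mix1_def using sum_mono[of "{..<M}" "\<lambda>b. wt1 p \<sigma> t b y" "\<lambda>_. 1"] wt1_le_1 by simp

lemma mix2_le: "mix2 p q \<sigma> \<tau> M t y \<le> real M"
  unfolding mix2_def using sum_mono[of "{..<M}" "\<lambda>b. wt2 p q \<sigma> \<tau> t b y" "\<lambda>_. 1"] wt2_le_1 by simp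

lemma wt1_le_mix1: "b < M \<Longrightarrow> wt1 p \<sigma> t b y \<le> mix1 p \<sigma> M t y"
  unfolding mix1_def by (rule member_le_sum) auto

lemma wt2_le_mix2: "b < M \<Longrightarrow> wt2 p q \<sigma> \<tau> t b y \<le> mix2 p q \<sigma> \<tau> M t y"
  unfolding mix2_def by (rule member_le_sum) auto

lemma predictive_pos: "M > 0 \<Longrightarrow> predictive p q \<sigma> \<tau> r \<rho> M t y > 0"
  unfolding predictive_def by (intro divide_pos_pos mix2_pos sum_pos mult_pos_pos) auto

lemma predictive_le_1:
  assumes "M > 0" shows "predictive p q \<sigma> \<tau> r \<rho> M t y \<le> 1"
proof -
  have "(\<Sum>b<M. wt2 p q \<sigma> \<tau> t b y * Ndens (y (t, r) - \<rho> t b)) \<le> mix2 p q \<sigma> \<tau> M t y"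
    unfolding mix2_def by (intro sum_mono) (simp add: mult_left_le Ndens_le_1)
  then show ?thesis using mix2_pos[OF assms] by (simp add: predictive_def)
qed

lemma predictive_ge:
  assumes "b < M"
  shows "wt2 p q \<sigma> \<tau> t b y * Ndens (y (t, r) - \<rho> t b) / real M \<le> predictive p q \<sigma> \<tau> r \<rho> M t y"
  unfolding predictive_def
proof (rule frac_le)
  show "0 \<le> (\<Sum>b<M. wt2 p q \<sigma> \<tau> t b y * Ndens (y (t, r) - \<rho> t b))"
    by (intro sum_nonneg mult_nonneg_nonneg) auto
  show "wt2 p q \<sigma> \<tau> t b y * Ndens (y (t, r) - \<rho> t b) \<le> (\<Sum>b<M. wt2 p q \<sigma> \<tau> t b y * Ndens (y (t, r) - \<rho> t b))"
    using assms by (intro member_le_sum) (auto simp: mult_nonneg_nonneg)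
qed (use assms mix2_pos mix2_le in auto)

text \<open>Together with \<open>predictive_le_1\<close> this traps the logarithm of a predictive
  density between integrable functions: the likelihood of any single hypothesis is a lower bound, as
  omitted factors are at most 1.\<close>

lemma predictive_ge':
  assumes "b < M" "t < n" "(r, \<rho>) = (p, \<sigma>) \<or> (r, \<rho>) = (q, \<tau>)"
  shows "wt2 p q \<sigma> \<tau> n b y / real M \<le> predictive p q \<sigma> \<tau> r \<rho> M t y"
proof -
  have "wt2 p q \<sigma> \<tau> n b y \<le> wt2 p q \<sigma> \<tau> (Suc t) b y"
    using assms by (intro wt2_antimono) auto
  also have "\<dots> \<le> wt2 p q \<sigma> \<tau> t b y * Ndens (y (t, r) - \<rho> t b)"
    unfolding wt2_Suc using assms(3) by (auto intro!: mult_left_mono simp: mult_left_le mult_right_le_one_le mult_left_le_one_le Ndens_le_1)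
  finally have "wt2 p q \<sigma> \<tau> n b y / real M \<le> wt2 p q \<sigma> \<tau> t b y * Ndens (y (t, r) - \<rho> t b) / real M"
    using assms(1) by (intro divide_right_mono) auto
  also have "\<dots> \<le> predictive p q \<sigma> \<tau> r \<rho> M t y" by (rule predictive_ge[OF assms(1)])
  finally show ?thesis .
qed

lemma wt1_measurable:
  assumes "\<And>s. s < t \<Longrightarrow> (\<lambda>x. Y x (s, p)) \<in> borel_measurable N"
    and "\<And>s. s < t \<Longrightarrow> (\<lambda>x. \<sigma> x s b) \<in> borel_measurable N"
  shows "(\<lambda>x. wt1 p (\<sigma> x) t b (Y x)) \<in> borel_measurable N"
  unfolding wt1_def using assms
  by (intro borel_measurable_prod measurable_compose[OF _ Ndens_measurable] borel_measurable_diff) auto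

lemma wt2_measurable:
  assumes "\<And>s. s < t \<Longrightarrow> (\<lambda>x. Y x (s, p)) \<in> borel_measurable N"
    and "\<And>s. s < t \<Longrightarrow> (\<lambda>x. Y x (s, q)) \<in> borel_measurable N"
    and "\<And>s. s < t \<Longrightarrow> (\<lambda>x. \<sigma> x s b) \<in> borel_measurable N"
    and "\<And>s. s < t \<Longrightarrow> (\<lambda>x. \<tau> x s b) \<in> borel_measurable N"
  shows "(\<lambda>x. wt2 p q (\<sigma> x) (\<tau> x) t b (Y x)) \<in> borel_measurable N"
  unfolding wt2_def using assms
  by (intro borel_measurable_prod borel_measurable_times measurable_compose[OF _ Ndens_measurable] borel_measurable_diff) auto

lemma mix1_measurable:
  assumes "\<And>s. s < t \<Longrightarrow> (\<lambda>x. Y x (s, p)) \<in> borel_measurable N"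
    and "\<And>s b. s < t \<Longrightarrow> b < M \<Longrightarrow> (\<lambda>x. \<sigma> x s b) \<in> borel_measurable N"
  shows "(\<lambda>x. mix1 p (\<sigma> x) M t (Y x)) \<in> borel_measurable N"
  unfolding mix1_def using assms by (intro borel_measurable_sum wt1_measurable) auto

lemma mix2_measurable:
  assumes "\<And>s. s < t \<Longrightarrow> (\<lambda>x. Y x (s, p)) \<in> borel_measurable N"
    and "\<And>s. s < t \<Longrightarrow> (\<lambda>x. Y x (s, q)) \<in> borel_measurable N"
    and "\<And>s b. s < t \<Longrightarrow> b < M \<Longrightarrow> (\<lambda>x. \<sigma> x s b) \<in> borel_measurable N"
    and "\<And>s b. s < t \<Longrightarrow> b < M \<Longrightarrow> (\<lambda>x. \<tau> x s b) \<in> borel_measurable N"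
  shows "(\<lambda>x. mix2 p q (\<sigma> x) (\<tau> x) M t (Y x)) \<in> borel_measurable N"
  unfolding mix2_def using assms by (intro borel_measurable_sum wt2_measurable) auto

lemma predictive_measurable:
  assumes "\<And>s. s \<le> t \<Longrightarrow> (\<lambda>x. Y x (s, p)) \<in> borel_measurable N"
    and "\<And>s. s \<le> t \<Longrightarrow> (\<lambda>x. Y x (s, q)) \<in> borel_measurable N"
    and "\<And>s b. s \<le> t \<Longrightarrow> b < M \<Longrightarrow> (\<lambda>x. \<sigma> x s b) \<in> borel_measurable N"
    and "\<And>s b. s \<le> t \<Longrightarrow> b < M \<Longrightarrow> (\<lambda>x. \<tau> x s b) \<in> borel_measurable N"
    and "(\<lambda>x. Y x (t, r)) \<in> borel_measurable N"
    and "\<And>b. b < M \<Longrightarrow> (\<lambda>x. \<rho> x t b) \<in> borel_measurable N"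
  shows "(\<lambda>x. predictive p q (\<sigma> x) (\<tau> x) r (\<rho> x) M t (Y x)) \<in> borel_measurable N"
  unfolding predictive_def using assms
  by (intro borel_measurable_divide mix2_measurable borel_measurable_sum borel_measurable_times wt2_measurable
      measurable_compose[OF _ Ndens_measurable] borel_measurable_diff) auto

lemma wt2_cong:
  "(\<And>s. s < t \<Longrightarrow> y (s, p) = y' (s, p) \<and> y (s, q) = y' (s, q)) \<Longrightarrow> wt2 p q \<sigma> \<tau> t b y = wt2 p q \<sigma> \<tau> t b y'"
  unfolding wt2_def by (intro prod.cong) auto

lemma wt1_cong:
  "(\<And>s. s < t \<Longrightarrow> y (s, p) = y' (s, p)) \<Longrightarrow> wt1 p \<sigma> t b y = wt1 p \<sigma> t b y'"
  unfolding wt1_def by (intro prod.cong) auto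

lemma mix2_cong:
  "(\<And>s. s < t \<Longrightarrow> y (s, p) = y' (s, p) \<and> y (s, q) = y' (s, q)) \<Longrightarrow> mix2 p q \<sigma> \<tau> M t y = mix2 p q \<sigma> \<tau> M t y'"
  unfolding mix2_def by (intro sum.cong wt2_cong) auto

lemma mix1_cong:
  "(\<And>s. s < t \<Longrightarrow> y (s, p) = y' (s, p)) \<Longrightarrow> mix1 p \<sigma> M t y = mix1 p \<sigma> M t y'"
  unfolding mix1_def by (intro sum.cong wt1_cong) auto

lemma predictive_cong:
  assumes "\<And>s. s < t \<Longrightarrow> y (s, p) = y' (s, p) \<and> y (s, q) = y' (s, q)" "y (t, r) = y' (t, r)"
  shows "predictive p q \<sigma> \<tau> r \<rho> M t y = predictive p q \<sigma> \<tau> r \<rho> M t y'"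
proof -
  have "wt2 p q \<sigma> \<tau> t b y = wt2 p q \<sigma> \<tau> t b y'" for b
    using assms(1) by (rule wt2_cong)
  then show ?thesis
    unfolding predictive_def using mix2_cong[of t y p y' q] assms by (simp add: mix2_def)
qed

section \<open>Integrals of products of one-step ratios\<close>

text \<open>Factor \<open>t\<close> sees only outputs up to time \<open>t\<close>, so integrating
  the last pair of outputs first strips off one factor at a time, as for a supermartingale.\<close>

lemma nn_integral_prod_le_1:
  fixes r :: "nat \<Rightarrow> (nat \<times> nat \<Rightarrow> complex) \<Rightarrow> real"
  assumes pq: "p \<noteq> q"
    and nonneg: "\<And>t y. r t y \<ge> 0"
    and meas: "\<And>t n. t < n \<Longrightarrow> r t \<in> borel_measurable (leb ({..<n} \<times> {p, q}))"
    and dep: "\<And>t y y'. (\<And>s. s \<le> t \<Longrightarrow> y (s, p) = y' (s, p) \<and> y (s, q) = y' (s, q)) \<Longrightarrow> r t y = r t y'"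
    and step: "\<And>t y. (\<integral>\<^sup>+ u. \<integral>\<^sup>+ v. ennreal (r t (y((t, p) := u, (t, q) := v))) \<partial>lborel \<partial>lborel) \<le> 1"
  shows "(\<integral>\<^sup>+ y. ennreal (\<Prod>t<n. r t y) \<partial>leb ({..<n} \<times> {p, q})) \<le> 1"
proof (induction n)
  case 0
  then show ?case by (simp add: PiM_empty nn_integral_count_space_finite)
next
  case (Suc n)
  let ?J = "{..<n} \<times> {p, q}" and ?R = "\<lambda>y. ennreal (\<Prod>t<Suc n. r t y)"
  have J: "{..<Suc n} \<times> {p, q} = insert (n, q) (insert (n, p) ?J)" by auto
  have fin: "finite ?J" "finite (insert (n, p) ?J)" by auto
  have nin: "(n, p) \<notin> ?J" "(n, q) \<notin> insert (n, p) ?J" using pq by auto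
  have R: "?R \<in> borel_measurable (PiM (insert (n, q) (insert (n, p) ?J)) (\<lambda>_. lborel))"
    unfolding J[symmetric]
    by (intro measurable_compose[OF _ measurable_ennreal] borel_measurable_prod meas) auto
  have R': "(\<lambda>x. \<integral>\<^sup>+ v. ?R (x((n, q) := v)) \<partial>lborel) \<in> borel_measurable (PiM (insert (n, p) ?J) (\<lambda>_. lborel))"
  proof -
    show ?thesis
      by (rule lborel.borel_measurable_nn_integral)
         (use measurable_compose[OF measurable_add_dim R] in \<open>simp add: split_beta'\<close>)
  qed
  have "(\<integral>\<^sup>+ y. ?R y \<partial>PiM ({..<Suc n} \<times> {p, q}) (\<lambda>_. lborel)) =
    (\<integral>\<^sup>+ y. \<integral>\<^sup>+ u. \<integral>\<^sup>+ v. ?R (y((n, p) := u, (n, q) := v)) \<partial>lborel \<partial>lborel \<partial>PiM ?J (\<lambda>_. lborel))"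
    unfolding J lb.product_nn_integral_insert[OF fin(2) nin(2) R]
    by (rule lb.product_nn_integral_insert[OF fin(1) nin(1) R'])
  also have "\<dots> \<le> (\<integral>\<^sup>+ y. ennreal (\<Prod>t<n. r t y) \<partial>PiM ?J (\<lambda>_. lborel))"
  proof (rule nn_integral_mono)
    fix y :: "nat \<times> nat \<Rightarrow> complex"
    assume y: "y \<in> space (PiM ?J (\<lambda>_. lborel))"
    let ?y = "\<lambda>u v. y((n, p) := u, (n, q) := v)"
    have e: "(\<Prod>t<n. r t (?y u v)) = (\<Prod>t<n. r t y)" for u v
      by (intro prod.cong refl dep) auto
    have R2: "(\<lambda>v. ennreal (r n (?y u v))) \<in> borel_measurable lborel" for u
    proof -
      have "y((n, p) := u) \<in> space (PiM (insert (n, p) ?J) (\<lambda>_. lborel))"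
        using y by (auto simp: space_PiM PiE_def extensional_def)
      then have m: "(\<lambda>v. ?y u v) \<in> measurable lborel (PiM ({..<Suc n} \<times> {p, q}) (\<lambda>_. lborel))"
        unfolding J by (intro measurable_fun_upd[where J = "insert (n, p) ?J"] measurable_const) auto
      show ?thesis
        using measurable_compose[OF m meas[of n "Suc n"]] by simp
    qed
    have R3: "(\<lambda>u. \<integral>\<^sup>+ v. ennreal (r n (?y u v)) \<partial>lborel) \<in> borel_measurable lborel"
    proof -
      have m1: "(\<lambda>x. y((n, p) := fst x)) \<in> measurable (lborel \<Otimes>\<^sub>M lborel) (PiM (insert (n, p) ?J) (\<lambda>_. lborel))"
        using y by (intro measurable_fun_upd[where J = ?J] measurable_const) auto
      have m: "(\<lambda>x. ?y (fst x) (snd x)) \<in> measurable (lborel \<Otimes>\<^sub>M lborel) (PiM ({..<Suc n} \<times> {p, q}) (\<lambda>_. lborel))"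
        unfolding J by (intro measurable_fun_upd[where J = "insert (n, p) ?J"] m1) auto
      have "(\<lambda>x. ennreal (r n (?y (fst x) (snd x)))) \<in> borel_measurable (lborel \<Otimes>\<^sub>M lborel)"
        using measurable_compose[OF m meas[of n "Suc n"]] by simp
      then show ?thesis
        by (intro lborel.borel_measurable_nn_integral) (simp add: split_beta')
    qed
    have "(\<integral>\<^sup>+ u. \<integral>\<^sup>+ v. ?R (?y u v) \<partial>lborel \<partial>lborel) =
      (\<integral>\<^sup>+ u. \<integral>\<^sup>+ v. ennreal (\<Prod>t<n. r t y) * ennreal (r n (?y u v)) \<partial>lborel \<partial>lborel)"
      by (simp add: e ennreal_mult prod_nonneg nonneg)
    also have "\<dots> = ennreal (\<Prod>t<n. r t y) * (\<integral>\<^sup>+ u. \<integral>\<^sup>+ v. ennreal (r n (?y u v)) \<partial>lborel \<partial>lborel)"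
      using R2 R3 by (simp add: nn_integral_cmult)
    also have "\<dots> \<le> ennreal (\<Prod>t<n. r t y) * 1"
      by (intro mult_left_mono step) simp
    finally show "(\<integral>\<^sup>+ u. \<integral>\<^sup>+ v. ?R (?y u v) \<partial>lborel \<partial>lborel) \<le> ennreal (\<Prod>t<n. r t y)" by simp
  qed
  also have "\<dots> \<le> 1" by (rule Suc)
  finally show ?case .
qed

lemma nn_integral_mixture:
  assumes "\<And>b. b < M \<Longrightarrow> c b \<ge> 0"
  shows "(\<integral>\<^sup>+ u. ennreal (\<Sum>b<M. c b * Ndens (u - \<sigma> b)) \<partial>lborel) = ennreal (\<Sum>b<M. c b)"
proof -
  have "(\<integral>\<^sup>+ u. ennreal (\<Sum>b<M. c b * Ndens (u - \<sigma> b)) \<partial>lborel)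
    = (\<integral>\<^sup>+ u. (\<Sum>b<M. ennreal (c b) * ennreal (Ndens (u - \<sigma> b))) \<partial>lborel)"
    using assms by (intro nn_integral_cong) (subst sum_ennreal[symmetric], auto simp: ennreal_mult)
  also have "\<dots> = (\<Sum>b<M. \<integral>\<^sup>+ u. ennreal (c b) * ennreal (Ndens (u - \<sigma> b)) \<partial>lborel)"
    by (rule nn_integral_sum) auto
  also have "\<dots> = (\<Sum>b<M. ennreal (c b))"
    by (intro sum.cong refl) (simp add: nn_integral_cmult nn_integral_Ndens_shift)
  also have "\<dots> = ennreal (\<Sum>b<M. c b)" using assms by (intro sum_ennreal) auto
  finally show ?thesis .
qed

lemma predictive_upd:
  assumes "p \<noteq> q" "r \<in> {p, q}" "M > 0"
  shows "(\<integral>\<^sup>+ u. ennreal (predictive p q \<sigma> \<tau> r \<rho> M t (y((t, r) := u))) \<partial>lborel) = 1"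
proof -
  have w: "wt2 p q \<sigma> \<tau> t b (y((t, r) := u)) = wt2 p q \<sigma> \<tau> t b y" for b u
    by (intro wt2_cong) auto
  have m: "mix2 p q \<sigma> \<tau> M t (y((t, r) := u)) = mix2 p q \<sigma> \<tau> M t y" for u
    by (intro mix2_cong) auto
  have pos: "mix2 p q \<sigma> \<tau> M t y > 0" by (rule mix2_pos[OF assms(3)])
  have "(\<integral>\<^sup>+ u. ennreal (predictive p q \<sigma> \<tau> r \<rho> M t (y((t, r) := u))) \<partial>lborel) =
    (\<integral>\<^sup>+ u. ennreal (\<Sum>b<M. (wt2 p q \<sigma> \<tau> t b y / mix2 p q \<sigma> \<tau> M t y) * Ndens (u - \<rho> t b)) \<partial>lborel)"
    by (simp add: predictive_def w m sum_divide_distrib)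
  also have "\<dots> = ennreal (\<Sum>b<M. wt2 p q \<sigma> \<tau> t b y / mix2 p q \<sigma> \<tau> M t y)"
    by (rule nn_integral_mixture) (use pos in auto)
  also have "\<dots> = 1"
    using pos by (simp add: sum_divide_distrib[symmetric] mix2_def[symmetric])
  finally show ?thesis .
qed

text \<open>Given the past, the two marginal predictive densities involve different new outputs, so
  each double integral splits into two integrals equal to 1.\<close>

lemma nn_integral_predictive_le_1:
  assumes pq: "p \<noteq> q" and M: "M > 0"
  shows "(\<integral>\<^sup>+ y. ennreal (\<Prod>t<n. predictive p q \<sigma> \<tau> p \<sigma> M t y * predictive p q \<sigma> \<tau> q \<tau> M t y)
     \<partial>leb ({..<n} \<times> {p, q})) \<le> 1"
proof (rule nn_integral_prod_le_1[OF pq])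
  fix t y
  show "predictive p q \<sigma> \<tau> p \<sigma> M t y * predictive p q \<sigma> \<tau> q \<tau> M t y \<ge> 0"
    using predictive_pos[OF M] by (intro mult_nonneg_nonneg less_imp_le) auto
next
  fix t n :: nat assume "t < n"
  then show "(\<lambda>y. predictive p q \<sigma> \<tau> p \<sigma> M t y * predictive p q \<sigma> \<tau> q \<tau> M t y) \<in> borel_measurable (leb ({..<n} \<times> {p, q}))"
    by (intro borel_measurable_times predictive_measurable measurable_PiM_lborel_coord) auto
next
  fix t and y y' :: "nat \<times> nat \<Rightarrow> complex"
  assume "\<And>s. s \<le> t \<Longrightarrow> y (s, p) = y' (s, p) \<and> y (s, q) = y' (s, q)"
  then show "predictive p q \<sigma> \<tau> p \<sigma> M t y * predictive p q \<sigma> \<tau> q \<tau> M t y = predictive p q \<sigma> \<tau> p \<sigma> M t y' * predictive p q \<sigma> \<tau> q \<tau> M t y'"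
    by (intro arg_cong2[of _ _ _ _ "(*)"] predictive_cong) auto
next
  fix t and y :: "nat \<times> nat \<Rightarrow> complex"
  let ?y = "\<lambda>u v. y((t, p) := u, (t, q) := v)"
  have p: "predictive p q \<sigma> \<tau> p \<sigma> M t (?y u v) = predictive p q \<sigma> \<tau> p \<sigma> M t (y((t, p) := u))" for u v
    using pq by (intro predictive_cong) auto
  have q: "predictive p q \<sigma> \<tau> q \<tau> M t (?y u v) = predictive p q \<sigma> \<tau> q \<tau> M t (y((t, q) := v))" for u v
    by (intro predictive_cong) auto
  have mq: "(\<lambda>v. predictive p q \<sigma> \<tau> q \<tau> M t (y((t, q) := v))) \<in> borel_measurable lborel"
    by (rule predictive_measurable) (auto simp: fun_upd_def)
  have "(\<integral>\<^sup>+ u. \<integral>\<^sup>+ v. ennreal (predictive p q \<sigma> \<tau> p \<sigma> M t (?y u v) * predictive p q \<sigma> \<tau> q \<tau> M t (?y u v)) \<partial>lborel \<partial>lborel)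
    = (\<integral>\<^sup>+ u. ennreal (predictive p q \<sigma> \<tau> p \<sigma> M t (y((t, p) := u))) \<partial>lborel)"
    using mq predictive_upd[OF pq _ M, of q \<sigma> \<tau> \<tau> t y]
    unfolding p q by (simp add: ennreal_mult less_imp_le[OF predictive_pos[OF M]] nn_integral_cmult)
  also have "\<dots> \<le> 1" using predictive_upd[OF pq _ M, of p] by simp
  finally show "(\<integral>\<^sup>+ u. \<integral>\<^sup>+ v. ennreal (predictive p q \<sigma> \<tau> p \<sigma> M t (?y u v) * predictive p q \<sigma> \<tau> q \<tau> M t (?y u v)) \<partial>lborel \<partial>lborel) \<le> 1" .
qed

lemma prod_telescope:
  fixes f :: "nat \<Rightarrow> real"
  assumes "\<And>t. f t > 0"
  shows "(\<Prod>t<n. f (Suc t) / f t) = f n / f 0"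
  by (induction n) (use assms in \<open>auto simp: less_imp_neq[OF assms, symmetric]\<close>)

text \<open>Telescoping turns the integrand into one-step ratios. Integrating out the new output at
  \<open>q\<close> reduces the step of \<open>mix2\<close> to the predictive density, which cancels
  the denominator; the remaining step of \<open>mix1\<close> is a density in the new output at
  \<open>p\<close>. The square of \<open>M\<close> comes from the two mixtures at time 0.\<close>

lemma nn_integral_mix_ratio_le:
  assumes pq: "p \<noteq> q" and M: "M > 0"
  shows "(\<integral>\<^sup>+ y. ennreal (mix2 p q \<sigma> \<tau> M n y * mix1 p \<sigma> M n y / (\<Prod>t<n. predictive p q \<sigma> \<tau> p \<sigma> M t y))
     \<partial>leb ({..<n} \<times> {p, q})) \<le> ennreal ((real M)\<^sup>2)"
proof -
  define r where "r t y = (mix2 p q \<sigma> \<tau> M (Suc t) y / mix2 p q \<sigma> \<tau> M t y)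
      * (mix1 p \<sigma> M (Suc t) y / mix1 p \<sigma> M t y) / predictive p q \<sigma> \<tau> p \<sigma> M t y" for t y
  note pos = mix1_pos[OF M] mix2_pos[OF M] predictive_pos[OF M]
  have r_meas: "r t \<in> borel_measurable (leb ({..<n} \<times> {p, q}))" if "t < n" for t n
    unfolding r_def[abs_def] using that
    by (intro borel_measurable_times borel_measurable_divide predictive_measurable mix1_measurable mix2_measurable
        measurable_PiM_lborel_coord) auto
  have "(\<integral>\<^sup>+ y. ennreal (\<Prod>t<n. r t y) \<partial>leb ({..<n} \<times> {p, q})) \<le> 1"
  proof (rule nn_integral_prod_le_1[OF pq _ r_meas])
    fix t y show "r t y \<ge> 0"
      unfolding r_def by (intro less_imp_le divide_pos_pos mult_pos_pos pos)
  next
    fix t and y y' :: "nat \<times> nat \<Rightarrow> complex"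
    assume *: "\<And>s. s \<le> t \<Longrightarrow> y (s, p) = y' (s, p) \<and> y (s, q) = y' (s, q)"
    have "mix2 p q \<sigma> \<tau> M (Suc t) y = mix2 p q \<sigma> \<tau> M (Suc t) y'" "mix2 p q \<sigma> \<tau> M t y = mix2 p q \<sigma> \<tau> M t y'"
      using * by (auto intro!: mix2_cong)
    moreover have "mix1 p \<sigma> M (Suc t) y = mix1 p \<sigma> M (Suc t) y'" "mix1 p \<sigma> M t y = mix1 p \<sigma> M t y'"
      using * by (auto intro!: mix1_cong)
    moreover have "predictive p q \<sigma> \<tau> p \<sigma> M t y = predictive p q \<sigma> \<tau> p \<sigma> M t y'"
      using * by (auto intro!: predictive_cong)
    ultimately show "r t y = r t y'" by (simp add: r_def)
  next
    fix t and y :: "nat \<times> nat \<Rightarrow> complex"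
    let ?y = "\<lambda>u v. y((t, p) := u, (t, q) := v)"
    define a where "a = mix2 p q \<sigma> \<tau> M t y"
    define c where "c = mix1 p \<sigma> M t y"
    define w where "w b = wt2 p q \<sigma> \<tau> t b y" for b
    define x where "x b = wt1 p \<sigma> t b y" for b
    have a: "a > 0" and c: "c > 0" unfolding a_def c_def by (rule pos)+
    have w0: "w b > 0" and x0: "x b > 0" for b by (auto simp: w_def x_def)
    have w': "wt2 p q \<sigma> \<tau> t b (?y u v) = w b" for b u v
      unfolding w_def by (intro wt2_cong) auto
    have x': "wt1 p \<sigma> t b (?y u v) = x b" for b u v
      unfolding x_def by (intro wt1_cong) auto
    have a': "mix2 p q \<sigma> \<tau> M t (?y u v) = a" for u v
      unfolding a_def by (intro mix2_cong) auto
    have c': "mix1 p \<sigma> M t (?y u v) = c" for u v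
      unfolding c_def by (intro mix1_cong) auto
    \<comment> \<open>\<open>f\<close> predicts the new output at \<open>p\<close> from the past of
      both receivers; \<open>g\<close> below predicts it from the past of \<open>p\<close>
      alone.\<close>
    define f where "f u = (\<Sum>b<M. w b * Ndens (u - \<sigma> t b)) / a" for u
    have f0: "f u > 0" for u
      unfolding f_def using a w0 M by (intro divide_pos_pos sum_pos) (auto intro!: mult_pos_pos)
    define g where "g u = (\<Sum>b<M. x b * Ndens (u - \<sigma> t b)) / c" for u
    have g0: "g u > 0" for u
      unfolding g_def using c x0 M by (intro divide_pos_pos sum_pos) (auto intro!: mult_pos_pos)
    have r: "r t (?y u v) = (g u / f u) * ((\<Sum>b<M. (w b * Ndens (u - \<sigma> t b)) * Ndens (v - \<tau> t b)) / a)" for u v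
      unfolding r_def predictive_def mix2_def[of _ _ _ _ _ "Suc t"] mix1_def[of _ _ _ "Suc t"] wt2_Suc wt1_Suc a' c' w' x'
      using pq by (simp add: f_def g_def field_simps)
    have inner: "(\<integral>\<^sup>+ v. ennreal (r t (?y u v)) \<partial>lborel) = ennreal (g u)" for u
    proof -
      have "(\<integral>\<^sup>+ v. ennreal (r t (?y u v)) \<partial>lborel) =
        (\<integral>\<^sup>+ v. ennreal (\<Sum>b<M. (g u / f u * (w b * Ndens (u - \<sigma> t b)) / a) * Ndens (v - \<tau> t b)) \<partial>lborel)"
        unfolding r by (simp add: sum_distrib_left sum_divide_distrib field_simps)
      also have "\<dots> = ennreal (\<Sum>b<M. g u / f u * (w b * Ndens (u - \<sigma> t b)) / a)"
        by (rule nn_integral_mixture) (use f0[of u] g0[of u] a w0 in \<open>auto intro!: divide_nonneg_nonneg mult_nonneg_nonneg less_imp_le\<close>)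
      also have "(\<Sum>b<M. g u / f u * (w b * Ndens (u - \<sigma> t b)) / a) = g u / f u * f u"
        by (simp add: f_def sum_distrib_left sum_divide_distrib)
      also have "\<dots> = g u" using f0[of u] by simp
      finally show ?thesis .
    qed
    have "(\<integral>\<^sup>+ u. ennreal (g u) \<partial>lborel) = (\<integral>\<^sup>+ u. ennreal (\<Sum>b<M. (x b / c) * Ndens (u - \<sigma> t b)) \<partial>lborel)"
      by (simp add: g_def sum_divide_distrib)
    also have "\<dots> = ennreal (\<Sum>b<M. x b / c)"
      by (rule nn_integral_mixture) (use c x0 in \<open>auto intro!: less_imp_le\<close>)
    also have "(\<Sum>b<M. x b / c) = 1"
      using c by (simp add: sum_divide_distrib[symmetric] c_def mix1_def x_def)
    finally show "(\<integral>\<^sup>+ u. \<integral>\<^sup>+ v. ennreal (r t (?y u v)) \<partial>lborel \<partial>lborel) \<le> 1"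
      by (simp add: inner)
  qed
  moreover have "mix2 p q \<sigma> \<tau> M n y * mix1 p \<sigma> M n y / (\<Prod>t<n. predictive p q \<sigma> \<tau> p \<sigma> M t y)
     = (real M)\<^sup>2 * (\<Prod>t<n. r t y)" for y
  proof -
    have "mix2 p q \<sigma> \<tau> M 0 y = real M" "mix1 p \<sigma> M 0 y = real M"
      by (simp_all add: mix2_def mix1_def wt2_def wt1_def)
    then have T: "(\<Prod>t<n. mix2 p q \<sigma> \<tau> M (Suc t) y / mix2 p q \<sigma> \<tau> M t y) = mix2 p q \<sigma> \<tau> M n y / real M"
      "(\<Prod>t<n. mix1 p \<sigma> M (Suc t) y / mix1 p \<sigma> M t y) = mix1 p \<sigma> M n y / real M"
      using prod_telescope[of "\<lambda>t. mix2 p q \<sigma> \<tau> M t y" n] prod_telescope[of "\<lambda>t. mix1 p \<sigma> M t y" n] pos by auto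
    have "(\<Prod>t<n. r t y) = (\<Prod>t<n. mix2 p q \<sigma> \<tau> M (Suc t) y / mix2 p q \<sigma> \<tau> M t y)
        * (\<Prod>t<n. mix1 p \<sigma> M (Suc t) y / mix1 p \<sigma> M t y) / (\<Prod>t<n. predictive p q \<sigma> \<tau> p \<sigma> M t y)"
      by (simp add: r_def prod_dividef prod.distrib)
    then show ?thesis
      unfolding T using M by (simp add: power2_eq_square)
  qed
  ultimately have "(\<integral>\<^sup>+ y. ennreal (mix2 p q \<sigma> \<tau> M n y * mix1 p \<sigma> M n y / (\<Prod>t<n. predictive p q \<sigma> \<tau> p \<sigma> M t y))
     \<partial>leb ({..<n} \<times> {p, q})) = (\<integral>\<^sup>+ y. ennreal ((real M)\<^sup>2) * ennreal (\<Prod>t<n. r t y)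
     \<partial>leb ({..<n} \<times> {p, q}))"
    by (intro nn_integral_cong) (auto simp: ennreal_mult'[symmetric])
  also have "\<dots> = ennreal ((real M)\<^sup>2) * (\<integral>\<^sup>+ y. ennreal (\<Prod>t<n. r t y) \<partial>leb ({..<n} \<times> {p, q}))"
    using r_meas by (intro nn_integral_cmult measurable_compose[OF _ measurable_ennreal] borel_measurable_prod) auto
  also have "\<dots> \<le> ennreal ((real M)\<^sup>2) * 1"
    by (intro mult_left_mono) (fact, simp)
  finally show ?thesis by simp
qed

section \<open>The converse\<close>

text \<open>Swaps G11 with G21, G12 with G22 and Z_D1 with Z_D2; the first hop, coordinates 0 to 3
  and 8, 9, stays fixed.\<close>

definition flip_perm :: "nat \<Rightarrow> nat" where
  "flip_perm k = (if k = 4 then 6 else if k = 6 then 4 else if k = 5 then 7 else if k = 7 then 5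
     else if k = 10 then 11 else if k = 11 then 10 else k)"

text \<open>Exchanges the two receivers at time \<open>t\<close>.\<close>

definition flip :: "nat \<Rightarrow> (nat \<Rightarrow> nat \<Rightarrow> complex) \<Rightarrow> nat \<Rightarrow> nat \<Rightarrow> complex" where
  "flip t w = w(t := (\<lambda>k\<in>{..<12}. w t (flip_perm k)))"

lemma flip_perm_less: "k < 12 \<Longrightarrow> flip_perm k < 12"
  by (auto simp: flip_perm_def)

lemma flip_measurable: "flip t \<in> measurable chan_meas chan_meas"
proof (rule measurable_chanI)
  fix s k :: nat assume "k < 12"
  then show "(\<lambda>w. flip t w s k) \<in> borel_measurable chan_meas"
    using measurable_chan_coord[OF flip_perm_less] measurable_chan_coord
    by (cases "s = t") (auto simp: flip_def)
qed (auto simp: flip_def space_chan)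

lemma nn_integral_slot_flip:
  assumes "F \<in> borel_measurable slot_meas"
  shows "(\<integral>\<^sup>+ v. F v \<partial>slot_meas) = (\<integral>\<^sup>+ v. F (\<lambda>k\<in>{..<12}. v (flip_perm k)) \<partial>slot_meas)"
proof -
  have d: "distr slot_meas slot_meas (\<lambda>v. \<lambda>k\<in>{..<12}. v (flip_perm k)) = slot_meas"
    by (rule distr_PiM_reindex[where M = "\<lambda>_. CN01"])
      (auto simp: prob_space_CN01 inj_on_def flip_perm_def split: if_splits)
  have m: "(\<lambda>v. \<lambda>k\<in>{..<12}. v (flip_perm k)) \<in> measurable slot_meas slot_meas"
    by (intro measurable_restrict measurable_component_singleton) (auto simp: flip_perm_less)
  show ?thesis
    by (subst d[symmetric], rule nn_integral_distr[OF m]) (use assms d in auto)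
qed

text \<open>Resampling use \<open>t\<close> reduces the claim to a permutation of finitely many
  i.i.d. coordinates.\<close>

lemma distr_flip: "distr chan_meas chan_meas (flip t) = chan_meas"
proof (rule measure_eqI)
  fix A assume A: "A \<in> sets (distr chan_meas chan_meas (flip t))"
  then have A': "A \<in> sets chan_meas" by simp
  have [measurable]: "indicator A \<in> borel_measurable chan_meas" using A' by simp
  have "emeasure chan_meas A = (\<integral>\<^sup>+ w. indicator A w \<partial>chan_meas)"
    using A' by simp
  also have "\<dots> = (\<integral>\<^sup>+ w. \<integral>\<^sup>+ v. indicator A (w(t := v)) \<partial>slot_meas \<partial>chan_meas)"
    by (rule nn_integral_chan_slot) measurable
  also have "\<dots> = (\<integral>\<^sup>+ w. \<integral>\<^sup>+ v. indicator A (w(t := (\<lambda>k\<in>{..<12}. v (flip_perm k)))) \<partial>slot_meas \<partial>chan_meas)"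
  proof (rule nn_integral_cong)
    fix w assume w: "w \<in> space chan_meas"
    have "(\<lambda>v. w(t := v)) \<in> measurable slot_meas chan_meas"
      using w by (intro measurable_chan_upd) auto
    then have "(\<lambda>v. indicator A (w(t := v)) :: ennreal) \<in> borel_measurable slot_meas"
      by (rule measurable_compose) measurable
    then show "(\<integral>\<^sup>+ v. indicator A (w(t := v)) \<partial>slot_meas) =
      (\<integral>\<^sup>+ v. (indicator A (w(t := (\<lambda>k\<in>{..<12}. v (flip_perm k)))) :: ennreal) \<partial>slot_meas)"
      by (rule nn_integral_slot_flip)
  qed
  also have "\<dots> = (\<integral>\<^sup>+ w. \<integral>\<^sup>+ v. indicator A (flip t (w(t := v))) \<partial>slot_meas \<partial>chan_meas)"
    by (simp add: flip_def)
  also have "\<dots> = (\<integral>\<^sup>+ w. indicator A (flip t w) \<partial>chan_meas)"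
    using measurable_compose[OF flip_measurable, of "indicator A" borel t]
    by (intro nn_integral_chan_slot[symmetric]) simp
  also have "\<dots> = emeasure (distr chan_meas chan_meas (flip t)) A"
    using A' flip_measurable[of t]
    by (subst nn_integral_distr[symmetric, OF flip_measurable]) auto
  finally show "emeasure (distr chan_meas chan_meas (flip t)) A = emeasure chan_meas A" by simp
qed simp

lemma integral_flip:
  fixes f :: "_ \<Rightarrow> real"
  assumes "f \<in> borel_measurable chan_meas"
  shows "(\<integral> w. f (flip t w) \<partial>chan_meas) = (\<integral> w. f w \<partial>chan_meas)"
  using integral_distr[OF flip_measurable assms, of t] by (simp add: distr_flip)

text \<open>A factor of unit second moment that is independent of the signal preserves expected
  energy. With \<open>X\<close> constant this is also the energy of the noise.\<close>

lemma second_moment_chan: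
  assumes k: "k < 12" and [measurable]: "X \<in> borel_measurable chan_meas"
    and inv: "\<And>w z. X (chan_upd t k w z) = X w"
  shows "(\<integral>\<^sup>+ w. ennreal ((cmod (w t k * X w))\<^sup>2) \<partial>chan_meas) = (\<integral>\<^sup>+ w. ennreal ((cmod (X w))\<^sup>2) \<partial>chan_meas)"
proof -
  have [measurable]: "(\<lambda>w. w t k) \<in> borel_measurable chan_meas" using k by measurable
  have "(\<integral>\<^sup>+ w. ennreal ((cmod (w t k * X w))\<^sup>2) \<partial>chan_meas) =
    (\<integral>\<^sup>+ w. \<integral>\<^sup>+ z. ennreal ((cmod (X w))\<^sup>2) * ennreal ((cmod z)\<^sup>2) \<partial>CN01 \<partial>chan_meas)"
    by (subst nn_integral_chan_coord[where t = t and k = k])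
      (use k inv in \<open>simp_all add: chan_upd_def norm_mult power_mult_distrib ennreal_mult mult.commute\<close>)
  also have "\<dots> = (\<integral>\<^sup>+ w. ennreal ((cmod (X w))\<^sup>2) \<partial>chan_meas)"
  proof -
    have "(\<lambda>z. ennreal ((cmod z)\<^sup>2)) \<in> borel_measurable CN01"
      unfolding measurable_cong_sets[OF sets_CN01 refl] by measurable
    then show ?thesis by (simp add: nn_integral_cmult second_moment_CN01)
  qed
  finally show ?thesis .
qed

lemma cmod_add3_sq: "(cmod (a + b + c))\<^sup>2 \<le> 3 * ((cmod a)\<^sup>2 + (cmod b)\<^sup>2 + (cmod c)\<^sup>2)"
proof -
  have "(cmod (a + b + c))\<^sup>2 \<le> (cmod a + cmod b + cmod c)\<^sup>2"
    by (intro power_mono order.trans[OF norm_triangle_ineq] add_right_mono norm_triangle_ineq) auto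
  also have "\<dots> \<le> 3 * ((cmod a)\<^sup>2 + (cmod b)\<^sup>2 + (cmod c)\<^sup>2)"
    using sum_squares_ge_zero[of "cmod a - cmod b" "cmod b - cmod c"] zero_le_power2[of "cmod a - cmod c"]
    by (auto simp: power2_eq_square algebra_simps)
  finally show ?thesis .
qed

text \<open>The factor 3 replaces any analysis of cross terms; constant factors in power do not
  affect degrees of freedom.\<close>

lemma nn_integral_add3_sq:
  assumes [measurable]: "f \<in> borel_measurable M" "g \<in> borel_measurable M" "h \<in> borel_measurable M"
  shows "(\<integral>\<^sup>+ w. ennreal ((cmod (f w + g w + h w))\<^sup>2) \<partial>M) \<le>
    3 * ((\<integral>\<^sup>+ w. ennreal ((cmod (f w))\<^sup>2) \<partial>M) + (\<integral>\<^sup>+ w. ennreal ((cmod (g w))\<^sup>2) \<partial>M)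
      + (\<integral>\<^sup>+ w. ennreal ((cmod (h w))\<^sup>2) \<partial>M))"
proof -
  have "(\<integral>\<^sup>+ w. ennreal ((cmod (f w + g w + h w))\<^sup>2) \<partial>M) \<le>
    (\<integral>\<^sup>+ w. 3 * (ennreal ((cmod (f w))\<^sup>2) + ennreal ((cmod (g w))\<^sup>2) + ennreal ((cmod (h w))\<^sup>2)) \<partial>M)"
  proof (rule nn_integral_mono)
    fix w
    have "ennreal ((cmod (f w + g w + h w))\<^sup>2) \<le> ennreal (3 * ((cmod (f w))\<^sup>2 + (cmod (g w))\<^sup>2 + (cmod (h w))\<^sup>2))"
      by (rule ennreal_leI[OF cmod_add3_sq])
    then show "ennreal ((cmod (f w + g w + h w))\<^sup>2) \<le>
      3 * (ennreal ((cmod (f w))\<^sup>2) + ennreal ((cmod (g w))\<^sup>2) + ennreal ((cmod (h w))\<^sup>2))"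
      by (simp add: ennreal_mult ennreal_plus)
  qed
  also have "\<dots> = 3 * ((\<integral>\<^sup>+ w. ennreal ((cmod (f w))\<^sup>2) \<partial>M) + (\<integral>\<^sup>+ w. ennreal ((cmod (g w))\<^sup>2) \<partial>M)
      + (\<integral>\<^sup>+ w. ennreal ((cmod (h w))\<^sup>2) \<partial>M))"
    by (simp add: nn_integral_cmult nn_integral_add)
  finally show ?thesis .
qed

section \<open>The change of measure from receiver noise to outputs\<close>

text \<open>Receiver \<open>d\<close> has weight 2 in the rate bound and \<open>e\<close> weight 1;
  both orders are instantiated later. \<open>P1\<close> allows the noise power to be absorbed into
  \<open>P\<close>.\<close>

locale two_receivers =
  fixes c :: code and P :: real and d e :: nat
  assumes valid: "valid_code P c" and P1: "P \<ge> 1"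
    and de: "d \<in> {1,2}" "e \<in> {1,2}" "d \<noteq> e"
begin

text \<open>Coordinates 10 and 11 hold the noises at D1 and D2, so \<open>9 + d\<close> is the one
  of receiver \<open>d\<close>; the same number also labels its outputs.\<close>

definition p where "p = 9 + d"
definition q where "q = 9 + e"
definition n where "n = blen c"
definition Md where "Md = nmsg c d"
definition Me where "Me = nmsg c e"
definition msg1 :: "nat \<Rightarrow> nat \<Rightarrow> nat" where "msg1 a b = (if d = 1 then a else b)"
definition msg2 :: "nat \<Rightarrow> nat \<Rightarrow> nat" where "msg2 a b = (if d = 1 then b else a)"

text \<open>The noiseless signal at receiver \<open>j\<close>, where \<open>a\<close> is the message for receiver \<open>d\<close> and \<open>b\<close>
  the one for \<open>e\<close>. It does not depend on the noise of the receivers.\<close>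

definition sg :: "nat \<Rightarrow> nat \<Rightarrow> nat \<Rightarrow> (nat \<Rightarrow> nat \<Rightarrow> complex) \<Rightarrow> nat \<Rightarrow> complex" where
  "sg j a b w t = Gc j 1 t w * XR c 1 (msg1 a b) (msg2 a b) t w + Gc j 2 t w * XR c 2 (msg1 a b) (msg2 a b) t w"

text \<open>The message \<open>a\<close> for \<open>d\<close> is a parameter and the message
  \<open>b\<close> for \<open>e\<close> the running index, so mixtures built from these signals are
  conditional on the message for \<open>d\<close>.\<close>

definition \<sigma> :: "nat \<Rightarrow> (nat \<Rightarrow> nat \<Rightarrow> complex) \<Rightarrow> nat \<Rightarrow> nat \<Rightarrow> complex" where
  "\<sigma> a w = (\<lambda>t b. sg d a b w t)"
definition \<tau> :: "nat \<Rightarrow> (nat \<Rightarrow> nat \<Rightarrow> complex) \<Rightarrow> nat \<Rightarrow> nat \<Rightarrow> complex" where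
  "\<tau> a w = (\<lambda>t b. sg e a b w t)"

definition out :: "nat \<Rightarrow> nat \<Rightarrow> (nat \<Rightarrow> nat \<Rightarrow> complex) \<Rightarrow> nat \<times> nat \<Rightarrow> complex" where
  "out a b w = (\<lambda>(t, k). YD c (k - 9) (msg1 a b) (msg2 a b) t w)"

lemma pq: "p \<noteq> q" "p \<in> {10, 11}" "q \<in> {10, 11}" "p - 9 = d" "q - 9 = e" "{p, q} = {10, 11}"
  using de by (auto simp: p_def q_def)

lemma Md_pos: "Md \<ge> 1" and Me_pos: "Me \<ge> 1"
  using valid de by (auto simp: valid_code_def Md_def Me_def)

lemma msg_less: "a < Md \<Longrightarrow> b < Me \<Longrightarrow> msg1 a b < nmsg c 1 \<and> msg2 a b < nmsg c 2"
  using de by (auto simp: msg1_def msg2_def Md_def Me_def)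

lemma sum_msg: "(\<Sum>a<Md. \<Sum>b<Me. F (msg1 a b) (msg2 a b)) = (\<Sum>m1<nmsg c 1. \<Sum>m2<nmsg c 2. F m1 m2)"
proof (cases "d = 1")
  case True
  then have d: "d = 1" and e: "e = 2" using de by auto
  show ?thesis unfolding Md_def Me_def msg1_def msg2_def by (simp add: d e)
next
  case False
  then have d: "d = 2" and e: "e = 1" using de by auto
  show ?thesis
    unfolding Md_def Me_def msg1_def msg2_def by (simp add: d e sum.swap[of _ "{..<nmsg c 2}"])
qed

lemma sg_measurable:
  assumes "j \<in> {1,2}" "t < n" "a < Md" "b < Me"
  shows "(\<lambda>w. sg j a b w t) \<in> borel_measurable chan_meas"
  unfolding sg_def using assms msg_less[OF assms(3,4)]
  by (intro borel_measurable_add borel_measurable_times Gc_measurable XR_measurable[OF valid]) (auto simp: n_def)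

lemma sg_cong:
  assumes "\<And>s k. s < t \<Longrightarrow> k < 10 \<Longrightarrow> w s k = w' s k" "\<And>k. k < 8 \<Longrightarrow> w t k = w' t k" "j \<in> {1,2}"
  shows "sg j a b w t = sg j a b w' t"
proof -
  have "XR c l (msg1 a b) (msg2 a b) t w = XR c l (msg1 a b) (msg2 a b) t w'" if "l \<in> {1,2}" for l
    using assms(1) that by (intro XR_cong) auto
  then show ?thesis using assms(2,3) by (auto simp: sg_def Gc_def)
qed

lemma out_eq: "k \<in> {10, 11} \<Longrightarrow> out a b w (t, k) = sg (k - 9) a b w t + w t k"
  by (auto simp: out_def YD_def sg_def ZD_def)

lemma out_measurable:
  assumes "t < n" "k \<in> {10, 11}" "a < Md" "b < Me"
  shows "(\<lambda>w. out a b w (t, k)) \<in> borel_measurable chan_meas"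
proof -
  have "(\<lambda>w. w t k) \<in> borel_measurable chan_meas" using assms by (intro measurable_chan_coord) auto
  moreover have "k - 9 \<in> {1,2}" using assms by auto
  ultimately show ?thesis
    using assms sg_measurable by (simp add: out_eq del: insert_iff)
qed

text \<open>Conditional on all coordinates except the receiver noises, the outputs have a Gaussian
  product density. After the change of variables the sum over messages can be evaluated pointwise in
  \<open>y\<close>, where mixtures cancel. That \<open>\<Phi>\<close> may read all coordinates below
  10 is the genie: channel and relay noises are given to the receivers.\<close>

lemma change_of_measure:
  fixes \<Phi> :: "nat \<Rightarrow> nat \<Rightarrow> (nat \<times> nat \<Rightarrow> complex) \<Rightarrow> (nat \<Rightarrow> nat \<Rightarrow> complex) \<Rightarrow> real" and C :: real
  assumes Q: "Q \<subseteq> {10, 11}"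
    and meas: "\<And>a b. a < Md \<Longrightarrow> b < Me \<Longrightarrow> (\<lambda>x. \<Phi> a b (snd x) (fst x)) \<in>
        borel_measurable (chan_meas \<Otimes>\<^sub>M leb ({..<n} \<times> Q))"
    and dep: "\<And>a b y y' w w'. (\<And>t k. t < n \<Longrightarrow> k \<in> Q \<Longrightarrow> y (t, k) = y' (t, k)) \<Longrightarrow>
        (\<And>t k. k < 10 \<Longrightarrow> w t k = w' t k) \<Longrightarrow> \<Phi> a b y w = \<Phi> a b y' w'"
    and nonneg: "\<And>a b y w. a < Md \<Longrightarrow> b < Me \<Longrightarrow> \<Phi> a b y w \<ge> 0"
    and bound: "\<And>w. w \<in> space chan_meas \<Longrightarrow> (\<integral>\<^sup>+ y. ennreal (\<Sum>a<Md. \<Sum>b<Me.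
        (\<Prod>t<n. \<Prod>k\<in>Q. Ndens (y (t, k) - sg (k - 9) a b w t)) * \<Phi> a b y w) \<partial>leb ({..<n} \<times> Q)) \<le> ennreal C"
  shows "(\<Sum>a<Md. \<Sum>b<Me. \<integral>\<^sup>+ w. ennreal (\<Phi> a b (out a b w) w) \<partial>chan_meas) \<le> ennreal C"
proof -
  define J where "J = {..<n} \<times> Q"
  define s where "s a b j w = sg (snd j - 9) a b w (fst j)" for a b and j :: "nat \<times> nat" and w
  define R where "R a b w y = (\<Prod>j\<in>J. Ndens (y j - s a b j w)) * \<Phi> a b y w" for a b w y
  have fQ: "finite Q" using Q finite_subset by blast
  have fJ: "finite J" by (simp add: J_def fQ)
  have JK: "J \<subseteq> UNIV \<times> {..<12}" using Q by (auto simp: J_def)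
  interpret Jf: sigma_finite_measure "PiM J (\<lambda>_. lborel :: complex measure)"
    by (rule lb.sigma_finite[OF fJ])
  have s_meas: "s a b j \<in> borel_measurable chan_meas" if "a < Md" "b < Me" "j \<in> J" for a b j
    unfolding s_def[abs_def] using that Q by (intro sg_measurable) (auto simp: J_def)
  have s_inv: "s a b j (chan_upd t k w z) = s a b j w" if "j \<in> J" "(t, k) \<in> J" for a b j t k w z
    unfolding s_def using that Q by (intro sg_cong) (auto simp: J_def chan_upd_def)
  have s_inv': "s a b j (chan_updJ J w y) = s a b j w" if "j \<in> J" for a b j w y
    unfolding s_def using that Q by (intro sg_cong) (auto simp: J_def chan_updJ_def)
  have s_pair: "(\<lambda>x. snd x j - s a b j (fst x)) \<in> borel_measurable (chan_meas \<Otimes>\<^sub>M leb J)"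
    if "a < Md" "b < Me" "j \<in> J" for a b j
    using s_meas[OF that] measurable_PiM_lborel_coord[OF that(3)]
    by (intro borel_measurable_diff measurable_compose[OF measurable_fst]
        measurable_compose[OF measurable_snd]) auto
  have R_meas: "(\<lambda>x. R a b (fst x) (snd x)) \<in> borel_measurable (chan_meas \<Otimes>\<^sub>M leb J)"
    if "a < Md" "b < Me" for a b
    unfolding R_def using meas[OF that] that
    by (intro borel_measurable_times borel_measurable_prod measurable_compose[OF _ Ndens_measurable] s_pair)
      (auto simp: J_def)
  have out_s: "out a b w j = s a b j w + w (fst j) (snd j)" if "j \<in> J" for a b w j
    using that Q by (auto simp: J_def s_def out_eq)
  have out_meas: "(\<lambda>w. (w, restrict (out a b w) J)) \<in> measurable chan_meas (chan_meas \<Otimes>\<^sub>M leb J)"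
    if "a < Md" "b < Me" for a b
    using out_measurable that Q
    by (intro measurable_Pair measurable_restrict) (auto simp: J_def)
  have \<Phi>_out: "\<Phi> a b (restrict (out a b w) J) w = \<Phi> a b (out a b w) w" for a b w
    by (rule dep) (auto simp: J_def)
  have \<Phi>_meas: "(\<lambda>w. ennreal (\<Phi> a b (out a b w) w)) \<in> borel_measurable chan_meas" if "a < Md" "b < Me" for a b
    using measurable_compose[OF out_meas[OF that] meas[OF that, folded J_def]]
    by (intro measurable_compose[OF _ measurable_ennreal]) (simp add: \<Phi>_out)
  have one: "(\<integral>\<^sup>+ w. ennreal (\<Phi> a b (out a b w) w) \<partial>chan_meas) =
      (\<integral>\<^sup>+ w. \<integral>\<^sup>+ y. ennreal (R a b w y) \<partial>leb J \<partial>chan_meas)" if ab: "a < Md" "b < Me" for a b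
  proof -
    have "(\<integral>\<^sup>+ w. ennreal (\<Phi> a b (out a b w) w) \<partial>chan_meas) =
      (\<integral>\<^sup>+ w. \<integral>\<^sup>+ y. ennreal (\<Prod>j\<in>J. Ndens (y j - s a b j w)) *
        ennreal (\<Phi> a b (out a b (chan_updJ J w (\<lambda>j. y j - s a b j w))) (chan_updJ J w (\<lambda>j. y j - s a b j w)))
         \<partial>leb J \<partial>chan_meas)"
      by (rule nn_integral_chan_resample[OF fJ subset_refl JK \<Phi>_meas[OF ab] s_meas[OF ab] s_inv])
    also have "\<dots> = (\<integral>\<^sup>+ w. \<integral>\<^sup>+ y. ennreal (R a b w y) \<partial>leb J \<partial>chan_meas)"
    proof (intro nn_integral_cong)
      fix w :: "nat \<Rightarrow> nat \<Rightarrow> complex" and y :: "nat \<times> nat \<Rightarrow> complex"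
      let ?w = "chan_updJ J w (\<lambda>j. y j - s a b j w)"
      \<comment> \<open>The resampled noise produces exactly \<open>y\<close> as output, since the
        signals do not react to it.\<close>
      have "\<Phi> a b (out a b ?w) ?w = \<Phi> a b y w"
      proof (rule dep)
        fix t k assume "t < n" "k \<in> Q"
        then have j: "(t, k) \<in> J" by (simp add: J_def)
        have "out a b ?w (t, k) = s a b (t, k) w + ?w t k"
          using out_s[OF j, of a b ?w] s_inv'[OF j, of a b w "\<lambda>j. y j - s a b j w"] by simp
        then show "out a b ?w (t, k) = y (t, k)" using j by (simp add: chan_updJ_def)
      next
        fix t k :: nat assume "k < 10"
        then show "?w t k = w t k" using Q by (auto simp: chan_updJ_def J_def)
      qed
      then show "ennreal (\<Prod>j\<in>J. Ndens (y j - s a b j w)) * ennreal (\<Phi> a b (out a b ?w) ?w) = ennreal (R a b w y)"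
        by (simp add: R_def ennreal_mult nonneg[OF ab] prod_nonneg)
    qed
    finally show ?thesis .
  qed
  have R0: "R a b w y \<ge> 0" if "a < Md" "b < Me" for a b w y
    unfolding R_def using nonneg[OF that] by (intro mult_nonneg_nonneg prod_nonneg) auto
  have inner_meas: "(\<lambda>w. \<integral>\<^sup>+ y. ennreal (R a b w y) \<partial>leb J) \<in> borel_measurable chan_meas"
    if "a < Md" "b < Me" for a b
    using R_meas[OF that] by (intro Jf.borel_measurable_nn_integral) (simp add: split_beta')
  have R_meas': "(\<lambda>y. ennreal (R a b w y)) \<in> borel_measurable (leb J)"
    if "a < Md" "b < Me" "w \<in> space chan_meas" for a b w
    using measurable_compose[OF measurable_Pair1'[OF that(3)] R_meas[OF that(1,2)]] by simp
  have "(\<Sum>a<Md. \<Sum>b<Me. \<integral>\<^sup>+ w. ennreal (\<Phi> a b (out a b w) w) \<partial>chan_meas) =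
    (\<Sum>a<Md. \<Sum>b<Me. \<integral>\<^sup>+ w. \<integral>\<^sup>+ y. ennreal (R a b w y) \<partial>leb J \<partial>chan_meas)"
    by (intro sum.cong refl one) auto
  also have "\<dots> = (\<integral>\<^sup>+ w. (\<Sum>a<Md. \<Sum>b<Me. \<integral>\<^sup>+ y. ennreal (R a b w y) \<partial>leb J) \<partial>chan_meas)"
  proof -
    have "(\<integral>\<^sup>+ w. (\<Sum>a<Md. \<Sum>b<Me. \<integral>\<^sup>+ y. ennreal (R a b w y) \<partial>leb J) \<partial>chan_meas) =
      (\<Sum>a<Md. \<integral>\<^sup>+ w. (\<Sum>b<Me. \<integral>\<^sup>+ y. ennreal (R a b w y) \<partial>leb J) \<partial>chan_meas)"
      by (rule nn_integral_sum) (intro borel_measurable_sum inner_meas, auto)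
    also have "\<dots> = (\<Sum>a<Md. \<Sum>b<Me. \<integral>\<^sup>+ w. \<integral>\<^sup>+ y. ennreal (R a b w y) \<partial>leb J \<partial>chan_meas)"
      by (intro sum.cong refl nn_integral_sum inner_meas) auto
    finally show ?thesis by simp
  qed
  also have "\<dots> \<le> (\<integral>\<^sup>+ w. ennreal C \<partial>chan_meas)"
  proof (rule nn_integral_mono)
    fix w assume w: "w \<in> space chan_meas"
    have "(\<Sum>a<Md. \<Sum>b<Me. \<integral>\<^sup>+ y. ennreal (R a b w y) \<partial>leb J) =
      (\<integral>\<^sup>+ y. (\<Sum>a<Md. \<Sum>b<Me. ennreal (R a b w y)) \<partial>leb J)"
    proof -
      have "(\<integral>\<^sup>+ y. (\<Sum>a<Md. \<Sum>b<Me. ennreal (R a b w y)) \<partial>leb J) =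
        (\<Sum>a<Md. \<integral>\<^sup>+ y. (\<Sum>b<Me. ennreal (R a b w y)) \<partial>leb J)"
        by (rule nn_integral_sum) (intro borel_measurable_sum R_meas' w, auto)
      also have "\<dots> = (\<Sum>a<Md. \<Sum>b<Me. \<integral>\<^sup>+ y. ennreal (R a b w y) \<partial>leb J)"
        by (intro sum.cong refl nn_integral_sum R_meas' w) auto
      finally show ?thesis by simp
    qed
    also have "\<dots> = (\<integral>\<^sup>+ y. ennreal (\<Sum>a<Md. \<Sum>b<Me. R a b w y) \<partial>leb J)"
    proof (rule nn_integral_cong)
      fix y :: "nat \<times> nat \<Rightarrow> complex"
      have "(\<Sum>a<Md. \<Sum>b<Me. ennreal (R a b w y)) = (\<Sum>a<Md. ennreal (\<Sum>b<Me. R a b w y))"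
        by (intro sum.cong refl sum_ennreal R0) auto
      also have "\<dots> = ennreal (\<Sum>a<Md. \<Sum>b<Me. R a b w y)"
        by (intro sum_ennreal sum_nonneg R0) auto
      finally show "(\<Sum>a<Md. \<Sum>b<Me. ennreal (R a b w y)) = ennreal (\<Sum>a<Md. \<Sum>b<Me. R a b w y)" .
    qed
    also have "(\<lambda>y. \<Sum>a<Md. \<Sum>b<Me. R a b w y) = (\<lambda>y. \<Sum>a<Md. \<Sum>b<Me.
        (\<Prod>t<n. \<Prod>k\<in>Q. Ndens (y (t, k) - sg (k - 9) a b w t)) * \<Phi> a b y w)"
      by (simp add: R_def J_def s_def prod.cartesian_product split_beta)
    also have "(\<integral>\<^sup>+ y. ennreal (\<Sum>a<Md. \<Sum>b<Me.
        (\<Prod>t<n. \<Prod>k\<in>Q. Ndens (y (t, k) - sg (k - 9) a b w t)) * \<Phi> a b y w) \<partial>leb J) \<le> ennreal C"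
      unfolding J_def by (rule bound[OF w])
    finally show "(\<Sum>a<Md. \<Sum>b<Me. \<integral>\<^sup>+ y. ennreal (R a b w y) \<partial>leb J) \<le> ennreal C" .
  qed
  also have "\<dots> = ennreal C" by (simp add: chan.emeasure_space_1)
  finally show ?thesis .
qed

text \<open>The constant is \<open>3 * (P + P + 1) \<le> 9 * P\<close>. The power constraint is an
  average over messages and uses, hence only the total is bounded.\<close>

lemma nn_integral_out_sq:
  "(\<Sum>a<Md. \<Sum>b<Me. \<Sum>t<n. \<integral>\<^sup>+ w. ennreal ((cmod (out a b w (t, p)))\<^sup>2) \<partial>chan_meas)
     \<le> ennreal (real Md * real Me * (real n * (9 * P)))"
proof -
  define E where "E i m1 m2 t = (\<integral>\<^sup>+ w. ennreal ((cmod (XR c i m1 m2 t w))\<^sup>2) \<partial>chan_meas)" for i m1 m2 t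
  have pow: "(\<Sum>a<Md. \<Sum>b<Me. \<Sum>t<n. E i (msg1 a b) (msg2 a b) t) \<le> ennreal (real Md * real Me * (real n * P))"
    if "i \<in> {1,2}" for i
  proof -
    have "(\<Sum>a<Md. \<Sum>b<Me. \<Sum>t<n. E i (msg1 a b) (msg2 a b) t) = (\<Sum>m1<nmsg c 1. \<Sum>m2<nmsg c 2. \<Sum>t<n. E i m1 m2 t)"
      by (rule sum_msg[of "\<lambda>m1 m2. \<Sum>t<n. E i m1 m2 t"])
    also have "\<dots> \<le> ennreal (real (nmsg c 1) * real (nmsg c 2) * real (blen c) * P)"
      using valid that unfolding valid_code_def E_def n_def by blast
    also have "real (nmsg c 1) * real (nmsg c 2) * real (blen c) * P = real Md * real Me * (real n * P)"
      using de by (auto simp: Md_def Me_def n_def)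
    finally show ?thesis .
  qed
  have one: "(\<integral>\<^sup>+ w. ennreal ((cmod (out a b w (t, p)))\<^sup>2) \<partial>chan_meas)
      \<le> 3 * (E 1 (msg1 a b) (msg2 a b) t + E 2 (msg1 a b) (msg2 a b) t + 1)"
    if "t < n" "a < Md" "b < Me" for a b t
  proof -
    define X where "X i = XR c i (msg1 a b) (msg2 a b) t" for i
    have Xm: "X i \<in> borel_measurable chan_meas" if "i \<in> {1,2}" for i
      unfolding X_def using that \<open>t < n\<close> msg_less[OF \<open>a < Md\<close> \<open>b < Me\<close>]
      by (intro XR_measurable[OF valid]) (auto simp: n_def)
    have G: "(\<integral>\<^sup>+ w. ennreal ((cmod (Gc d i t w * X i w))\<^sup>2) \<partial>chan_meas) = E i (msg1 a b) (msg2 a b) t"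
      if "i \<in> {1,2}" for i
    proof -
      have "(\<integral>\<^sup>+ w. ennreal ((cmod (w t (4 + 2 * (d - 1) + (i - 1)) * X i w))\<^sup>2) \<partial>chan_meas)
         = (\<integral>\<^sup>+ w. ennreal ((cmod (X i w))\<^sup>2) \<partial>chan_meas)"
      proof (rule second_moment_chan[OF _ Xm[OF that]])
        show "4 + 2 * (d - 1) + (i - 1) < 12" using that de by auto
        show "X i (chan_upd t (4 + 2 * (d - 1) + (i - 1)) w z) = X i w" for w z
          unfolding X_def using that by (intro XR_cong) (auto simp: chan_upd_def)
      qed
      then show ?thesis by (simp add: Gc_def X_def E_def)
    qed
    have Z: "(\<integral>\<^sup>+ w. ennreal ((cmod (ZD d t w))\<^sup>2) \<partial>chan_meas) = 1"
      using second_moment_chan[of "9 + d" "\<lambda>_. 1" t] de by (auto simp: ZD_def chan.emeasure_space_1)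
    have "out a b w (t, p) = Gc d 1 t w * X 1 w + Gc d 2 t w * X 2 w + ZD d t w" for w
      using pq by (simp add: out_def YD_def X_def)
    then have "(\<integral>\<^sup>+ w. ennreal ((cmod (out a b w (t, p)))\<^sup>2) \<partial>chan_meas)
      \<le> 3 * ((\<integral>\<^sup>+ w. ennreal ((cmod (Gc d 1 t w * X 1 w))\<^sup>2) \<partial>chan_meas)
       + (\<integral>\<^sup>+ w. ennreal ((cmod (Gc d 2 t w * X 2 w))\<^sup>2) \<partial>chan_meas)
       + (\<integral>\<^sup>+ w. ennreal ((cmod (ZD d t w))\<^sup>2) \<partial>chan_meas))"
      using de by (simp only:) (intro nn_integral_add3_sq borel_measurable_times Xm Gc_measurable ZD_measurable, auto)
    then show ?thesis using G Z by simp
  qed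
  have "(\<Sum>a<Md. \<Sum>b<Me. \<Sum>t<n. \<integral>\<^sup>+ w. ennreal ((cmod (out a b w (t, p)))\<^sup>2) \<partial>chan_meas)
    \<le> (\<Sum>a<Md. \<Sum>b<Me. \<Sum>t<n. 3 * (E 1 (msg1 a b) (msg2 a b) t + E 2 (msg1 a b) (msg2 a b) t + 1))"
    by (intro sum_mono one) auto
  also have "\<dots> = 3 * ((\<Sum>a<Md. \<Sum>b<Me. \<Sum>t<n. E 1 (msg1 a b) (msg2 a b) t)
      + (\<Sum>a<Md. \<Sum>b<Me. \<Sum>t<n. E 2 (msg1 a b) (msg2 a b) t) + of_nat (Md * Me * n))"
    by (simp add: sum.distrib sum_distrib_left[symmetric] algebra_simps)
  also have "\<dots> \<le> 3 * (ennreal (real Md * real Me * (real n * P)) + ennreal (real Md * real Me * (real n * P))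
      + ennreal (real Md * real Me * (real n * P)))"
  proof (intro mult_left_mono add_mono pow)
    have "of_nat (Md * Me * n) = ennreal (real Md * real Me * (real n * 1))"
      by (simp add: ennreal_of_nat_eq_real_of_nat[symmetric] ennreal_of_nat_eq_real_of_nat mult.assoc)
    also have "\<dots> \<le> ennreal (real Md * real Me * (real n * P))"
      using P1 by (intro ennreal_leI mult_left_mono) auto
    finally show "of_nat (Md * Me * n) \<le> ennreal (real Md * real Me * (real n * P))" .
  qed auto
  also have "\<dots> = ennreal 3 * ennreal (3 * (real Md * real Me * (real n * P)))"
  proof -
    have "x \<ge> 0 \<Longrightarrow> ennreal x + ennreal x + ennreal x = ennreal (3 * x)" for x
      by (simp add: ennreal_plus[symmetric] del: ennreal_plus)
    then show ?thesis using P1 by simp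
  qed
  also have "\<dots> = ennreal (3 * (3 * (real Md * real Me * (real n * P))))"
    using P1 by (intro ennreal_mult[symmetric]) auto
  also have "3 * (3 * (real Md * real Me * (real n * P))) = real Md * real Me * (real n * (9 * P))"
    by simp
  finally show ?thesis .
qed

end

section \<open>Logarithms of likelihoods and their integrability\<close>

lemma ln_Ndens: "ln (Ndens z) = - (cmod z)\<^sup>2 - ln pi"
  by (simp add: Ndens_def ln_div)

lemma prod_ln:
  fixes f :: "nat \<Rightarrow> real"
  assumes "\<And>t. t < n \<Longrightarrow> f t > 0"
  shows "ln (\<Prod>t<n. f t) = (\<Sum>t<n. ln (f t))"
  using assms
proof (induction n)
  case (Suc n)
  then have "(\<Prod>t<n. f t) > 0" "f n > 0" by (auto intro!: prod_pos)
  with Suc show ?case by (simp add: ln_mult_pos)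
qed simp

lemma Ndens_nonzero [simp]: "Ndens z \<noteq> 0"
  using Ndens_pos[of z] by linarith

lemma nn_integral_Gauss_var:
  assumes "P > 0"
  shows "(\<integral>\<^sup>+ z. ennreal (exp (- (cmod z)\<^sup>2 / P) / (pi * P)) \<partial>lborel) = 1"
proof -
  let ?f = "normal_density 0 (sqrt (P/2))"
  have n: "(\<integral>\<^sup>+ x. ennreal (?f x) \<partial>lborel) = 1"
    using integral_normal_density[of "sqrt (P/2)" 0] assms
    by (subst nn_integral_eq_integral) auto
  have f: "?f x = exp (- x\<^sup>2 / P) / sqrt (pi * P)" for x
    using assms by (simp add: normal_density_def)
  have "sqrt (pi * P) * sqrt (pi * P) = pi * P" using assms by simp
  then have "exp (- (cmod z)\<^sup>2 / P) / (pi * P) = ?f (Re z) * ?f (Im z)" for z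
    unfolding f cmod_power2 by (simp add: exp_add [symmetric] add_divide_distrib diff_divide_distrib)
  then show ?thesis
    using nn_integral_complex_prod[of ?f ?f] n by simp
qed

context two_receivers
begin

abbreviation "wtde a w b \<equiv> wt2 p q (\<sigma> a w) (\<tau> a w) n b"
abbreviation "mixd a w \<equiv> mix1 p (\<sigma> a w) Me n"
abbreviation "mixde a w \<equiv> mix2 p q (\<sigma> a w) (\<tau> a w) Me n"
abbreviation "predp a w t \<equiv> predictive p q (\<sigma> a w) (\<tau> a w) p (\<sigma> a w) Me t"
abbreviation "predq a w t \<equiv> predictive p q (\<sigma> a w) (\<tau> a w) q (\<tau> a w) Me t"

text \<open>Reference law for the outputs at \<open>d\<close>: i.i.d. complex Gaussian of variance
  \<open>P\<close>. The cross entropy against it stands in for the entropy of the outputs.\<close>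

definition qd :: "(nat \<times> nat \<Rightarrow> complex) \<Rightarrow> real" where
  "qd y = (\<Prod>t<n. exp (- (cmod (y (t, p)))\<^sup>2 / P) / (pi * P))"

definition dcd :: "nat \<Rightarrow> (nat \<times> nat \<Rightarrow> complex) \<Rightarrow> (nat \<Rightarrow> nat \<Rightarrow> complex) \<Rightarrow> nat" where
  "dcd j y w = dec c j (csi_past w n, restrict (\<lambda>s. y (s, 9 + j)) {..<n})"

definition guess :: "nat \<Rightarrow> nat \<Rightarrow> nat \<Rightarrow> (nat \<times> nat \<Rightarrow> complex) \<Rightarrow> (nat \<Rightarrow> nat \<Rightarrow> complex) \<Rightarrow> real" where
  "guess j M m y w = 1 / 2 + real M / 2 * (if dcd j y w = m then 1 else 0)"

text \<open>Fano's inequality: the likelihood ratio is tested against \<open>guess\<close>, which is large when the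
  decision is correct and whose sum over all messages is at most their number.\<close>

lemma guess_pos [simp]: "guess j M m y w > 0"
  by (simp add: guess_def add_pos_nonneg)

lemma sum_guess_le: "(\<Sum>m<M. guess j M m y w) \<le> real M"
proof -
  have "(\<Sum>m<M. if dcd j y w = m then 1 else 0::real) \<le> 1"
    by (simp add: sum.delta)
  then have "real M / 2 * (\<Sum>m<M. if dcd j y w = m then 1 else 0::real) \<le> real M / 2 * 1"
    by (intro mult_left_mono) auto
  moreover have "(\<Sum>m<M. guess j M m y w) = real M / 2 + real M / 2 * (\<Sum>m<M. if dcd j y w = m then 1 else 0::real)"
    unfolding guess_def sum.distrib sum_distrib_left[symmetric] by simp
  ultimately show ?thesis by simp
qed

lemma guess_le: "guess j M m y w \<le> 1 + real M"
  by (simp add: guess_def)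

lemma qd_pos [simp]: "qd y > 0"
  using P1 by (auto simp: qd_def intro!: prod_pos)

lemma dcd_out:
  "j \<in> {1,2} \<Longrightarrow> dcd j (out a b w) w = decoded c j (msg1 a b) (msg2 a b) w"
  by (simp add: dcd_def decoded_def out_def n_def)

context
  fixes N :: "'x measure" and F and Y :: "'x \<Rightarrow> nat \<times> nat \<Rightarrow> complex"
  assumes F: "F \<in> measurable N chan_meas"
begin

lemma \<sigma>_meas: "t < n \<Longrightarrow> a < Md \<Longrightarrow> b < Me \<Longrightarrow> (\<lambda>x. \<sigma> a (F x) t b) \<in> borel_measurable N"
  unfolding \<sigma>_def by (rule measurable_compose[OF F sg_measurable[OF de(1)]])

lemma \<tau>_meas: "t < n \<Longrightarrow> a < Md \<Longrightarrow> b < Me \<Longrightarrow> (\<lambda>x. \<tau> a (F x) t b) \<in> borel_measurable N"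
  unfolding \<tau>_def by (rule measurable_compose[OF F sg_measurable[OF de(2)]])

lemma guess_meas:
  assumes "j \<in> {1,2}" "\<And>t. t < n \<Longrightarrow> (\<lambda>x. Y x (t, 9 + j)) \<in> borel_measurable N"
  shows "(\<lambda>x. guess j M m (Y x) (F x)) \<in> borel_measurable N"
proof -
  have "(\<lambda>x. dcd j (Y x) (F x)) \<in> measurable N (count_space UNIV)"
    unfolding dcd_def n_def
    by (rule dec_measurable[OF valid assms(1)])
      (use assms measurable_compose[OF F measurable_csi_past] in \<open>auto simp: n_def\<close>)
  then have "(\<lambda>x. (\<lambda>k. if k = m then 1 else 0::real) (dcd j (Y x) (F x))) \<in> borel_measurable N"
    by (rule measurable_compose) simp
  then show ?thesis unfolding guess_def by (intro borel_measurable_add borel_measurable_times) auto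
qed

lemma qd_meas:
  assumes "\<And>t. t < n \<Longrightarrow> (\<lambda>x. Y x (t, p)) \<in> borel_measurable N"
  shows "(\<lambda>x. qd (Y x)) \<in> borel_measurable N"
  unfolding qd_def using assms by (intro borel_measurable_prod) (auto intro!: borel_measurable_divide)

lemma mix1_meas:
  assumes "\<And>t. t < n \<Longrightarrow> (\<lambda>x. Y x (t, p)) \<in> borel_measurable N" "a < Md"
  shows "(\<lambda>x. mixd a (F x) (Y x)) \<in> borel_measurable N"
  using assms by (intro mix1_measurable \<sigma>_meas) auto

context
  assumes Y: "\<And>t k. t < n \<Longrightarrow> k \<in> {p, q} \<Longrightarrow> (\<lambda>x. Y x (t, k)) \<in> borel_measurable N"
begin

lemma mix2_meas: "a < Md \<Longrightarrow> (\<lambda>x. mixde a (F x) (Y x)) \<in> borel_measurable N"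
  by (intro mix2_measurable \<sigma>_meas \<tau>_meas Y) auto

lemma wt2_meas: "a < Md \<Longrightarrow> b < Me \<Longrightarrow> (\<lambda>x. wtde a (F x) b (Y x)) \<in> borel_measurable N"
  by (intro wt2_measurable \<sigma>_meas \<tau>_meas Y) auto

lemma predp_meas: "a < Md \<Longrightarrow> t < n \<Longrightarrow> (\<lambda>x. predp a (F x) t (Y x)) \<in> borel_measurable N"
  by (intro predictive_measurable \<sigma>_meas \<tau>_meas Y) auto

lemma predq_meas: "a < Md \<Longrightarrow> t < n \<Longrightarrow> (\<lambda>x. predq a (F x) t (Y x)) \<in> borel_measurable N"
  by (intro predictive_measurable \<sigma>_meas \<tau>_meas Y) auto

end
end

lemma out_meas: "t < n \<Longrightarrow> k \<in> {p, q} \<Longrightarrow> a < Md \<Longrightarrow> b < Me \<Longrightarrow> (\<lambda>w. out a b w (t, k)) \<in> borel_measurable chan_meas"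
  using pq(6) by (intro out_measurable) auto

lemma \<sigma>_cong: "(\<And>t k. k < 10 \<Longrightarrow> w t k = w' t k) \<Longrightarrow> \<sigma> a w = \<sigma> a w'"
  unfolding \<sigma>_def using de by (intro ext sg_cong) auto

lemma \<tau>_cong: "(\<And>t k. k < 10 \<Longrightarrow> w t k = w' t k) \<Longrightarrow> \<tau> a w = \<tau> a w'"
  unfolding \<tau>_def using de by (intro ext sg_cong) auto

lemma guess_cong:
  assumes "\<And>t k. k < 10 \<Longrightarrow> w t k = w' t k" "\<And>t. t < n \<Longrightarrow> y (t, 9 + j) = y' (t, 9 + j)"
  shows "guess j M m y w = guess j M m y' w'"
proof -
  have "csi_past w n = csi_past w' n" by (rule csi_past_cong) (use assms in auto)
  moreover have "restrict (\<lambda>s. y (s, 9 + j)) {..<n} = restrict (\<lambda>s. y' (s, 9 + j)) {..<n}"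
    by (rule restrict_ext) (use assms in auto)
  ultimately show ?thesis by (simp add: guess_def dcd_def)
qed

text \<open>Jensen's inequality in the form \<open>ln x \<le> x - 1\<close>, averaged over messages.
  Integrability of \<open>ln f\<close> is assumed because the integral of a non-integrable function
  is 0 by convention and carries no information; that of \<open>f\<close> follows from the
  bound.\<close>

lemma gibbs:
  fixes f :: "nat \<Rightarrow> nat \<Rightarrow> (nat \<Rightarrow> nat \<Rightarrow> complex) \<Rightarrow> real"
  assumes pos: "\<And>a b w. a < Md \<Longrightarrow> b < Me \<Longrightarrow> f a b w > 0"
    and meas: "\<And>a b. a < Md \<Longrightarrow> b < Me \<Longrightarrow> f a b \<in> borel_measurable chan_meas"
    and int: "\<And>a b. a < Md \<Longrightarrow> b < Me \<Longrightarrow> integrable chan_meas (\<lambda>w. ln (f a b w))"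
    and le: "(\<Sum>a<Md. \<Sum>b<Me. \<integral>\<^sup>+ w. ennreal (f a b w) \<partial>chan_meas) \<le> ennreal (real Md * real Me)"
  shows "(\<Sum>a<Md. \<Sum>b<Me. \<integral> w. ln (f a b w) \<partial>chan_meas) \<le> 0"
proof -
  have fin: "(\<integral>\<^sup>+ w. ennreal (f a b w) \<partial>chan_meas) < \<infinity>" if "a < Md" "b < Me" for a b
  proof -
    have "(\<integral>\<^sup>+ w. ennreal (f a b w) \<partial>chan_meas) \<le> (\<Sum>b<Me. \<integral>\<^sup>+ w. ennreal (f a b w) \<partial>chan_meas)"
      using that by (intro member_le_sum) auto
    also have "\<dots> \<le> (\<Sum>a<Md. \<Sum>b<Me. \<integral>\<^sup>+ w. ennreal (f a b w) \<partial>chan_meas)"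
      using that by (intro member_le_sum[of a "{..<Md}" "\<lambda>a. \<Sum>b<Me. \<integral>\<^sup>+ w. ennreal (f a b w) \<partial>chan_meas"]) auto
    also note le
    finally show ?thesis by (simp add: le_less_trans)
  qed
  have fint: "integrable chan_meas (f a b)" if "a < Md" "b < Me" for a b
    using fin[OF that] meas[OF that] pos[OF that]
    by (intro integrableI_nonneg) (auto intro: less_imp_le)
  have nn: "(\<integral>\<^sup>+ w. ennreal (f a b w) \<partial>chan_meas) = ennreal (\<integral> w. f a b w \<partial>chan_meas)" if "a < Md" "b < Me" for a b
    using fint[OF that] pos[OF that] by (intro nn_integral_eq_integral) (auto intro: less_imp_le)
  have i0: "(\<integral> w. f a b w \<partial>chan_meas) \<ge> 0" if "a < Md" "b < Me" for a b
    using pos[OF that] by (intro integral_nonneg_AE) (auto intro: less_imp_le)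
  have "(\<Sum>a<Md. \<Sum>b<Me. \<integral>\<^sup>+ w. ennreal (f a b w) \<partial>chan_meas) = (\<Sum>a<Md. ennreal (\<Sum>b<Me. \<integral> w. f a b w \<partial>chan_meas))"
    using i0 by (intro sum.cong refl) (auto simp: nn intro!: sum_ennreal)
  also have "\<dots> = ennreal (\<Sum>a<Md. \<Sum>b<Me. \<integral> w. f a b w \<partial>chan_meas)"
    by (intro sum_ennreal sum_nonneg i0) auto
  finally have "ennreal (\<Sum>a<Md. \<Sum>b<Me. \<integral> w. f a b w \<partial>chan_meas) \<le> ennreal (real Md * real Me)"
    using le by simp
  then have sum: "(\<Sum>a<Md. \<Sum>b<Me. \<integral> w. f a b w \<partial>chan_meas) \<le> real Md * real Me"
    by (subst (asm) ennreal_le_iff) auto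
  have "(\<Sum>a<Md. \<Sum>b<Me. \<integral> w. ln (f a b w) \<partial>chan_meas) \<le> (\<Sum>a<Md. \<Sum>b<Me. (\<integral> w. f a b w \<partial>chan_meas) - 1)"
  proof (intro sum_mono)
    fix a b assume "a \<in> {..<Md}" "b \<in> {..<Me}"
    then have ab: "a < Md" "b < Me" by auto
    have "(\<integral> w. ln (f a b w) \<partial>chan_meas) \<le> (\<integral> w. f a b w - 1 \<partial>chan_meas)"
      using int[OF ab] fint[OF ab] pos[OF ab] by (intro integral_mono) (auto intro: ln_le_minus_one)
    then show "(\<integral> w. ln (f a b w) \<partial>chan_meas) \<le> (\<integral> w. f a b w \<partial>chan_meas) - 1"
      using fint[OF ab] by (simp add: chan.prob_space)
  qed
  also have "\<dots> = (\<Sum>a<Md. \<Sum>b<Me. \<integral> w. f a b w \<partial>chan_meas) - real Md * real Me"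
    by (simp add: sum_subtractf)
  finally show ?thesis using sum by simp
qed

definition Zs :: "(nat \<Rightarrow> nat \<Rightarrow> complex) \<Rightarrow> real" where
  "Zs w = (\<Sum>t<n. (cmod (w t p))\<^sup>2 + (cmod (w t q))\<^sup>2)"

lemma Zs_nonneg: "Zs w \<ge> 0"
  by (auto simp: Zs_def intro!: sum_nonneg)

lemma integrable_noise: "k < 12 \<Longrightarrow> integrable chan_meas (\<lambda>w. (cmod (w t k))\<^sup>2)"
  using second_moment_chan[of k "\<lambda>_. 1" t]
  by (intro integrableI_nonneg) (auto simp: chan.emeasure_space_1)

lemma integrable_Zs: "integrable chan_meas Zs"
  unfolding Zs_def[abs_def] using pq
  by (intro Bochner_Integration.integrable_sum Bochner_Integration.integrable_add integrable_noise) auto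

text \<open>At the true messages and the true outputs the residuals are the receiver noises
  themselves.\<close>

lemma wt2_out:
  "ln (wtde a w b (out a b w)) = - Zs w - 2 * real n * ln pi"
proof -
  have "out a b w (t, p) - \<sigma> a w t b = w t p" "out a b w (t, q) - \<tau> a w t b = w t q" for t
    using pq by (auto simp: out_eq \<sigma>_def \<tau>_def)
  then show ?thesis
    unfolding wt2_def
    by (subst prod_ln) (auto simp: ln_mult ln_Ndens Zs_def sum.distrib sum_negf sum_subtractf)
qed

text \<open>The likelihood of the true message is a lower bound, and its logarithm is minus the
  noise energy up to a constant. The domination is therefore independent of what the code
  transmits.\<close>

lemma integrable_ln:
  assumes meas: "f \<in> borel_measurable chan_meas"
    and bd: "\<And>w. wtde a w b (out a b w) / real Me \<le> f w" "\<And>w. f w \<le> real Me"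
  shows "integrable chan_meas (\<lambda>w. ln (f w))"
proof (rule Bochner_Integration.integrable_bound[of _ "\<lambda>w. Zs w + (2 * real n * ln pi + ln (real Me))"])
  show "integrable chan_meas (\<lambda>w. Zs w + (2 * real n * ln pi + ln (real Me)))"
    using integrable_Zs by simp
  show "(\<lambda>w. ln (f w)) \<in> borel_measurable chan_meas" using meas by measurable
  have "norm (ln (f w)) \<le> norm (Zs w + (2 * real n * ln pi + ln (real Me)))" for w
  proof -
    let ?W = "wtde a w b (out a b w)"
    have W: "?W / real Me > 0" using Me_pos by simp
    have f0: "f w > 0" using bd(1)[of w] W by linarith
    have "ln (?W / real Me) \<le> ln (f w)" using bd(1)[of w] W f0 by (subst ln_le_cancel_iff) auto
    then have "ln (f w) \<ge> - Zs w - 2 * real n * ln pi - ln (real Me)"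
      using Me_pos by (simp add: ln_divide_pos wt2_out)
    moreover have "ln (f w) \<le> ln (real Me)" using bd(2)[of w] f0 by simp
    moreover have "ln (real Me) \<ge> 0" using Me_pos by simp
    moreover have "real n * ln pi \<ge> 0" using pi_gt3 by (intro mult_nonneg_nonneg) auto
    moreover have "Zs w \<ge> 0" by (rule Zs_nonneg)
    ultimately show ?thesis by simp
  qed
  then show "AE w in chan_meas. norm (ln (f w)) \<le> norm (Zs w + (2 * real n * ln pi + ln (real Me)))" by simp
qed

lemma wt2_div: "wtde a w b y / real Me \<le> wtde a w b y"
  using Me_pos by (simp add: field_simps mult_left_le)

lemma Me0: "Me > 0" using Me_pos by simp

lemma ln_qd: "ln (qd y) = (\<Sum>t<n. - (cmod (y (t, p)))\<^sup>2 / P - ln (pi * P))"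
  unfolding qd_def using P1 by (subst prod_ln) (auto simp: ln_div)

context
  fixes a b assumes ab: "a < Md" "b < Me"
begin

lemma Y_out: "t < n \<Longrightarrow> k \<in> {p, q} \<Longrightarrow> (\<lambda>w. out a b w (t, k)) \<in> borel_measurable chan_meas"
  using out_meas ab by blast

lemma integrable_ln_wt2: "integrable chan_meas (\<lambda>w. ln (wtde a w b (out a b w)))"
proof (rule integrable_ln[where a = a and b = b])
  show "(\<lambda>w. wtde a w b (out a b w)) \<in> borel_measurable chan_meas"
    using wt2_meas[where F = id and Y = "out a b", OF measurable_ident Y_out ab] by simp
  show "wtde a w b (out a b w) \<le> real Me" for w
    using wt2_le_1[of p q "\<sigma> a w" "\<tau> a w" n b "out a b w"] Me_pos by linarith
qed (rule wt2_div)

lemma integrable_ln_mix2: "integrable chan_meas (\<lambda>w. ln (mixde a w (out a b w)))"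
proof (rule integrable_ln[where a = a and b = b])
  show "(\<lambda>w. mixde a w (out a b w)) \<in> borel_measurable chan_meas"
    using mix2_meas[where F = id and Y = "out a b", OF measurable_ident Y_out ab(1)] by simp
  show "wtde a w b (out a b w) / real Me \<le> mixde a w (out a b w)" for w
    by (rule order.trans[OF wt2_div wt2_le_mix2[OF ab(2)]])
qed (rule mix2_le)

lemma integrable_ln_mix1: "integrable chan_meas (\<lambda>w. ln (mixd a w (out a b w)))"
proof (rule integrable_ln[where a = a and b = b])
  show "(\<lambda>w. mixd a w (out a b w)) \<in> borel_measurable chan_meas"
    using mix1_meas[where F = id and Y = "out a b", OF measurable_ident Y_out ab(1)] by simp
  show "wtde a w b (out a b w) / real Me \<le> mixd a w (out a b w)" for w
    by (rule order.trans[OF order.trans[OF wt2_div wt2_le_wt1] wt1_le_mix1[OF ab(2)]])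
qed (rule mix1_le)

lemma integrable_ln_predp:
  assumes "t < n" shows "integrable chan_meas (\<lambda>w. ln (predp a w t (out a b w)))"
proof (rule integrable_ln[where a = a and b = b])
  show "(\<lambda>w. predp a w t (out a b w)) \<in> borel_measurable chan_meas"
    using predp_meas[where F = id and Y = "out a b", OF measurable_ident Y_out ab(1) assms] by simp
  show "wtde a w b (out a b w) / real Me \<le> predp a w t (out a b w)" for w
    by (rule predictive_ge'[OF ab(2) assms]) simp
  show "predp a w t (out a b w) \<le> real Me" for w
    using predictive_le_1[OF Me0, of p q "\<sigma> a w" "\<tau> a w" p "\<sigma> a w" t "out a b w"] Me_pos by linarith
qed

lemma integrable_ln_predq:
  assumes "t < n" shows "integrable chan_meas (\<lambda>w. ln (predq a w t (out a b w)))"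
proof (rule integrable_ln[where a = a and b = b])
  show "(\<lambda>w. predq a w t (out a b w)) \<in> borel_measurable chan_meas"
    using predq_meas[where F = id and Y = "out a b", OF measurable_ident Y_out ab(1) assms] by simp
  show "wtde a w b (out a b w) / real Me \<le> predq a w t (out a b w)" for w
    by (rule predictive_ge'[OF ab(2) assms]) simp
  show "predq a w t (out a b w) \<le> real Me" for w
    using predictive_le_1[OF Me0, of p q "\<sigma> a w" "\<tau> a w" q "\<tau> a w" t "out a b w"] Me_pos by linarith
qed

lemma integrable_ln_guess:
  assumes "j \<in> {1,2}" shows "integrable chan_meas (\<lambda>w. ln (guess j M m (out a b w) w))"
proof (rule chan.integrable_const_bound[where B = "ln 2 + ln (1 + real M)"])
  show "(\<lambda>w. ln (guess j M m (out a b w) w)) \<in> borel_measurable chan_meas"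
    using guess_meas[where F = id and Y = "out a b", OF measurable_ident assms, of M m] Y_out assms pq(6)
    by (intro borel_measurable_ln) auto
  have "norm (ln (guess j M m (out a b w) w)) \<le> ln 2 + ln (1 + real M)" for w
  proof -
    have "ln (guess j M m (out a b w) w) \<le> ln (1 + real M)" using guess_le by simp
    moreover have "ln (1 / 2) \<le> ln (guess j M m (out a b w) w)" by (simp add: guess_def)
    moreover have "ln (1 / 2) = - ln (2::real)" by (simp add: ln_div)
    moreover have "ln (1 + real M) \<ge> 0" "ln (2::real) \<ge> 0" by simp_all
    ultimately show ?thesis unfolding real_norm_def abs_le_iff by linarith
  qed
  then show "AE w in chan_meas. norm (ln (guess j M m (out a b w) w)) \<le> ln 2 + ln (1 + real M)" by simp
qed

lemma nn_integral_out_sq_finite: "t < n \<Longrightarrow> (\<integral>\<^sup>+ w. ennreal ((cmod (out a b w (t, p)))\<^sup>2) \<partial>chan_meas) < \<infinity>"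
proof -
  assume t: "t < n"
  let ?f = "\<lambda>a b t. \<integral>\<^sup>+ w. ennreal ((cmod (out a b w (t, p)))\<^sup>2) \<partial>chan_meas"
  have "?f a b t \<le> (\<Sum>t<n. ?f a b t)" using t by (intro member_le_sum) auto
  also have "\<dots> \<le> (\<Sum>b<Me. \<Sum>t<n. ?f a b t)" using ab by (intro member_le_sum[of b _ "\<lambda>b. \<Sum>t<n. ?f a b t"]) auto
  also have "\<dots> \<le> (\<Sum>a<Md. \<Sum>b<Me. \<Sum>t<n. ?f a b t)" using ab by (intro member_le_sum[of a _ "\<lambda>a. \<Sum>b<Me. \<Sum>t<n. ?f a b t"]) auto
  also note nn_integral_out_sq
  finally show "?f a b t < \<infinity>" by (simp add: le_less_trans)
qed

lemma integrable_out_sq: "t < n \<Longrightarrow> integrable chan_meas (\<lambda>w. (cmod (out a b w (t, p)))\<^sup>2)"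
  using nn_integral_out_sq_finite Y_out
  by (intro integrableI_nonneg) auto

lemma integrable_ln_qd: "integrable chan_meas (\<lambda>w. ln (qd (out a b w)))"
  unfolding ln_qd
  by (intro Bochner_Integration.integrable_sum Bochner_Integration.integrable_diff) (auto intro!: integrable_divide integrable_minus integrable_out_sq)

end

end

section \<open>The four likelihood ratios of the converse\<close>

context two_receivers
begin

lemma prod_wt1: "(\<Prod>t<n. \<Prod>k\<in>{p}. Ndens (y (t, k) - sg (k - 9) a b w t)) = wt1 p (\<sigma> a w) n b y"
  using pq by (simp add: wt1_def \<sigma>_def)

lemma prod_wt2: "(\<Prod>t<n. \<Prod>k\<in>{p, q}. Ndens (y (t, k) - sg (k - 9) a b w t)) = wtde a w b y"
  using pq(1,4,5) by (simp add: wt2_def \<sigma>_def \<tau>_def)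

lemma Y_snd:
  assumes "t < n" "k \<in> Q"
  shows "(\<lambda>x. snd x (t, k)) \<in> borel_measurable (chan_meas \<Otimes>\<^sub>M PiM ({..<n} \<times> Q) (\<lambda>_. lborel :: complex measure))"
  using measurable_PiM_lborel_coord[of "(t, k)" "{..<n} \<times> Q"] assms
  by (intro measurable_compose[OF measurable_snd]) auto

lemma Y_fst:
  assumes "t < n" "k \<in> Q"
  shows "(\<lambda>y. y (t, k)) \<in> borel_measurable (PiM ({..<n} \<times> Q) (\<lambda>_. lborel :: complex measure))"
  using measurable_PiM_lborel_coord[of "(t, k)" "{..<n} \<times> Q"] assms by auto

lemma nn_integral_qd: "(\<integral>\<^sup>+ y. ennreal (qd y) \<partial>leb ({..<n} \<times> {p})) = 1"
proof -
  have e: "ennreal (qd y) = (\<Prod>j\<in>{..<n} \<times> {p}. ennreal (exp (- (cmod (y j))\<^sup>2 / P) / (pi * P)))" for y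
    using P1 by (subst prod_ennreal) (simp_all add: qd_def prod.cartesian_product[symmetric, where g = "\<lambda>t k. exp (- (cmod (y (t, k)))\<^sup>2 / P) / (pi * P)", simplified split_beta, simplified])
  have "(\<integral>\<^sup>+ y. ennreal (qd y) \<partial>leb ({..<n} \<times> {p})) =
    (\<Prod>j\<in>{..<n} \<times> {p}. \<integral>\<^sup>+ z. ennreal (exp (- (cmod z)\<^sup>2 / P) / (pi * P)) \<partial>lborel)"
    unfolding e by (rule lb.product_nn_integral_prod) auto
  then show ?thesis using P1 nn_integral_Gauss_var[of P] by simp
qed

lemma nn_integral_wt2:
  "(\<integral>\<^sup>+ y. ennreal (wt2 p q s s' n b y) \<partial>leb ({..<n} \<times> {p, q})) \<le> 1"
  unfolding wt2_def
proof (rule nn_integral_prod_le_1[OF pq(1)])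
  fix t m :: nat assume "t < m"
  then show "(\<lambda>y. Ndens (y (t, p) - s t b) * Ndens (y (t, q) - s' t b)) \<in> borel_measurable (PiM ({..<m} \<times> {p, q}) (\<lambda>_. lborel))"
    by (intro borel_measurable_times measurable_compose[OF _ Ndens_measurable] borel_measurable_diff
        measurable_PiM_lborel_coord) auto
next
  fix t and y :: "nat \<times> nat \<Rightarrow> complex"
  show "(\<integral>\<^sup>+ u. \<integral>\<^sup>+ v. ennreal (Ndens ((y((t, p) := u, (t, q) := v)) (t, p) - s t b) *
      Ndens ((y((t, p) := u, (t, q) := v)) (t, q) - s' t b)) \<partial>lborel \<partial>lborel) \<le> 1"
    using pq(1) by (simp add: ennreal_mult nn_integral_cmult nn_integral_Ndens_shift)
qed auto

text \<open>Counterpart of n r_d \<le> h(Y_d) - h(Y_d | W_d), with \<open>qd\<close> in place of the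
  output law. Summing over \<open>b\<close> cancels \<open>mixd\<close>, and summing the guesses
  over \<open>a\<close> leaves a multiple of \<open>qd\<close>.\<close>

lemma gibbs_decode_first:
  "(\<Sum>a<Md. \<Sum>b<Me. \<integral>\<^sup>+ w. ennreal (qd (out a b w) * guess d Md a (out a b w) w * (real Me / mixd a w (out a b w))) \<partial>chan_meas)
    \<le> ennreal (real Md * real Me)"
proof (rule change_of_measure[where Q = "{p}"])
  show "{p} \<subseteq> {10, 11}" using pq by simp
next
  fix a b assume ab: "a < Md" "b < Me"
  show "(\<lambda>x. qd (snd x) * guess d Md a (snd x) (fst x) * (real Me / mixd a (fst x) (snd x)))
    \<in> borel_measurable (chan_meas \<Otimes>\<^sub>M leb ({..<n} \<times> {p}))"
    using ab de by (intro borel_measurable_times borel_measurable_divide borel_measurable_const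
        qd_meas[OF measurable_fst] guess_meas[OF measurable_fst] mix1_meas[OF measurable_fst] Y_snd)
      (auto simp: p_def)
next
  fix a b and y y' :: "nat \<times> nat \<Rightarrow> complex" and w w' :: "nat \<Rightarrow> nat \<Rightarrow> complex"
  assume y: "\<And>t k. t < n \<Longrightarrow> k \<in> {p} \<Longrightarrow> y (t, k) = y' (t, k)" and w: "\<And>t k. k < 10 \<Longrightarrow> w t k = w' t k"
  have "qd y = qd y'" using y by (simp add: qd_def)
  moreover have "guess d Md a y w = guess d Md a y' w'"
    using y w by (intro guess_cong) (auto simp: p_def)
  moreover have "mixd a w y = mixd a w' y'"
    using \<sigma>_cong[of w w' a, OF w] y by (auto intro!: mix1_cong)
  ultimately show "qd y * guess d Md a y w * (real Me / mixd a w y) =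
    qd y' * guess d Md a y' w' * (real Me / mixd a w' y')" by simp
next
  fix a b y w assume "a < Md" "b < Me"
  show "0 \<le> qd y * guess d Md a y w * (real Me / mixd a w y)"
    by (intro mult_nonneg_nonneg divide_nonneg_nonneg less_imp_le[OF qd_pos] less_imp_le[OF guess_pos]
        less_imp_le[OF mix1_pos] Me0) auto
next
  fix w
  have "(\<Sum>a<Md. \<Sum>b<Me. wt1 p (\<sigma> a w) n b y * (qd y * guess d Md a y w * (real Me / mixd a w y)))
      \<le> real Md * real Me * qd y" for y
  proof -
    have "(\<Sum>b<Me. wt1 p (\<sigma> a w) n b y * (qd y * guess d Md a y w * (real Me / mixd a w y)))
      = qd y * real Me * guess d Md a y w" for a
      using mix1_pos[OF Me0, of p "\<sigma> a w" n y]
      unfolding sum_distrib_right[symmetric] mix1_def[symmetric] by simp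
    then have "(\<Sum>a<Md. \<Sum>b<Me. wt1 p (\<sigma> a w) n b y * (qd y * guess d Md a y w * (real Me / mixd a w y)))
      = qd y * real Me * (\<Sum>a<Md. guess d Md a y w)"
      by (simp add: sum_distrib_left)
    also have "\<dots> \<le> qd y * real Me * real Md"
      by (intro mult_left_mono sum_guess_le mult_nonneg_nonneg less_imp_le[OF qd_pos]) auto
    finally show ?thesis by (simp add: mult_ac)
  qed
  then have "(\<integral>\<^sup>+ y. ennreal (\<Sum>a<Md. \<Sum>b<Me. wt1 p (\<sigma> a w) n b y * (qd y * guess d Md a y w * (real Me / mixd a w y)))
      \<partial>leb ({..<n} \<times> {p})) \<le> (\<integral>\<^sup>+ y. ennreal (real Md * real Me) * ennreal (qd y) \<partial>leb ({..<n} \<times> {p}))"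
    by (intro nn_integral_mono) (simp add: ennreal_mult[symmetric] less_imp_le[OF qd_pos] ennreal_leI)
  also have "\<dots> = ennreal (real Md * real Me) * (\<integral>\<^sup>+ y. ennreal (qd y) \<partial>leb ({..<n} \<times> {p}))"
  proof (intro nn_integral_cmult measurable_compose[OF _ measurable_ennreal])
    have "(\<lambda>y. exp (- (cmod (y (t, p)))\<^sup>2 / P) / (pi * P)) \<in> borel_measurable (PiM ({..<n} \<times> {p}) (\<lambda>_. lborel :: complex measure))"
      if "t < n" for t
      by (rule measurable_compose[OF Y_fst[OF that, of p "{p}"], where g = "\<lambda>z. exp (- (cmod z)\<^sup>2 / P) / (pi * P)"]) auto
    then show "qd \<in> borel_measurable (leb ({..<n} \<times> {p}))"
      unfolding qd_def[abs_def] by (intro borel_measurable_prod) auto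
  qed
  finally show "(\<integral>\<^sup>+ y. ennreal (\<Sum>a<Md. \<Sum>b<Me. (\<Prod>t<n. \<Prod>k\<in>{p}. Ndens (y (t, k) - sg (k - 9) a b w t)) *
        (qd y * guess d Md a y w * (real Me / mixd a w y)))
      \<partial>leb ({..<n} \<times> {p})) \<le> ennreal (real Md * real Me)"
    by (simp add: prod_wt1 nn_integral_qd del: prod.insert)
qed

lemma pq_sub: "{p, q} \<subseteq> {10, 11}" using pq by simp

lemma mix2_congw:
  assumes "\<And>t k. t < n \<Longrightarrow> k \<in> {p, q} \<Longrightarrow> y (t, k) = y' (t, k)" and w: "\<And>t k. k < 10 \<Longrightarrow> w t k = w' t k"
  shows "mixde a w y = mixde a w' y'"
proof -
  have s: "\<sigma> a w = \<sigma> a w'" "\<tau> a w = \<tau> a w'" using w by (blast intro: \<sigma>_cong \<tau>_cong)+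
  show ?thesis unfolding s using assms(1) by (intro mix2_cong) auto
qed

lemma predp_congw:
  assumes "\<And>t k. t < n \<Longrightarrow> k \<in> {p, q} \<Longrightarrow> y (t, k) = y' (t, k)" and w: "\<And>t k. k < 10 \<Longrightarrow> w t k = w' t k" and "t < n"
  shows "predp a w t y = predp a w' t y'"
proof -
  have s: "\<sigma> a w = \<sigma> a w'" "\<tau> a w = \<tau> a w'" using w by (blast intro: \<sigma>_cong \<tau>_cong)+
  show ?thesis unfolding s using assms(1,3) by (intro predictive_cong) auto
qed

lemma predq_congw:
  assumes "\<And>t k. t < n \<Longrightarrow> k \<in> {p, q} \<Longrightarrow> y (t, k) = y' (t, k)" and w: "\<And>t k. k < 10 \<Longrightarrow> w t k = w' t k" and "t < n"
  shows "predq a w t y = predq a w' t y'"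
proof -
  have s: "\<sigma> a w = \<sigma> a w'" "\<tau> a w = \<tau> a w'" using w by (blast intro: \<sigma>_cong \<tau>_cong)+
  show ?thesis unfolding s using assms(1,3) by (intro predictive_cong) auto
qed

text \<open>Counterpart of n r_e \<le> h(Y_d, Y_e | W_d) - h(noise). The likelihoods use both
  outputs and the message \<open>a\<close>, while the guess still comes from the decoder of
  \<open>e\<close>. The denominator cancels the likelihood of the true message, so the sum over
  \<open>b\<close> acts on the guesses alone.\<close>

lemma gibbs_decode_second:
  "(\<Sum>a<Md. \<Sum>b<Me. \<integral>\<^sup>+ w. ennreal (mixde a w (out a b w) / real Me * guess e Me b (out a b w) w
      / wtde a w b (out a b w)) \<partial>chan_meas) \<le> ennreal (real Md * real Me)"
proof (rule change_of_measure[where Q = "{p, q}", OF pq_sub])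
  fix a b assume ab: "a < Md" "b < Me"
  show "(\<lambda>x. mixde a (fst x) (snd x) / real Me * guess e Me b (snd x) (fst x)
      / wtde a (fst x) b (snd x))
    \<in> borel_measurable (chan_meas \<Otimes>\<^sub>M leb ({..<n} \<times> {p, q}))"
    using ab de by (intro borel_measurable_times borel_measurable_divide borel_measurable_const
        mix2_meas[OF measurable_fst] guess_meas[OF measurable_fst] wt2_meas[OF measurable_fst] Y_snd)
      (auto simp: q_def)
next
  fix a b and y y' :: "nat \<times> nat \<Rightarrow> complex" and w w' :: "nat \<Rightarrow> nat \<Rightarrow> complex"
  assume y: "\<And>t k. t < n \<Longrightarrow> k \<in> {p, q} \<Longrightarrow> y (t, k) = y' (t, k)" and w: "\<And>t k. k < 10 \<Longrightarrow> w t k = w' t k"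
  have "guess e Me b y w = guess e Me b y' w'"
    using y w by (intro guess_cong) (auto simp: q_def)
  moreover have "wtde a w b y = wtde a w' b y'"
  proof -
    have s: "\<sigma> a w = \<sigma> a w'" "\<tau> a w = \<tau> a w'" using w by (blast intro: \<sigma>_cong \<tau>_cong)+
    show ?thesis unfolding s using y by (intro wt2_cong) auto
  qed
  ultimately show "mixde a w y / real Me * guess e Me b y w / wtde a w b y =
    mixde a w' y' / real Me * guess e Me b y' w' / wtde a w' b y'"
    using mix2_congw[of y y' w w' a, OF y w] by simp
next
  fix a b y w assume "a < Md" "b < Me"
  show "0 \<le> mixde a w y / real Me * guess e Me b y w / wtde a w b y"
    by (intro mult_nonneg_nonneg divide_nonneg_nonneg less_imp_le[OF guess_pos] less_imp_le[OF mix2_pos] Me0) auto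
next
  fix w assume w: "w \<in> space chan_meas"
  have "(\<Sum>a<Md. \<Sum>b<Me. wtde a w b y * (mixde a w y / real Me * guess e Me b y w
        / wtde a w b y))
      \<le> (\<Sum>a<Md. mixde a w y)" for y
  proof (rule sum_mono)
    fix a
    have "wtde a w b y \<noteq> 0" for b
      using wt2_pos[of p q "\<sigma> a w" "\<tau> a w" n b y] by linarith
    then have "(\<Sum>b<Me. wtde a w b y * (mixde a w y / real Me * guess e Me b y w
        / wtde a w b y)) = mixde a w y / real Me * (\<Sum>b<Me. guess e Me b y w)"
      by (simp add: sum_distrib_left)
    also have "\<dots> \<le> mixde a w y / real Me * real Me"
      by (intro mult_left_mono sum_guess_le divide_nonneg_nonneg less_imp_le[OF mix2_pos] Me0) auto
    also have "\<dots> = mixde a w y" using Me0 by simp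
    finally show "(\<Sum>b<Me. wtde a w b y * (mixde a w y / real Me * guess e Me b y w
        / wtde a w b y)) \<le> mixde a w y" .
  qed
  then have "(\<integral>\<^sup>+ y. ennreal (\<Sum>a<Md. \<Sum>b<Me. wtde a w b y * (mixde a w y / real Me * guess e Me b y w
        / wtde a w b y)) \<partial>leb ({..<n} \<times> {p, q}))
    \<le> (\<integral>\<^sup>+ y. (\<Sum>a<Md. \<Sum>b<Me. ennreal (wtde a w b y)) \<partial>leb ({..<n} \<times> {p, q}))"
    by (intro nn_integral_mono) (simp add: mix2_def ennreal_leI sum_ennreal sum_nonneg)
  also have "\<dots> = (\<Sum>a<Md. \<integral>\<^sup>+ y. (\<Sum>b<Me. ennreal (wtde a w b y)) \<partial>leb ({..<n} \<times> {p, q}))"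
    by (intro nn_integral_sum borel_measurable_sum measurable_compose[OF _ measurable_ennreal] wt2_measurable Y_fst) auto
  also have "\<dots> = (\<Sum>a<Md. \<Sum>b<Me. \<integral>\<^sup>+ y. ennreal (wtde a w b y) \<partial>leb ({..<n} \<times> {p, q}))"
    by (intro sum.cong refl nn_integral_sum measurable_compose[OF _ measurable_ennreal] wt2_measurable Y_fst) auto
  also have "\<dots> \<le> (\<Sum>a<Md. \<Sum>b<Me. 1)"
    by (intro sum_mono nn_integral_wt2)
  also have "\<dots> = ennreal (real Md * real Me)"
    by (simp add: ennreal_of_nat_eq_real_of_nat ennreal_mult)
  finally show "(\<integral>\<^sup>+ y. ennreal (\<Sum>a<Md. \<Sum>b<Me. (\<Prod>t<n. \<Prod>k\<in>{p, q}. Ndens (y (t, k) - sg (k - 9) a b w t)) *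
        (mixde a w y / real Me * guess e Me b y w / wtde a w b y))
      \<partial>leb ({..<n} \<times> {p, q})) \<le> ennreal (real Md * real Me)"
    unfolding prod_wt2 .
qed

lemma nn_integral_sum_const_bound:
  assumes nn: "\<And>a y. f a y \<ge> (0::real)"
    and m: "\<And>a. a < Md \<Longrightarrow> (\<lambda>y. f a y) \<in> borel_measurable M"
    and le: "\<And>a. a < Md \<Longrightarrow> (\<integral>\<^sup>+ y. ennreal (f a y) \<partial>M) \<le> ennreal (real Me)"
  shows "(\<integral>\<^sup>+ y. ennreal (\<Sum>a<Md. f a y) \<partial>M) \<le> ennreal (real Md * real Me)"
proof -
  have "(\<integral>\<^sup>+ y. ennreal (\<Sum>a<Md. f a y) \<partial>M) = (\<integral>\<^sup>+ y. (\<Sum>a<Md. ennreal (f a y)) \<partial>M)"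
    by (simp add: sum_ennreal nn)
  also have "\<dots> = (\<Sum>a<Md. \<integral>\<^sup>+ y. ennreal (f a y) \<partial>M)"
    using m by (intro nn_integral_sum) auto
  also have "\<dots> \<le> (\<Sum>a<Md. ennreal (real Me))"
    by (intro sum_mono le) auto
  also have "\<dots> = ennreal (real Md * real Me)"
    by (simp add: ennreal_of_nat_eq_real_of_nat ennreal_mult)
  finally show ?thesis .
qed

text \<open>The joint predictive density of both outputs is compared with the product of its marginals.\<close>

lemma gibbs_independence:
  "(\<Sum>a<Md. \<Sum>b<Me. \<integral>\<^sup>+ w. ennreal (real Me * (\<Prod>t<n. predp a w t (out a b w)
        * predq a w t (out a b w)) / mixde a w (out a b w)) \<partial>chan_meas)
     \<le> ennreal (real Md * real Me)"
proof (rule change_of_measure[where Q = "{p, q}", OF pq_sub])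
  fix a b assume ab: "a < Md" "b < Me"
  show "(\<lambda>x. real Me * (\<Prod>t<n. predp a (fst x) t (snd x)
        * predq a (fst x) t (snd x)) / mixde a (fst x) (snd x))
    \<in> borel_measurable (chan_meas \<Otimes>\<^sub>M leb ({..<n} \<times> {p, q}))"
    using ab by (intro borel_measurable_times borel_measurable_divide borel_measurable_const borel_measurable_prod
        mix2_meas[OF measurable_fst] predp_meas[OF measurable_fst] predq_meas[OF measurable_fst] Y_snd) auto
next
  fix a b and y y' :: "nat \<times> nat \<Rightarrow> complex" and w w' :: "nat \<Rightarrow> nat \<Rightarrow> complex"
  assume y: "\<And>t k. t < n \<Longrightarrow> k \<in> {p, q} \<Longrightarrow> y (t, k) = y' (t, k)" and w: "\<And>t k. k < 10 \<Longrightarrow> w t k = w' t k"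
  show "real Me * (\<Prod>t<n. predp a w t y
        * predq a w t y) / mixde a w y =
      real Me * (\<Prod>t<n. predp a w' t y'
        * predq a w' t y') / mixde a w' y'"
  proof -
    have "(\<Prod>t<n. predp a w t y * predq a w t y) =
      (\<Prod>t<n. predp a w' t y' * predq a w' t y')"
      by (rule prod.cong) (use predp_congw[of y y' w w' _ a, OF y w] predq_congw[of y y' w w' _ a, OF y w] in auto)
    then show ?thesis using mix2_congw[of y y' w w' a, OF y w] by simp
  qed
next
  fix a b y w assume "a < Md" "b < Me"
  show "0 \<le> real Me * (\<Prod>t<n. predp a w t y
        * predq a w t y) / mixde a w y"
    by (intro mult_nonneg_nonneg divide_nonneg_nonneg prod_nonneg less_imp_le[OF mix2_pos] less_imp_le[OF predictive_pos] Me0 ballI) auto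
next
  fix w assume w: "w \<in> space chan_meas"
  define f where "f a y = real Me * (\<Prod>t<n. predp a w t y
        * predq a w t y)" for a y
  have fm: "(\<lambda>y. \<Prod>t<n. predp a w t y * predq a w t y)
     \<in> borel_measurable (leb ({..<n} \<times> {p, q}))" for a
    by (intro borel_measurable_times borel_measurable_prod predictive_measurable Y_fst) auto
  have "(\<Sum>a<Md. \<Sum>b<Me. wtde a w b y * (f a y / mixde a w y)) = (\<Sum>a<Md. f a y)" for y
  proof (rule sum.cong[OF refl])
    fix a
    show "(\<Sum>b<Me. wtde a w b y * (f a y / mixde a w y)) = f a y"
      using mix2_pos[OF Me0, of p q "\<sigma> a w" "\<tau> a w" n y]
      unfolding sum_distrib_right[symmetric] mix2_def[symmetric] by simp
  qed
  moreover have "(\<integral>\<^sup>+ y. ennreal (\<Sum>a<Md. f a y) \<partial>leb ({..<n} \<times> {p, q})) \<le> ennreal (real Md * real Me)"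
  proof (rule nn_integral_sum_const_bound)
    show "0 \<le> f a y" for a y
      unfolding f_def by (intro mult_nonneg_nonneg prod_nonneg less_imp_le[OF predictive_pos] Me0 ballI) auto
    show "(\<lambda>y. f a y) \<in> borel_measurable (leb ({..<n} \<times> {p, q}))" for a
      unfolding f_def by (intro borel_measurable_times fm) auto
    show "(\<integral>\<^sup>+ y. ennreal (f a y) \<partial>leb ({..<n} \<times> {p, q})) \<le> ennreal (real Me)" for a
    proof -
      have "(\<integral>\<^sup>+ y. ennreal (f a y) \<partial>leb ({..<n} \<times> {p, q})) =
        ennreal (real Me) * (\<integral>\<^sup>+ y. ennreal (\<Prod>t<n. predp a w t y
        * predq a w t y) \<partial>leb ({..<n} \<times> {p, q}))"
        unfolding f_def using fm[of a] by (subst nn_integral_cmult[symmetric]) (auto simp: ennreal_mult')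
      also have "\<dots> \<le> ennreal (real Me) * 1"
        by (intro mult_left_mono nn_integral_predictive_le_1 pq(1) Me0) auto
      finally show ?thesis by simp
    qed
  qed
  ultimately show "(\<integral>\<^sup>+ y. ennreal (\<Sum>a<Md. \<Sum>b<Me. (\<Prod>t<n. \<Prod>k\<in>{p, q}. Ndens (y (t, k) - sg (k - 9) a b w t)) *
        (real Me * (\<Prod>t<n. predp a w t y
        * predq a w t y) / mixde a w y))
      \<partial>leb ({..<n} \<times> {p, q})) \<le> ennreal (real Md * real Me)"
    unfolding prod_wt2 f_def by simp
qed

text \<open>Predicting the output of receiver \<open>d\<close> from its own past instead of the past of both receivers.\<close>

lemma gibbs_feedback:
  "(\<Sum>a<Md. \<Sum>b<Me. \<integral>\<^sup>+ w. ennreal (mixd a w (out a b w) / real Me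
       / (\<Prod>t<n. predp a w t (out a b w))) \<partial>chan_meas)
     \<le> ennreal (real Md * real Me)"
proof (rule change_of_measure[where Q = "{p, q}", OF pq_sub])
  fix a b assume ab: "a < Md" "b < Me"
  show "(\<lambda>x. mixd a (fst x) (snd x) / real Me
       / (\<Prod>t<n. predp a (fst x) t (snd x)))
    \<in> borel_measurable (chan_meas \<Otimes>\<^sub>M leb ({..<n} \<times> {p, q}))"
    using ab by (intro borel_measurable_divide borel_measurable_const borel_measurable_prod
        mix1_meas[OF measurable_fst] predp_meas[OF measurable_fst] Y_snd) auto
next
  fix a b and y y' :: "nat \<times> nat \<Rightarrow> complex" and w w' :: "nat \<Rightarrow> nat \<Rightarrow> complex"
  assume y: "\<And>t k. t < n \<Longrightarrow> k \<in> {p, q} \<Longrightarrow> y (t, k) = y' (t, k)" and w: "\<And>t k. k < 10 \<Longrightarrow> w t k = w' t k"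
  have "mixd a w y = mixd a w' y'"
    using \<sigma>_cong[of w w' a, OF w] y by (auto intro!: mix1_cong)
  moreover have "(\<Prod>t<n. predp a w t y) =
      (\<Prod>t<n. predp a w' t y')"
    by (rule prod.cong) (use predp_congw[of y y' w w' _ a, OF y w] in auto)
  ultimately show "mixd a w y / real Me / (\<Prod>t<n. predp a w t y) =
      mixd a w' y' / real Me / (\<Prod>t<n. predp a w' t y')"
    by simp
next
  fix a b y w assume "a < Md" "b < Me"
  show "0 \<le> mixd a w y / real Me / (\<Prod>t<n. predp a w t y)"
    by (intro divide_nonneg_nonneg prod_nonneg less_imp_le[OF mix1_pos] less_imp_le[OF predictive_pos] Me0 ballI) auto
next
  fix w assume w: "w \<in> space chan_meas"
  define f where "f a y = (1 / real Me) * (mixde a w y * mixd a w y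
      / (\<Prod>t<n. predp a w t y))" for a y
  have fm: "(\<lambda>y. mixde a w y * mixd a w y
      / (\<Prod>t<n. predp a w t y)) \<in> borel_measurable (leb ({..<n} \<times> {p, q}))" for a
    by (intro borel_measurable_times borel_measurable_divide borel_measurable_prod predictive_measurable mix1_measurable mix2_measurable Y_fst) auto
  have "(\<Sum>a<Md. \<Sum>b<Me. wtde a w b y * (mixd a w y / real Me
       / (\<Prod>t<n. predp a w t y))) = (\<Sum>a<Md. f a y)" for y
    unfolding sum_distrib_right[symmetric] mix2_def[symmetric] by (simp add: f_def)
  moreover have "(\<integral>\<^sup>+ y. ennreal (\<Sum>a<Md. f a y) \<partial>leb ({..<n} \<times> {p, q})) \<le> ennreal (real Md * real Me)"
  proof (rule nn_integral_sum_const_bound)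
    show "0 \<le> f a y" for a y
      unfolding f_def by (intro mult_nonneg_nonneg divide_nonneg_nonneg prod_nonneg less_imp_le[OF predictive_pos]
          less_imp_le[OF mix1_pos] less_imp_le[OF mix2_pos] Me0 ballI) auto
    show "(\<lambda>y. f a y) \<in> borel_measurable (leb ({..<n} \<times> {p, q}))" for a
      unfolding f_def by (intro borel_measurable_times fm) auto
    show "(\<integral>\<^sup>+ y. ennreal (f a y) \<partial>leb ({..<n} \<times> {p, q})) \<le> ennreal (real Me)" for a
    proof -
      have "(\<integral>\<^sup>+ y. ennreal (f a y) \<partial>leb ({..<n} \<times> {p, q})) =
        ennreal (1 / real Me) * (\<integral>\<^sup>+ y. ennreal (mixde a w y * mixd a w y
      / (\<Prod>t<n. predp a w t y)) \<partial>leb ({..<n} \<times> {p, q}))"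
        unfolding f_def using fm[of a] by (subst nn_integral_cmult[symmetric]) (auto simp: ennreal_mult'[symmetric])
      also have "\<dots> \<le> ennreal (1 / real Me) * ennreal ((real Me)\<^sup>2)"
        by (intro mult_left_mono nn_integral_mix_ratio_le pq(1) Me0) auto
      also have "\<dots> = ennreal (1 / real Me * (real Me)\<^sup>2)"
        by (rule ennreal_mult[symmetric]) auto
      also have "1 / real Me * (real Me)\<^sup>2 = real Me"
        using Me0 by (simp add: power2_eq_square)
      finally show ?thesis .
    qed
  qed
  ultimately show "(\<integral>\<^sup>+ y. ennreal (\<Sum>a<Md. \<Sum>b<Me. (\<Prod>t<n. \<Prod>k\<in>{p, q}. Ndens (y (t, k) - sg (k - 9) a b w t)) *
        (mixd a w y / real Me / (\<Prod>t<n. predp a w t y)))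
      \<partial>leb ({..<n} \<times> {p, q})) \<le> ennreal (real Md * real Me)"
    unfolding prod_wt2 by simp
qed

text \<open>This is where the lack of current channel knowledge at the transmitters enters: given the past,
  both receivers see statistically equivalent signals.\<close>

lemma flip_pred:
  assumes "t < n"
  shows "predp a (flip t w) t (out a b (flip t w))
    = predq a w t (out a b w)"
proof -
  let ?w = "flip t w"
  have earlier: "?w s = w s" if "s < t" for s using that by (simp add: flip_def)
  have XR: "XR c l m1 m2 t ?w = XR c l m1 m2 t w" if "l \<in> {1,2}" for l m1 m2
    by (rule XR_cong) (use that earlier in auto)
  have G: "Gc d l t ?w = Gc e l t w" if "l \<in> {1,2}" for l
    using that de by (auto simp: Gc_def flip_def flip_perm_def)
  have Z: "?w t p = w t q"
    using de by (auto simp: flip_def flip_perm_def p_def q_def)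
  have sg_t: "sg d a b ?w t = sg e a b w t" for b
    using XR G by (simp add: sg_def)
  have sg_s: "sg j a b ?w s = sg j a b w s" if "s < t" "j \<in> {1,2}" for j b s
    using that earlier by (intro sg_cong) auto
  have out_s: "out a b ?w (s, k) = out a b w (s, k)" if "s < t" "k \<in> {p, q}" for s k
    using that pq(2,3) earlier[OF that(1)] sg_s[OF that(1), of "k - 9"] by (auto simp: out_eq)
  have out_t: "out a b ?w (t, p) - \<sigma> a ?w t b' = out a b w (t, q) - \<tau> a w t b'" for b'
    using pq sg_t by (auto simp: out_eq \<sigma>_def \<tau>_def Z)
  have wt: "wt2 p q (\<sigma> a ?w) (\<tau> a ?w) t b' (out a b ?w) = wt2 p q (\<sigma> a w) (\<tau> a w) t b' (out a b w)" for b'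
    unfolding wt2_def using de out_s sg_s by (intro prod.cong) (auto simp: \<sigma>_def \<tau>_def)
  show ?thesis
    unfolding predictive_def mix2_def wt out_t ..
qed

lemma integral_ln_pred_eq:
  assumes "t < n" "a < Md" "b < Me"
  shows "(\<integral> w. ln (predp a w t (out a b w)) \<partial>chan_meas)
    = (\<integral> w. ln (predq a w t (out a b w)) \<partial>chan_meas)"
  using integral_flip[OF borel_measurable_integrable[OF integrable_ln_predp[OF assms(2,3,1)]], of t]
  unfolding flip_pred[OF assms(1)] by simp

text \<open>The four ratios enter with weights 2, 1, 1, 2, forced by cancellation:
  \<open>mixd\<close> occurs in the first and the last, \<open>mixde\<close> in the second and the
  third, and the predictive terms cancel once the exchange of receivers has identified the two sums
  in the third.\<close>

lemma core_inequality:
  "(\<Sum>a<Md. \<Sum>b<Me. 2 * (\<integral> w. ln (qd (out a b w)) \<partial>chan_meas) + 2 * (\<integral> w. ln (guess d Md a (out a b w) w) \<partial>chan_meas)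
      + (\<integral> w. ln (guess e Me b (out a b w) w) \<partial>chan_meas)) \<le> 0"
proof -
  define fA where "fA a b w = qd (out a b w) * guess d Md a (out a b w) w * (real Me / mixd a w (out a b w))" for a b w
  define fB where "fB a b w = mixde a w (out a b w) / real Me * guess e Me b (out a b w) w
      / wtde a w b (out a b w)" for a b w
  define fC where "fC a b w = real Me * (\<Prod>t<n. predp a w t (out a b w)
        * predq a w t (out a b w)) / mixde a w (out a b w)" for a b w
  define fD where "fD a b w = mixd a w (out a b w) / real Me
       / (\<Prod>t<n. predp a w t (out a b w))" for a b w
  define pp where "pp t a b w = ln (predp a w t (out a b w))" for t a b w
  define pr where "pr t a b w = ln (predq a w t (out a b w))" for t a b w
  define lq where "lq a b w = ln (qd (out a b w))" for a b w
  define lg where "lg a b w = ln (guess d Md a (out a b w) w)" for a b w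
  define le where "le a b w = ln (guess e Me b (out a b w) w)" for a b w
  define l1 where "l1 a b w = ln (mixd a w (out a b w))" for a b w
  define l2 where "l2 a b w = ln (mixde a w (out a b w))" for a b w
  define lw where "lw a b w = ln (wtde a w b (out a b w))" for a b w
  note defs = pp_def pr_def lq_def lg_def le_def l1_def l2_def lw_def
  note pos = mix1_pos[OF Me0] mix2_pos[OF Me0] predictive_pos[OF Me0] wt2_pos qd_pos guess_pos
  have i: "integrable chan_meas (pp t a b)" "integrable chan_meas (pr t a b)" if "t < n" "a < Md" "b < Me" for t a b
    unfolding defs using integrable_ln_predp[OF that(2,3,1)] integrable_ln_predq[OF that(2,3,1)] by auto
  have j: "integrable chan_meas (lq a b)" "integrable chan_meas (lg a b)" "integrable chan_meas (le a b)"
    "integrable chan_meas (l1 a b)" "integrable chan_meas (l2 a b)" "integrable chan_meas (lw a b)" if "a < Md" "b < Me" for a b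
    unfolding defs using integrable_ln_qd[OF that] integrable_ln_guess[OF that de(1)] integrable_ln_guess[OF that de(2)]
      integrable_ln_mix1[OF that] integrable_ln_mix2[OF that] integrable_ln_wt2[OF that] by auto
  have posA: "fA a b w > 0" and posB: "fB a b w > 0" and posC: "fC a b w > 0" and posD: "fD a b w > 0" for a b w
    unfolding fA_def fB_def fC_def fD_def using Me0 by (auto intro!: mult_pos_pos divide_pos_pos prod_pos pos)
  have lnA: "ln (fA a b w) = lq a b w + lg a b w + ln (real Me) - l1 a b w" for a b w
    unfolding fA_def defs using pos Me0
    by (simp add: ln_mult_pos ln_divide_pos)
  have lnB: "ln (fB a b w) = l2 a b w - ln (real Me) + le a b w - lw a b w" for a b w
    unfolding fB_def defs using pos Me0
    by (simp add: ln_mult_pos ln_divide_pos)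
  have prodC: "(\<Prod>t<n. predp a w t (out a b w)
        * predq a w t (out a b w)) > 0" for a b w
    by (intro prod_pos mult_pos_pos pos ballI)
  have prodD: "(\<Prod>t<n. predp a w t (out a b w)) > 0" for a b w
    by (intro prod_pos pos ballI)
  have lnC: "ln (fC a b w) = ln (real Me) + (\<Sum>t<n. pp t a b w + pr t a b w) - l2 a b w" for a b w
  proof -
    have "ln (fC a b w) = ln (real Me) + ln (\<Prod>t<n. predp a w t (out a b w)
        * predq a w t (out a b w)) - l2 a b w"
      unfolding fC_def defs using pos Me0 prodC by (simp add: ln_mult_pos ln_divide_pos)
    also have "ln (\<Prod>t<n. predp a w t (out a b w)
        * predq a w t (out a b w)) = (\<Sum>t<n. pp t a b w + pr t a b w)"
      unfolding defs by (subst prod_ln) (auto intro!: mult_pos_pos pos simp: ln_mult_pos pos)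
    finally show ?thesis .
  qed
  have lnD: "ln (fD a b w) = l1 a b w - ln (real Me) - (\<Sum>t<n. pp t a b w)" for a b w
  proof -
    have "ln (fD a b w) = l1 a b w - ln (real Me) - ln (\<Prod>t<n. predp a w t (out a b w))"
      unfolding fD_def defs using pos Me0 prodD by (simp add: ln_divide_pos ln_mult_pos)
    also have "ln (\<Prod>t<n. predp a w t (out a b w)) = (\<Sum>t<n. pp t a b w)"
      unfolding defs by (subst prod_ln) (auto intro!: pos)
    finally show ?thesis .
  qed
  have intA: "integrable chan_meas (\<lambda>w. ln (fA a b w))" and intB: "integrable chan_meas (\<lambda>w. ln (fB a b w))"
    and intC: "integrable chan_meas (\<lambda>w. ln (fC a b w))" and intD: "integrable chan_meas (\<lambda>w. ln (fD a b w))"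
    if "a < Md" "b < Me" for a b
    unfolding lnA lnB lnC lnD using i that j[OF that]
    by (auto intro!: Bochner_Integration.integrable_add Bochner_Integration.integrable_diff Bochner_Integration.integrable_sum)
  have meas: "f \<in> borel_measurable chan_meas" if "integrable chan_meas (\<lambda>w. ln (f w))" "\<And>w. f w > (0::real)" for f
  proof -
    have "(\<lambda>w. exp (ln (f w))) \<in> borel_measurable chan_meas"
      using borel_measurable_integrable[OF that(1)] by measurable
    then show ?thesis using that(2) by simp
  qed
  have gA: "(\<Sum>a<Md. \<Sum>b<Me. \<integral> w. ln (fA a b w) \<partial>chan_meas) \<le> 0"
    using gibbs_decode_first by (intro gibbs meas posA intA) (simp_all add: fA_def)
  have gB: "(\<Sum>a<Md. \<Sum>b<Me. \<integral> w. ln (fB a b w) \<partial>chan_meas) \<le> 0"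
    using gibbs_decode_second by (intro gibbs meas posB intB) (simp_all add: fB_def)
  have gC: "(\<Sum>a<Md. \<Sum>b<Me. \<integral> w. ln (fC a b w) \<partial>chan_meas) \<le> 0"
    using gibbs_independence by (intro gibbs meas posC intC) (simp_all add: fC_def)
  have gD: "(\<Sum>a<Md. \<Sum>b<Me. \<integral> w. ln (fD a b w) \<partial>chan_meas) \<le> 0"
    using gibbs_feedback by (intro gibbs meas posD intD) (simp_all add: fD_def)
  have "(\<Sum>a<Md. \<Sum>b<Me. 2 * (\<integral> w. lq a b w \<partial>chan_meas) + 2 * (\<integral> w. lg a b w \<partial>chan_meas) + (\<integral> w. le a b w \<partial>chan_meas))
     \<le> (\<Sum>a<Md. \<Sum>b<Me. 2 * (\<integral> w. ln (fA a b w) \<partial>chan_meas) + (\<integral> w. ln (fB a b w) \<partial>chan_meas)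
        + (\<integral> w. ln (fC a b w) \<partial>chan_meas) + 2 * (\<integral> w. ln (fD a b w) \<partial>chan_meas))"
  proof (intro sum_mono)
    fix a b assume "a \<in> {..<Md}" "b \<in> {..<Me}"
    then have ab: "a < Md" "b < Me" by auto
    note j' = j[OF ab]
    have i': "integrable chan_meas (\<lambda>w. \<Sum>t<n. pp t a b w + pr t a b w)" "integrable chan_meas (\<lambda>w. \<Sum>t<n. pp t a b w)"
      using i ab by (auto intro!: Bochner_Integration.integrable_add Bochner_Integration.integrable_sum)
    have eqp: "(\<integral> w. pp t a b w \<partial>chan_meas) = (\<integral> w. pr t a b w \<partial>chan_meas)" if "t < n" for t
      unfolding defs by (rule integral_ln_pred_eq[OF that ab])
    have A: "(\<integral> w. ln (fA a b w) \<partial>chan_meas) = (\<integral> w. lq a b w \<partial>chan_meas) + (\<integral> w. lg a b w \<partial>chan_meas) + ln (real Me) - (\<integral> w. l1 a b w \<partial>chan_meas)"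
      unfolding lnA using j' by (simp add: chan.prob_space)
    have B: "(\<integral> w. ln (fB a b w) \<partial>chan_meas) = (\<integral> w. l2 a b w \<partial>chan_meas) - ln (real Me) + (\<integral> w. le a b w \<partial>chan_meas) - (\<integral> w. lw a b w \<partial>chan_meas)"
      unfolding lnB using j' by (simp add: chan.prob_space)
    have C: "(\<integral> w. ln (fC a b w) \<partial>chan_meas) = ln (real Me) + (\<integral> w. (\<Sum>t<n. pp t a b w + pr t a b w) \<partial>chan_meas) - (\<integral> w. l2 a b w \<partial>chan_meas)"
      unfolding lnC using j' i' by (simp add: chan.prob_space)
    have D: "(\<integral> w. ln (fD a b w) \<partial>chan_meas) = (\<integral> w. l1 a b w \<partial>chan_meas) - ln (real Me) - (\<integral> w. (\<Sum>t<n. pp t a b w) \<partial>chan_meas)"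
      unfolding lnD using j' i' by (simp add: chan.prob_space)
    have S1: "(\<integral> w. (\<Sum>t<n. pp t a b w) \<partial>chan_meas) = (\<Sum>t<n. \<integral> w. pp t a b w \<partial>chan_meas)"
      using i ab by (intro Bochner_Integration.integral_sum) auto
    have "(\<integral> w. (\<Sum>t<n. pp t a b w + pr t a b w) \<partial>chan_meas) = (\<Sum>t<n. \<integral> w. pp t a b w + pr t a b w \<partial>chan_meas)"
      using i ab by (intro Bochner_Integration.integral_sum Bochner_Integration.integrable_add) auto
    also have "\<dots> = (\<Sum>t<n. (\<integral> w. pp t a b w \<partial>chan_meas) + (\<integral> w. pr t a b w \<partial>chan_meas))"
      using i ab by (intro sum.cong refl Bochner_Integration.integral_add) auto
    also have "\<dots> = 2 * (\<Sum>t<n. \<integral> w. pp t a b w \<partial>chan_meas)"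
      using eqp by (simp add: sum_distrib_left)
    finally have S2: "(\<integral> w. (\<Sum>t<n. pp t a b w + pr t a b w) \<partial>chan_meas) = 2 * (\<Sum>t<n. \<integral> w. pp t a b w \<partial>chan_meas)" .
    \<comment> \<open>The entropy of the noise is nonnegative because densities are at most 1, so
      its term may be dropped.\<close>
    have W: "(\<integral> w. lw a b w \<partial>chan_meas) \<le> 0"
    proof -
      have "lw a b w \<le> 0" for w unfolding lw_def using wt2_le_1 by simp
      then have "(\<integral> w. lw a b w \<partial>chan_meas) \<le> (\<integral> w. 0 \<partial>chan_meas)"
        using j' by (intro integral_mono) auto
      then show ?thesis by simp
    qed
    show "2 * (\<integral> w. lq a b w \<partial>chan_meas) + 2 * (\<integral> w. lg a b w \<partial>chan_meas) + (\<integral> w. le a b w \<partial>chan_meas)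
      \<le> 2 * (\<integral> w. ln (fA a b w) \<partial>chan_meas) + (\<integral> w. ln (fB a b w) \<partial>chan_meas)
        + (\<integral> w. ln (fC a b w) \<partial>chan_meas) + 2 * (\<integral> w. ln (fD a b w) \<partial>chan_meas)"
      unfolding A B C D S1 S2 using W by simp
  qed
  also have "\<dots> \<le> 0"
    using gA gB gC gD unfolding sum.distrib sum_distrib_left[symmetric] by linarith
  finally show ?thesis unfolding lq_def lg_def le_def .
qed

end

section \<open>From likelihood ratios to rates\<close>

context two_receivers
begin

text \<open>The logarithm is at least \<open>ln (M / 2)\<close> on a correct decision and equals
  \<open>- ln 2\<close> on a wrong one. The loss \<open>ln 2\<close> does not grow with the
  blocklength.\<close>

lemma sum_integral_ln_guess:
  assumes j: "j \<in> {1,2}" and M: "M \<ge> 1"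
    and m: "\<And>a b. a < Md \<Longrightarrow> b < Me \<Longrightarrow> m a b = (if j = 1 then msg1 a b else msg2 a b)"
  shows "(\<Sum>a<Md. \<Sum>b<Me. \<integral> w. ln (guess j M (m a b) (out a b w) w) \<partial>chan_meas)
    \<ge> real Md * real Me * ((1 - err_prob c j) * ln (real M) - ln 2)"
proof -
  define D where "D m1 m2 = {w \<in> space chan_meas. decoded c j m1 m2 w \<noteq> (if j = 1 then m1 else m2)}" for m1 m2
  have D: "D m1 m2 \<in> sets chan_meas" if "m1 < nmsg c 1" "m2 < nmsg c 2" for m1 m2
  proof -
    have "decoded c j m1 m2 -` (- {if j = 1 then m1 else m2}) \<inter> space chan_meas \<in> sets chan_meas"
      by (rule measurable_sets[OF decoded_measurable[OF valid j that]]) simp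
    also have "decoded c j m1 m2 -` (- {if j = 1 then m1 else m2}) \<inter> space chan_meas = D m1 m2"
      by (auto simp: D_def)
    finally show ?thesis .
  qed
  have "nmsg c 1 \<ge> 1" "nmsg c 2 \<ge> 1" using valid by (auto simp: valid_code_def)
  then have pos: "real (nmsg c 1) * real (nmsg c 2) > 0" by simp
  have MM: "real (nmsg c 1) * real (nmsg c 2) = real Md * real Me"
    using de by (auto simp: Md_def Me_def)
  have err: "(\<Sum>m1<nmsg c 1. \<Sum>m2<nmsg c 2. measure chan_meas (D m1 m2)) = real Md * real Me * err_prob c j"
    using pos unfolding MM[symmetric] err_prob_def D_def by simp
  have one: "(\<integral> w. ln (guess j M (m a b) (out a b w) w) \<partial>chan_meas)
    \<ge> (1 - measure chan_meas (D (msg1 a b) (msg2 a b))) * ln (real M) - ln 2" if ab: "a < Md" "b < Me" for a b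
  proof -
    let ?D = "D (msg1 a b) (msg2 a b)"
    have Dm: "?D \<in> sets chan_meas" using D msg_less[OF ab] by blast
    have int: "integrable chan_meas (\<lambda>w. (1 - indicator ?D w) * ln (real M) - ln 2)"
      using Dm by (intro Bochner_Integration.integrable_diff integrable_mult_left) (auto simp: chan.emeasure_eq_measure)
    have "(\<integral> w. (1 - indicator ?D w) * ln (real M) - ln 2 \<partial>chan_meas)
      \<le> (\<integral> w. ln (guess j M (m a b) (out a b w) w) \<partial>chan_meas)"
    proof (rule integral_mono[OF int integrable_ln_guess[OF ab j]])
      fix w assume w: "w \<in> space chan_meas"
      have e: "dcd j (out a b w) w = m a b \<longleftrightarrow> w \<notin> ?D"
        using w j m[OF ab] by (auto simp: dcd_out D_def)
      show "(1 - indicator ?D w) * ln (real M) - ln 2 \<le> ln (guess j M (m a b) (out a b w) w)"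
      proof (cases "w \<in> ?D")
        case True
        then have g: "guess j M (m a b) (out a b w) w = 1 / 2" using e by (simp add: guess_def)
        show ?thesis using True unfolding g by (simp add: ln_div)
      next
        case False
        then have g: "guess j M (m a b) (out a b w) w = 1 / 2 + real M / 2" using e by (simp add: guess_def)
        have "ln (real M / 2) \<le> ln (1 / 2 + real M / 2)" using M by (subst ln_le_cancel_iff) auto
        then show ?thesis using False M unfolding g by (simp add: ln_div)
      qed
    qed
    moreover have "(\<integral> w. (1 - indicator ?D w) * ln (real M) - ln 2 \<partial>chan_meas) = (1 - measure chan_meas ?D) * ln (real M) - ln 2"
    proof -
      have "integrable chan_meas (indicator ?D :: _ \<Rightarrow> real)"
        using Dm by (simp add: chan.emeasure_eq_measure)
      then show ?thesis using Dm by (simp add: chan.prob_space)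
    qed
    ultimately show ?thesis by simp
  qed
  have "real Md * real Me * ((1 - err_prob c j) * ln (real M) - ln 2) =
    (real Md * real Me - real Md * real Me * err_prob c j) * ln (real M) - real Md * real Me * ln 2"
    by (simp add: algebra_simps)
  also have "\<dots> = (real Md * real Me - (\<Sum>a<Md. \<Sum>b<Me. measure chan_meas (D (msg1 a b) (msg2 a b)))) * ln (real M) - real Md * real Me * ln 2"
    unfolding err[symmetric] sum_msg[of "\<lambda>m1 m2. measure chan_meas (D m1 m2)"] ..
  also have "\<dots> = (\<Sum>a<Md. \<Sum>b<Me. (1 - measure chan_meas (D (msg1 a b) (msg2 a b))) * ln (real M) - ln 2)"
    by (simp add: sum_subtractf sum_distrib_right left_diff_distrib)
  also have "\<dots> \<le> (\<Sum>a<Md. \<Sum>b<Me. \<integral> w. ln (guess j M (m a b) (out a b w) w) \<partial>chan_meas)"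
    by (intro sum_mono one) auto
  finally show ?thesis .
qed

text \<open>Only the output energy enters: at most \<open>9 * P\<close> on average, measured against
  variance \<open>P\<close>, it costs 9 per channel use beside \<open>ln (pi * P)\<close>.\<close>

lemma sum_integral_ln_qd:
  "(\<Sum>a<Md. \<Sum>b<Me. \<integral> w. ln (qd (out a b w)) \<partial>chan_meas) \<ge> - (real Md * real Me * (real n * (9 + ln (pi * P))))"
proof -
  define S where "S a b t = (\<integral> w. (cmod (out a b w (t, p)))\<^sup>2 \<partial>chan_meas)" for a b t
  have S0: "S a b t \<ge> 0" for a b t unfolding S_def by simp
  have nn: "(\<integral>\<^sup>+ w. ennreal ((cmod (out a b w (t, p)))\<^sup>2) \<partial>chan_meas) = ennreal (S a b t)" if "a < Md" "b < Me" "t < n" for a b t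
    unfolding S_def using integrable_out_sq[OF that] by (intro nn_integral_eq_integral) auto
  have "ennreal (\<Sum>a<Md. \<Sum>b<Me. \<Sum>t<n. S a b t) = (\<Sum>a<Md. \<Sum>b<Me. \<Sum>t<n. ennreal (S a b t))"
  proof -
    have "(\<Sum>a<Md. \<Sum>b<Me. \<Sum>t<n. ennreal (S a b t)) = (\<Sum>a<Md. \<Sum>b<Me. ennreal (\<Sum>t<n. S a b t))"
      by (intro sum.cong refl sum_ennreal S0)
    also have "\<dots> = (\<Sum>a<Md. ennreal (\<Sum>b<Me. \<Sum>t<n. S a b t))"
      by (intro sum.cong refl sum_ennreal sum_nonneg S0)
    also have "\<dots> = ennreal (\<Sum>a<Md. \<Sum>b<Me. \<Sum>t<n. S a b t)"
      by (intro sum_ennreal sum_nonneg S0)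
    finally show ?thesis by (rule sym)
  qed
  also have "\<dots> = (\<Sum>a<Md. \<Sum>b<Me. \<Sum>t<n. \<integral>\<^sup>+ w. ennreal ((cmod (out a b w (t, p)))\<^sup>2) \<partial>chan_meas)"
    by (intro sum.cong refl) (simp add: nn)
  also note nn_integral_out_sq
  finally have S: "(\<Sum>a<Md. \<Sum>b<Me. \<Sum>t<n. S a b t) \<le> real Md * real Me * (real n * (9 * P))"
    by (subst (asm) ennreal_le_iff) (use P1 in auto)
  have "(\<integral> w. ln (qd (out a b w)) \<partial>chan_meas) = - (\<Sum>t<n. S a b t) / P - real n * ln (pi * P)" if ab: "a < Md" "b < Me" for a b
  proof -
    have int: "integrable chan_meas (\<lambda>w. - (cmod (out a b w (t, p)))\<^sup>2 / P)" if "t < n" for t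
      using integrable_out_sq[OF ab that] by (auto intro!: integrable_divide integrable_minus)
    have "(\<integral> w. ln (qd (out a b w)) \<partial>chan_meas) = (\<Sum>t<n. \<integral> w. - (cmod (out a b w (t, p)))\<^sup>2 / P - ln (pi * P) \<partial>chan_meas)"
      unfolding ln_qd using int
      by (intro Bochner_Integration.integral_sum Bochner_Integration.integrable_diff) auto
    also have "\<dots> = (\<Sum>t<n. - S a b t / P - ln (pi * P))"
    proof (intro sum.cong refl)
      fix t assume "t \<in> {..<n}"
      then have "(\<integral> w. - (cmod (out a b w (t, p)))\<^sup>2 / P - ln (pi * P) \<partial>chan_meas) =
        (\<integral> w. - (cmod (out a b w (t, p)))\<^sup>2 / P \<partial>chan_meas) - (\<integral> w. ln (pi * P) \<partial>chan_meas)"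
        using int by (intro Bochner_Integration.integral_diff) auto
      then show "(\<integral> w. - (cmod (out a b w (t, p)))\<^sup>2 / P - ln (pi * P) \<partial>chan_meas) = - S a b t / P - ln (pi * P)"
        by (simp add: S_def chan.prob_space)
    qed
    also have "\<dots> = - (\<Sum>t<n. S a b t) / P - real n * ln (pi * P)"
      by (simp add: sum_subtractf sum_negf sum_divide_distrib)
    finally show ?thesis .
  qed
  then have "(\<Sum>a<Md. \<Sum>b<Me. \<integral> w. ln (qd (out a b w)) \<partial>chan_meas) = (\<Sum>a<Md. \<Sum>b<Me. - (\<Sum>t<n. S a b t) / P - real n * ln (pi * P))"
    by (intro sum.cong refl) auto
  also have "\<dots> = - (\<Sum>a<Md. \<Sum>b<Me. \<Sum>t<n. S a b t) / P - real Md * real Me * (real n * ln (pi * P))"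
    by (simp add: sum_subtractf sum_negf sum_divide_distrib)
  also have "\<dots> \<ge> - (real Md * real Me * (real n * (9 * P))) / P - real Md * real Me * (real n * ln (pi * P))"
    using S P1 by (intro diff_right_mono divide_right_mono) auto
  also have "- (real Md * real Me * (real n * (9 * P))) / P - real Md * real Me * (real n * ln (pi * P))
    = - (real Md * real Me * (real n * (9 + ln (pi * P))))"
    using P1 by (simp add: algebra_simps)
  finally show ?thesis .
qed

lemma converse_bound:
  "2 * (1 - err_prob c d) * ln (real Md) + (1 - err_prob c e) * ln (real Me)
    \<le> 3 * ln 2 + 2 * real n * (9 + ln (pi * P))"
proof -
  define K where "K = real Md * real Me"
  have K: "K > 0" unfolding K_def using Md_pos Me_pos by simp
  have d: "(\<Sum>a<Md. \<Sum>b<Me. \<integral> w. ln (guess d Md a (out a b w) w) \<partial>chan_meas) \<ge> K * ((1 - err_prob c d) * ln (real Md) - ln 2)"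
    unfolding K_def by (rule sum_integral_ln_guess[OF de(1) Md_pos]) (unfold msg1_def msg2_def, simp)
  have e: "(\<Sum>a<Md. \<Sum>b<Me. \<integral> w. ln (guess e Me b (out a b w) w) \<partial>chan_meas) \<ge> K * ((1 - err_prob c e) * ln (real Me) - ln 2)"
    unfolding K_def by (rule sum_integral_ln_guess[OF de(2) Me_pos]) (use de in \<open>auto simp: msg1_def msg2_def\<close>)
  define A where "A = (1 - err_prob c d) * ln (real Md)"
  define B where "B = (1 - err_prob c e) * ln (real Me)"
  define Q where "Q = real n * (9 + ln (pi * P))"
  have "2 * (K * (A - ln 2)) + K * (B - ln 2) - 2 * (K * Q) \<le> 0"
    using d e sum_integral_ln_qd core_inequality
    unfolding sum.distrib sum_distrib_left[symmetric] K_def[symmetric] A_def[symmetric] B_def[symmetric] Q_def[symmetric]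
    by linarith
  also have "2 * (K * (A - ln 2)) + K * (B - ln 2) - 2 * (K * Q) = K * (2 * A + B - 3 * ln 2 - 2 * Q)"
    by (simp add: algebra_simps)
  finally have "2 * A + B - 3 * ln 2 - 2 * Q \<le> 0"
    using K by (simp add: mult_le_0_iff)
  then have "2 * A + B \<le> 3 * ln 2 + 2 * Q" by linarith
  then show ?thesis unfolding A_def B_def Q_def by (simp only: mult.assoc)
qed

end

text \<open>Dividing by the blocklength removes the constant of Fano's inequality. Rates are a
  function of the user so that one statement serves both orders of the receivers.\<close>

lemma achievable_weighted:
  assumes ach: "achievable P (r 1) (r 2)"
    and P: "P \<ge> 1" and de: "d \<in> {1,2::nat}" "e \<in> {1,2}" "d \<noteq> e"
  shows "2 * r d + r e \<le> 2 * (9 + ln (pi * P)) / ln 2"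
proof -
  from ach obtain C where *: "\<forall>n\<ge>1. valid_code P (C n) \<and> blen (C n) = n \<and>
        real (nmsg (C n) 1) \<ge> 2 powr (real n * r 1) \<and> real (nmsg (C n) 2) \<ge> 2 powr (real n * r 2)"
      "(\<lambda>n. err_prob (C n) 1) \<longlonglongrightarrow> 0" "(\<lambda>n. err_prob (C n) 2) \<longlonglongrightarrow> 0"
    unfolding achievable_def by (elim exE conjE)
  have r: "r i \<ge> 0" if "i \<in> {1,2}" for i
    using ach that unfolding achievable_def by (elim insertE) simp_all
  have C: "valid_code P (C n)" "blen (C n) = n" if "n \<ge> 1" for n
    using *(1) that by simp_all
  have C3: "real (nmsg (C n) i) \<ge> 2 powr (real n * r i)" if "n \<ge> 1" "i \<in> {1,2}" for n i
    using *(1) that by (elim insertE) simp_all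
  have lim: "(\<lambda>n. err_prob (C n) i) \<longlonglongrightarrow> 0" if "i \<in> {1,2}" for i
    using *(2,3) that by (elim insertE) simp_all
  \<comment> \<open>Makes \<open>1 - err_prob\<close> nonnegative, so that the lower bounds on
    \<open>ln nmsg\<close> can be multiplied by it.\<close>
  have ev: "\<forall>\<^sub>F n in sequentially. err_prob (C n) i \<le> 1" if "i \<in> {1,2}" for i
    using order_tendstoD(2)[OF lim[OF that], of 1] by (auto elim: eventually_mono)
  have lnM: "ln (real (nmsg (C n) i)) \<ge> real n * (r i * ln 2)" if "n \<ge> 1" "i \<in> {1,2}" for n i
  proof -
    have "ln (2 powr (real n * r i)) \<le> ln (real (nmsg (C n) i))"
      using C3[OF that] less_le_trans[OF _ C3[OF that], of 0] by (subst ln_le_cancel_iff) auto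
    then show ?thesis by (simp add: ln_powr mult.assoc)
  qed
  have "\<forall>\<^sub>F n in sequentially. 2 * (1 - err_prob (C n) d) * (r d * ln 2) + (1 - err_prob (C n) e) * (r e * ln 2)
     \<le> 3 * ln 2 / real n + 2 * (9 + ln (pi * P))"
    using ev[OF de(1)] ev[OF de(2)] eventually_ge_at_top[of 1]
  proof eventually_elim
    case (elim n)
    interpret two_receivers "C n" P d e
      using C(1)[OF elim(3)] P de by unfold_locales auto
    have b: "2 * (1 - err_prob (C n) d) * ln (real (nmsg (C n) d)) + (1 - err_prob (C n) e) * ln (real (nmsg (C n) e))
      \<le> 3 * ln 2 + 2 * real n * (9 + ln (pi * P))"
      using converse_bound C(2)[OF elim(3)] by (simp add: Md_def Me_def n_def)
    have "2 * (1 - err_prob (C n) d) * (real n * (r d * ln 2)) + (1 - err_prob (C n) e) * (real n * (r e * ln 2))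
      \<le> 2 * (1 - err_prob (C n) d) * ln (real (nmsg (C n) d)) + (1 - err_prob (C n) e) * ln (real (nmsg (C n) e))"
      using elim lnM[OF elim(3) de(1)] lnM[OF elim(3) de(2)] by (intro add_mono mult_left_mono) auto
    also note b
    also have "2 * (1 - err_prob (C n) d) * (real n * (r d * ln 2)) + (1 - err_prob (C n) e) * (real n * (r e * ln 2))
      = real n * (2 * (1 - err_prob (C n) d) * (r d * ln 2) + (1 - err_prob (C n) e) * (r e * ln 2))"
      by (simp only: distrib_left mult.left_commute)
    also have "3 * ln 2 + 2 * real n * (9 + ln (pi * P)) = real n * (3 * ln 2 / real n + 2 * (9 + ln (pi * P)))"
      using elim(3) by (simp only: distrib_left) simp
    finally have "real n * (2 * (1 - err_prob (C n) d) * (r d * ln 2) + (1 - err_prob (C n) e) * (r e * ln 2))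
       \<le> real n * (3 * ln 2 / real n + 2 * (9 + ln (pi * P)))" .
    then show ?case using elim(3) by (subst (asm) mult_le_cancel_left_pos) auto
  qed
  moreover have "(\<lambda>n. 2 * (1 - err_prob (C n) d) * (r d * ln 2) + (1 - err_prob (C n) e) * (r e * ln 2))
    \<longlonglongrightarrow> 2 * (1 - 0) * (r d * ln 2) + (1 - 0) * (r e * ln 2)"
    by (intro tendsto_intros lim de)
  moreover have "(\<lambda>n. 3 * ln 2 / real n + 2 * (9 + ln (pi * P))) \<longlonglongrightarrow> 0 + 2 * (9 + ln (pi * P))"
    by (intro tendsto_intros lim_const_over_n)
  ultimately have "2 * (1 - 0) * (r d * ln 2) + (1 - 0) * (r e * ln 2) \<le> 0 + 2 * (9 + ln (pi * P))"
    by (intro tendsto_le[OF sequentially_bot])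
  moreover have "2 * (1 - 0) * (r d * ln 2) + (1 - 0) * (r e * ln 2) = (2 * r d + r e) * ln 2"
    by (simp add: distrib_right)
  ultimately have "(2 * r d + r e) * ln 2 \<le> 2 * (9 + ln (pi * P))" by linarith
  then show ?thesis by (subst pos_le_divide_eq) auto
qed

text \<open>The two weighted bounds add up to \<open>3 * (r1 + r2)\<close> on the left and to
  \<open>4 * log 2 P\<close> plus a constant on the right; this is where 4 / 3 comes from.\<close>

lemma achievable_sum_le:
  assumes "achievable P r1 r2" "P \<ge> 1"
  shows "r1 + r2 \<le> 4 / 3 * log 2 P + 4 / 3 * (9 + ln pi) / ln 2"
proof -
  define r where "r i = (if i = (1::nat) then r1 else r2)" for i
  have ach: "achievable P (r 1) (r 2)" using assms(1) by (simp add: r_def)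
  have "2 * r1 + r2 \<le> 2 * (9 + ln (pi * P)) / ln 2" "2 * r2 + r1 \<le> 2 * (9 + ln (pi * P)) / ln 2"
    using achievable_weighted[OF ach assms(2), of 1 2] achievable_weighted[OF ach assms(2), of 2 1]
    by (simp_all add: r_def)
  then have "(2 * r1 + r2) + (2 * r2 + r1) \<le> 2 * (9 + ln (pi * P)) / ln 2 + 2 * (9 + ln (pi * P)) / ln 2"
    by (rule add_mono)
  also have "(2 * r1 + r2) + (2 * r2 + r1) = 3 * (r1 + r2)" by simp
  also have "2 * (9 + ln (pi * P)) / ln 2 + 2 * (9 + ln (pi * P)) / ln 2 = 2 * (2 * (9 + ln (pi * P)) / ln 2)"
    by (rule mult_2[symmetric])
  also have "\<dots> = 2 * (2 * (9 + (ln pi + ln P)) / ln 2)"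
    using assms(2) by (simp add: ln_mult_pos)
  also have "\<dots> = 3 * (4 / 3 * log 2 P + 4 / 3 * (9 + ln pi) / ln 2)"
    unfolding log_def by (simp add: add_divide_distrib)
  finally show ?thesis by (subst (asm) mult_le_cancel_left_pos) simp_all
qed

section \<open>The relaying scheme\<close>

definition cramer1 :: "complex \<Rightarrow> complex \<Rightarrow> complex \<Rightarrow> complex \<Rightarrow> complex \<Rightarrow> complex \<Rightarrow> complex" where
  "cramer1 A B C D u v = (D * u - B * v) / (A * D - B * C)"

definition cramer2 :: "complex \<Rightarrow> complex \<Rightarrow> complex \<Rightarrow> complex \<Rightarrow> complex \<Rightarrow> complex \<Rightarrow> complex" where
  "cramer2 A B C D u v = (A * v - C * u) / (A * D - B * C)"

lemma cramer_add:
  "cramer1 A B C D (u + u') (v + v') = cramer1 A B C D u v + cramer1 A B C D u' v'"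
  "cramer2 A B C D (u + u') (v + v') = cramer2 A B C D u v + cramer2 A B C D u' v'"
  by (simp_all add: cramer1_def cramer2_def add_divide_distrib[symmetric] algebra_simps)

lemma cramer_solve:
  assumes "A * D - B * C \<noteq> 0"
  shows "cramer1 A B C D (A * x + B * y) (C * x + D * y) = x"
    "cramer2 A B C D (A * x + B * y) (C * x + D * y) = y"
proof -
  have "D * (A * x + B * y) - B * (C * x + D * y) = x * (A * D - B * C)"
    "A * (C * x + D * y) - C * (A * x + B * y) = y * (A * D - B * C)"
    by (simp_all add: algebra_simps)
  then show "cramer1 A B C D (A * x + B * y) (C * x + D * y) = x" "cramer2 A B C D (A * x + B * y) (C * x + D * y) = y"
    using assms unfolding cramer1_def cramer2_def by simp_all
qed

text \<open>A block starting at time \<open>T\<close> carries two symbols per source. They are sent at times \<open>T\<close> and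
  \<open>T + 1\<close>; at time \<open>T + 2\<close> relay 1 forwards its first and relay 2 its second observation, so
  that the coefficients of the symbols of source \<open>i\<close> at destination \<open>j\<close> are \<open>gh1\<close> and \<open>gh2\<close>.\<close>

definition gh1 :: "nat \<Rightarrow> nat \<Rightarrow> nat \<Rightarrow> (nat \<Rightarrow> nat \<Rightarrow> complex) \<Rightarrow> complex" where
  "gh1 j i T x = Gc j 1 (T + 2) x * Hc 1 i T x"

definition gh2 :: "nat \<Rightarrow> nat \<Rightarrow> nat \<Rightarrow> (nat \<Rightarrow> nat \<Rightarrow> complex) \<Rightarrow> complex" where
  "gh2 j i T x = Gc j 2 (T + 2) x * Hc 2 i (T + 1) x"

text \<open>The part of source \<open>i\<close> in what the unintended destination \<open>3 - i\<close> has received: interference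
  there, and a second equation for destination \<open>i\<close>. Source \<open>i\<close> sends it at time \<open>T + 5\<close>, and the
  relays forward it to both destinations at times \<open>T + 6\<close> and \<open>T + 7\<close>.\<close>

definition overheard :: "nat \<Rightarrow> nat \<Rightarrow> (nat \<Rightarrow> nat \<Rightarrow> complex) \<Rightarrow> complex \<times> complex \<Rightarrow> complex" where
  "overheard i T x s = gh1 (3 - i) i T x * fst s + gh2 (3 - i) i T x * snd s"

text \<open>Estimates the observation of relay 1 at time \<open>T + 5\<close> from the two outputs
  in which it is forwarded; the factor 3 undoes the power scaling of the relays.\<close>

definition relay_est1 :: "nat \<Rightarrow> nat \<Rightarrow> (nat \<Rightarrow> nat \<Rightarrow> complex) \<Rightarrow> (nat \<Rightarrow> complex) \<Rightarrow> complex" where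
  "relay_est1 d T x y = cramer1 (Gc d 1 (T + 6) x) (Gc d 2 (T + 6) x) (Gc d 1 (T + 7) x) (Gc d 2 (T + 7) x) (3 * y (T + 6)) (3 * y (T + 7))"

definition relay_est2 :: "nat \<Rightarrow> nat \<Rightarrow> (nat \<Rightarrow> nat \<Rightarrow> complex) \<Rightarrow> (nat \<Rightarrow> complex) \<Rightarrow> complex" where
  "relay_est2 d T x y = cramer2 (Gc d 1 (T + 6) x) (Gc d 2 (T + 6) x) (Gc d 1 (T + 7) x) (Gc d 2 (T + 7) x) (3 * y (T + 6)) (3 * y (T + 7))"

text \<open>Inverts the first hop of time \<open>T + 5\<close>. A destination wants both
  combinations: that of source \<open>3 - d\<close> is its interference at \<open>T + 2\<close>,
  that of source \<open>d\<close> its second equation.\<close>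

definition overheard_est :: "nat \<Rightarrow> nat \<Rightarrow> nat \<Rightarrow> (nat \<Rightarrow> nat \<Rightarrow> complex) \<Rightarrow> (nat \<Rightarrow> complex) \<Rightarrow> complex" where
  "overheard_est i d T x y = (if i = 1 then cramer1 else cramer2) (Hc 1 1 (T + 5) x) (Hc 1 2 (T + 5) x) (Hc 2 1 (T + 5) x) (Hc 2 2 (T + 5) x)
     (relay_est1 d T x y) (relay_est2 d T x y)"

definition est1 :: "nat \<Rightarrow> nat \<Rightarrow> (nat \<Rightarrow> nat \<Rightarrow> complex) \<Rightarrow> (nat \<Rightarrow> complex) \<Rightarrow> complex" where
  "est1 d T x y = cramer1 (gh1 d d T x) (gh2 d d T x) (gh1 (3 - d) d T x) (gh2 (3 - d) d T x)
     (3 * y (T + 2) - overheard_est (3 - d) d T x y) (overheard_est d d T x y)"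

definition est2 :: "nat \<Rightarrow> nat \<Rightarrow> (nat \<Rightarrow> nat \<Rightarrow> complex) \<Rightarrow> (nat \<Rightarrow> complex) \<Rightarrow> complex" where
  "est2 d T x y = cramer2 (gh1 d d T x) (gh2 d d T x) (gh1 (3 - d) d T x) (gh2 (3 - d) d T x)
     (3 * y (T + 2) - overheard_est (3 - d) d T x y) (overheard_est d d T x y)"

definition nondeg :: "nat \<Rightarrow> nat \<Rightarrow> (nat \<Rightarrow> nat \<Rightarrow> complex) \<Rightarrow> bool" where
  "nondeg d T x \<longleftrightarrow>
     Gc d 1 (T + 6) x * Gc d 2 (T + 7) x - Gc d 2 (T + 6) x * Gc d 1 (T + 7) x \<noteq> 0 \<and>
     Hc 1 1 (T + 5) x * Hc 2 2 (T + 5) x - Hc 1 2 (T + 5) x * Hc 2 1 (T + 5) x \<noteq> 0 \<and>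
     gh1 d d T x * gh2 (3 - d) d T x - gh2 d d T x * gh1 (3 - d) d T x \<noteq> 0"

lemma relay_est_add:
  "relay_est1 d T x (\<lambda>t. y t + z t) = relay_est1 d T x y + relay_est1 d T x z"
  "relay_est2 d T x (\<lambda>t. y t + z t) = relay_est2 d T x y + relay_est2 d T x z"
  unfolding relay_est1_def relay_est2_def distrib_left cramer_add by simp_all

lemma overheard_est_add: "overheard_est i d T x (\<lambda>t. y t + z t) = overheard_est i d T x y + overheard_est i d T x z"
  by (simp add: overheard_est_def relay_est_add cramer_add)

text \<open>Linearity in the outputs is what makes zero forcing tractable: the estimation error is
  the estimator applied to the noise, whatever the symbols are.\<close>

lemma est_add:
  "est1 d T x (\<lambda>t. y t + z t) = est1 d T x y + est1 d T x z"
  "est2 d T x (\<lambda>t. y t + z t) = est2 d T x y + est2 d T x z"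
proof -
  have "3 * (y (T + 2) + z (T + 2)) - overheard_est (3 - d) d T x (\<lambda>t. y t + z t)
    = (3 * y (T + 2) - overheard_est (3 - d) d T x y) + (3 * z (T + 2) - overheard_est (3 - d) d T x z)"
    by (simp add: overheard_est_add algebra_simps)
  then show "est1 d T x (\<lambda>t. y t + z t) = est1 d T x y + est1 d T x z"
    "est2 d T x (\<lambda>t. y t + z t) = est2 d T x y + est2 d T x z"
    unfolding est1_def est2_def overheard_est_add by (simp_all only: cramer_add)
qed

definition block_signal :: "nat \<Rightarrow> nat \<Rightarrow> (nat \<Rightarrow> nat \<Rightarrow> complex) \<Rightarrow> complex \<times> complex \<Rightarrow> complex \<times> complex \<Rightarrow> nat \<Rightarrow> complex" where
  "block_signal d T x a b t = (if t = T + 2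
     then (gh1 d 1 T x * fst a + gh2 d 1 T x * snd a + gh1 d 2 T x * fst b + gh2 d 2 T x * snd b) / 3
     else (Gc d 1 t x * (Hc 1 1 (T + 5) x * overheard 1 T x a + Hc 1 2 (T + 5) x * overheard 2 T x b)
         + Gc d 2 t x * (Hc 2 1 (T + 5) x * overheard 1 T x a + Hc 2 2 (T + 5) x * overheard 2 T x b)) / 3)"

text \<open>Relay noise reaches the destination through the second hop with the scaling 1 / 3. The
  expression contains no symbols, so its law depends neither on \<open>P\<close> nor on the
  messages.\<close>

definition block_noise :: "nat \<Rightarrow> nat \<Rightarrow> (nat \<Rightarrow> nat \<Rightarrow> complex) \<Rightarrow> nat \<Rightarrow> complex" where
  "block_noise d T w t = (if t = T + 2
     then (Gc d 1 t w * ZR 1 T w + Gc d 2 t w * ZR 2 (T + 1) w) / 3 + ZD d t w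
     else (Gc d 1 t w * ZR 1 (T + 5) w + Gc d 2 t w * ZR 2 (T + 5) w) / 3 + ZD d t w)"

lemma est_signal:
  assumes nd: "nondeg d T x" and d: "d \<in> {1, 2}"
    and s_def: "s = (if d = 1 then a else b)"
  shows "est1 d T x (block_signal d T x a b) = fst s" "est2 d T x (block_signal d T x a b) = snd s"
proof -
  let ?y = "block_signal d T x a b"
  have R: "relay_est1 d T x ?y = Hc 1 1 (T + 5) x * overheard 1 T x a + Hc 1 2 (T + 5) x * overheard 2 T x b"
    "relay_est2 d T x ?y = Hc 2 1 (T + 5) x * overheard 1 T x a + Hc 2 2 (T + 5) x * overheard 2 T x b"
  proof -
    have y: "3 * ?y t = Gc d 1 t x * (Hc 1 1 (T + 5) x * overheard 1 T x a + Hc 1 2 (T + 5) x * overheard 2 T x b)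
         + Gc d 2 t x * (Hc 2 1 (T + 5) x * overheard 1 T x a + Hc 2 2 (T + 5) x * overheard 2 T x b)" if "t \<noteq> T + 2" for t
      using that by (simp add: block_signal_def)
    have "T + 6 \<noteq> T + 2" "T + 7 \<noteq> T + 2" by simp_all
    note y' = y[OF this(1)] y[OF this(2)]
    have n: "Gc d 1 (T + 6) x * Gc d 2 (T + 7) x - Gc d 2 (T + 6) x * Gc d 1 (T + 7) x \<noteq> 0"
      using nd unfolding nondeg_def by blast
    show "relay_est1 d T x ?y = Hc 1 1 (T + 5) x * overheard 1 T x a + Hc 1 2 (T + 5) x * overheard 2 T x b"
      unfolding relay_est1_def y' by (rule cramer_solve(1)[OF n])
    show "relay_est2 d T x ?y = Hc 2 1 (T + 5) x * overheard 1 T x a + Hc 2 2 (T + 5) x * overheard 2 T x b"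
      unfolding relay_est2_def y' by (rule cramer_solve(2)[OF n])
  qed
  have v: "overheard_est 1 d T x ?y = overheard 1 T x a" "overheard_est 2 d T x ?y = overheard 2 T x b"
    using nd unfolding overheard_est_def R nondeg_def by (simp_all add: cramer_solve)
  \<comment> \<open>Subtracting the combination of the other source leaves an equation in the two
    desired symbols; \<open>w\<close> below supplies the second one.\<close>
  have u: "3 * ?y (T + 2) - overheard_est (3 - d) d T x ?y = gh1 d d T x * fst s + gh2 d d T x * snd s"
  proof -
    have c: "3 * (z / 3) = z" for z :: complex by simp
    have "3 * ?y (T + 2) = gh1 d 1 T x * fst a + gh2 d 1 T x * snd a + gh1 d 2 T x * fst b + gh2 d 2 T x * snd b"
      by (simp only: block_signal_def c if_True refl)
    then show ?thesis using d v by (auto simp: s_def overheard_def)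
  qed
  have w: "overheard_est d d T x ?y = gh1 (3 - d) d T x * fst s + gh2 (3 - d) d T x * snd s"
    using d v by (auto simp: s_def overheard_def)
  show "est1 d T x ?y = fst s" "est2 d T x ?y = snd s"
    unfolding est1_def est2_def u w using nd by (simp_all add: cramer_solve nondeg_def)
qed

lemma est_signal_noise:
  assumes "nondeg d T x" "d \<in> {1, 2}" "\<And>t. t \<in> {T + 2, T + 6, T + 7} \<Longrightarrow> y t = block_signal d T x a b t + z t"
  shows "est1 d T x y = fst (if d = 1 then a else b) + est1 d T x z"
    "est2 d T x y = snd (if d = 1 then a else b) + est2 d T x z"
proof -
  have "est1 d T x y = est1 d T x (\<lambda>t. block_signal d T x a b t + z t)" "est2 d T x y = est2 d T x (\<lambda>t. block_signal d T x a b t + z t)"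
    using assms(3) by (simp_all add: est1_def est2_def overheard_est_def relay_est1_def relay_est2_def)
  then show "est1 d T x y = fst (if d = 1 then a else b) + est1 d T x z"
    "est2 d T x y = snd (if d = 1 then a else b) + est2 d T x z"
    using est_signal[OF assms(1,2) refl, of a b] by (simp_all only: est_add)
qed

section \<open>The interleaved code and its decoder\<close>

text \<open>Block \<open>\<kappa>\<close> occupies the sources at times \<open>3 * \<kappa>\<close>,
  \<open>3 * \<kappa> + 1\<close> and \<open>3 * \<kappa> + 5\<close>. The guard
  \<open>t < 3\<close> concerns time 2, where truncated subtraction would select block 0 and ask for
  coefficients of the current use.\<close>

definition scheme_enc :: "(nat \<Rightarrow> nat \<Rightarrow> complex \<times> complex) \<Rightarrow> nat \<Rightarrow> nat \<Rightarrow> nat \<Rightarrow> (nat \<Rightarrow> nat \<Rightarrow> complex) \<Rightarrow> complex" where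
  "scheme_enc \<alpha> i t m x = (if t mod 3 = 0 then fst (\<alpha> m (t div 3)) else if t mod 3 = 1 then snd (\<alpha> m (t div 3))
     else if t < 3 then 0 else overheard i (3 * (t div 3 - 1)) x (\<alpha> m (t div 3 - 1)))"

text \<open>Residue 2 forwards the fresh symbols of the current block; residues 0 and 1 repeat the
  latest observation made at residue 2, which does not exist yet at times 0 and 1.\<close>

definition scheme_rel :: "nat \<Rightarrow> nat \<Rightarrow> (nat \<Rightarrow> complex) \<Rightarrow> complex" where
  "scheme_rel i t y = (if t mod 3 = 2 then y (if i = 1 then t - 2 else t - 1) / 3
     else if t < 3 then 0 else y (3 * (t div 3) - 1) / 3)"

definition close :: "real \<Rightarrow> nat \<Rightarrow> nat \<Rightarrow> complex \<times> complex \<Rightarrow> (nat \<Rightarrow> nat \<Rightarrow> complex) \<Rightarrow> (nat \<Rightarrow> complex) \<Rightarrow> bool" where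
  "close \<Delta> d \<kappa> s x y \<longleftrightarrow> cmod (est1 d (3 * \<kappa>) x y - fst s) < \<Delta> / 2 \<and> cmod (est2 d (3 * \<kappa>) x y - snd s) < \<Delta> / 2"

text \<open>\<open>D\<close> is the minimum Hamming distance of the outer code \<open>\<alpha>\<close>; the \<open>(n - 5) div 3\<close> blocks that are
  completed within \<open>n\<close> channel uses are decoded.\<close>

definition scheme :: "(nat \<Rightarrow> nat \<Rightarrow> complex \<times> complex) \<Rightarrow> nat \<Rightarrow> nat \<Rightarrow> nat \<Rightarrow> real \<Rightarrow> code" where
  "scheme \<alpha> M n D \<Delta> = \<lparr> blen = n, nmsg = (\<lambda>_. M), enc = scheme_enc \<alpha>, rel = scheme_rel,
     dec = (\<lambda>d p. LEAST m. m < M \<and> 2 * card {\<kappa>. \<kappa> < (n - 5) div 3 \<and> \<not> close \<Delta> d \<kappa> (\<alpha> m \<kappa>) (fst p) (snd p)} < D) \<rparr>"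

lemma scheme_sel:
  "blen (scheme \<alpha> M n D \<Delta>) = n" "nmsg (scheme \<alpha> M n D \<Delta>) i = M"
  "enc (scheme \<alpha> M n D \<Delta>) = scheme_enc \<alpha>" "rel (scheme \<alpha> M n D \<Delta>) = scheme_rel"
  "dec (scheme \<alpha> M n D \<Delta>) d p =
    (LEAST m. m < M \<and> 2 * card {\<kappa>. \<kappa> < (n - 5) div 3 \<and> \<not> close \<Delta> d \<kappa> (\<alpha> m \<kappa>) (fst p) (snd p)} < D)"
  by (simp_all add: scheme_def)

lemma Hc_csi_past: "s < t \<Longrightarrow> i \<in> {1,2} \<Longrightarrow> j \<in> {1,2} \<Longrightarrow> Hc i j s (csi_past w t) = Hc i j s w"
  by (auto simp: Hc_def csi_past_def csi_def)

lemma Gc_csi_past: "s < t \<Longrightarrow> i \<in> {1,2} \<Longrightarrow> j \<in> {1,2} \<Longrightarrow> Gc i j s (csi_past w t) = Gc i j s w"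
  by (auto simp: Gc_def csi_past_def csi_def)

lemma gh_csi_past:
  assumes "T + 2 < t" "i \<in> {1,2}" "j \<in> {1,2}"
  shows "gh1 j i T (csi_past w t) = gh1 j i T w" "gh2 j i T (csi_past w t) = gh2 j i T w"
  using assms by (simp_all add: gh1_def gh2_def Hc_csi_past Gc_csi_past del: insert_iff) (simp_all add: Hc_csi_past Gc_csi_past)

lemma overheard_csi_past:
  assumes "T + 2 < t" "i \<in> {1,2}"
  shows "overheard i T (csi_past w t) s = overheard i T w s"
  unfolding overheard_def using gh_csi_past[OF assms(1), of i "3 - i"] assms(2) by auto

lemma est_csi_past:
  assumes "T + 7 < t" "d \<in> {1,2}"
  shows "est1 d T (csi_past w t) y = est1 d T w y" "est2 d T (csi_past w t) y = est2 d T w y"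
proof -
  have g: "gh1 j i T (csi_past w t) = gh1 j i T w" "gh2 j i T (csi_past w t) = gh2 j i T w" if "i \<in> {1,2}" "j \<in> {1,2}" for i j
    using gh_csi_past[of T t i j w] assms that by simp_all
  have H: "Hc i j (T + 5) (csi_past w t) = Hc i j (T + 5) w" if "i \<in> {1,2}" "j \<in> {1,2}" for i j
    using Hc_csi_past[of "T + 5" t i j w] assms that by simp
  have G: "Gc d j (T + s) (csi_past w t) = Gc d j (T + s) w" if "j \<in> {1,2}" "s \<le> 7" for j s
    using Gc_csi_past[of "T + s" t d j w] assms that by simp
  have v: "overheard_est i d T (csi_past w t) y = overheard_est i d T w y" for i
    using assms(2) by (simp add: overheard_est_def relay_est1_def relay_est2_def H G)
  have "3 - d \<in> {1,2}" using assms by auto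
  then show "est1 d T (csi_past w t) y = est1 d T w y" "est2 d T (csi_past w t) y = est2 d T w y"
    unfolding est1_def est2_def v using g assms(2) by simp_all
qed

lemma est_cong_y:
  assumes "\<And>t. t \<in> {T + 2, T + 6, T + 7} \<Longrightarrow> y t = y' t"
  shows "est1 d T x y = est1 d T x y'" "est2 d T x y = est2 d T x y'"
  using assms by (simp_all add: est1_def est2_def overheard_est_def relay_est1_def relay_est2_def)

context
  fixes \<alpha> :: "nat \<Rightarrow> nat \<Rightarrow> complex \<times> complex" and M n D :: nat and \<Delta> :: real
begin

lemma scheme_XS:
  "XS (scheme \<alpha> M n D \<Delta>) i m (3 * \<kappa>) w = fst (\<alpha> m \<kappa>)"
  "XS (scheme \<alpha> M n D \<Delta>) i m (3 * \<kappa> + 1) w = snd (\<alpha> m \<kappa>)"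
  "i \<in> {1,2} \<Longrightarrow> XS (scheme \<alpha> M n D \<Delta>) i m (3 * \<kappa> + 5) w = overheard i (3 * \<kappa>) w (\<alpha> m \<kappa>)"
proof -
  show "XS (scheme \<alpha> M n D \<Delta>) i m (3 * \<kappa>) w = fst (\<alpha> m \<kappa>)" by (simp add: XS_def scheme_def scheme_enc_def)
  have "(3 * \<kappa> + 1) mod 3 = 1" "(3 * \<kappa> + 1) div 3 = \<kappa>" by presburger+
  then show "XS (scheme \<alpha> M n D \<Delta>) i m (3 * \<kappa> + 1) w = snd (\<alpha> m \<kappa>)" by (simp add: XS_def scheme_def scheme_enc_def)
  have "(3 * \<kappa> + 5) mod 3 = 2" "(3 * \<kappa> + 5) div 3 = \<kappa> + 1" by presburger+
  then show "XS (scheme \<alpha> M n D \<Delta>) i m (3 * \<kappa> + 5) w = overheard i (3 * \<kappa>) w (\<alpha> m \<kappa>)" if "i \<in> {1,2}"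
    using overheard_csi_past[of "3 * \<kappa>" "3 * \<kappa> + 5" i w] that by (simp add: XS_def scheme_def scheme_enc_def)
qed

lemma scheme_XR:
  "XR (scheme \<alpha> M n D \<Delta>) 1 m1 m2 (3 * \<kappa> + 2) w = YR (scheme \<alpha> M n D \<Delta>) 1 m1 m2 (3 * \<kappa>) w / 3"
  "XR (scheme \<alpha> M n D \<Delta>) 2 m1 m2 (3 * \<kappa> + 2) w = YR (scheme \<alpha> M n D \<Delta>) 2 m1 m2 (3 * \<kappa> + 1) w / 3"
  "XR (scheme \<alpha> M n D \<Delta>) i m1 m2 (3 * \<kappa> + 6) w = YR (scheme \<alpha> M n D \<Delta>) i m1 m2 (3 * \<kappa> + 5) w / 3"
  "XR (scheme \<alpha> M n D \<Delta>) i m1 m2 (3 * \<kappa> + 7) w = YR (scheme \<alpha> M n D \<Delta>) i m1 m2 (3 * \<kappa> + 5) w / 3"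
proof -
  have "(3 * \<kappa> + 2) mod 3 = 2" by presburger
  then show "XR (scheme \<alpha> M n D \<Delta>) 1 m1 m2 (3 * \<kappa> + 2) w = YR (scheme \<alpha> M n D \<Delta>) 1 m1 m2 (3 * \<kappa>) w / 3"
    "XR (scheme \<alpha> M n D \<Delta>) 2 m1 m2 (3 * \<kappa> + 2) w = YR (scheme \<alpha> M n D \<Delta>) 2 m1 m2 (3 * \<kappa> + 1) w / 3"
    by (simp_all add: XR_def[of "scheme \<alpha> M n D \<Delta>"] scheme_sel scheme_rel_def)
  have "(3 * \<kappa> + 6) mod 3 = 0" "(3 * \<kappa> + 6) div 3 = \<kappa> + 2" by presburger+
  then show "XR (scheme \<alpha> M n D \<Delta>) i m1 m2 (3 * \<kappa> + 6) w = YR (scheme \<alpha> M n D \<Delta>) i m1 m2 (3 * \<kappa> + 5) w / 3"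
    by (simp add: XR_def[of "scheme \<alpha> M n D \<Delta>"] scheme_sel scheme_rel_def add.commute[of "3 * \<kappa>" 5])
  have "(3 * \<kappa> + 7) mod 3 = 1" "(3 * \<kappa> + 7) div 3 = \<kappa> + 2" by presburger+
  then show "XR (scheme \<alpha> M n D \<Delta>) i m1 m2 (3 * \<kappa> + 7) w = YR (scheme \<alpha> M n D \<Delta>) i m1 m2 (3 * \<kappa> + 5) w / 3"
    by (simp add: XR_def[of "scheme \<alpha> M n D \<Delta>"] scheme_sel scheme_rel_def add.commute[of "3 * \<kappa>" 5])
qed

lemma scheme_YD:
  assumes "t \<in> {3 * \<kappa> + 2, 3 * \<kappa> + 6, 3 * \<kappa> + 7}"
  shows "YD (scheme \<alpha> M n D \<Delta>) d m1 m2 t w = block_signal d (3 * \<kappa>) w (\<alpha> m1 \<kappa>) (\<alpha> m2 \<kappa>) t + block_noise d (3 * \<kappa>) w t"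
proof -
  have Y0: "YR (scheme \<alpha> M n D \<Delta>) 1 m1 m2 (3 * \<kappa>) w = Hc 1 1 (3 * \<kappa>) w * fst (\<alpha> m1 \<kappa>) + Hc 1 2 (3 * \<kappa>) w * fst (\<alpha> m2 \<kappa>) + ZR 1 (3 * \<kappa>) w"
    "YR (scheme \<alpha> M n D \<Delta>) 2 m1 m2 (3 * \<kappa> + 1) w = Hc 2 1 (3 * \<kappa> + 1) w * snd (\<alpha> m1 \<kappa>) + Hc 2 2 (3 * \<kappa> + 1) w * snd (\<alpha> m2 \<kappa>) + ZR 2 (3 * \<kappa> + 1) w"
    unfolding YR_def scheme_XS by simp_all
  have Y5: "YR (scheme \<alpha> M n D \<Delta>) i m1 m2 (3 * \<kappa> + 5) w = Hc i 1 (3 * \<kappa> + 5) w * overheard 1 (3 * \<kappa>) w (\<alpha> m1 \<kappa>)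
      + Hc i 2 (3 * \<kappa> + 5) w * overheard 2 (3 * \<kappa>) w (\<alpha> m2 \<kappa>) + ZR i (3 * \<kappa> + 5) w" for i
    using scheme_XS(3) by (simp add: YR_def)
  from assms consider "t = 3 * \<kappa> + 2" | "t = 3 * \<kappa> + 6" | "t = 3 * \<kappa> + 7" by blast
  then show ?thesis
  proof cases
    case 1
    show ?thesis
      unfolding 1 YD_def scheme_XR Y0 block_signal_def block_noise_def gh1_def gh2_def
      by (simp add: algebra_simps add_divide_distrib)
  next
    case 2
    show ?thesis
      unfolding 2 YD_def scheme_XR Y5 block_signal_def block_noise_def
      by (simp add: algebra_simps add_divide_distrib)
  next
    case 3
    show ?thesis
      unfolding 3 YD_def scheme_XR Y5 block_signal_def block_noise_def
      by (simp add: algebra_simps add_divide_distrib)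
  qed
qed

text \<open>A property of channel and noise only, so that one probability bound serves all pairs of
  messages.\<close>

definition bad_block :: "nat \<Rightarrow> nat \<Rightarrow> (nat \<Rightarrow> nat \<Rightarrow> complex) \<Rightarrow> bool" where
  "bad_block d \<kappa> w \<longleftrightarrow> \<not> nondeg d (3 * \<kappa>) w \<or> cmod (est1 d (3 * \<kappa>) w (block_noise d (3 * \<kappa>) w)) \<ge> \<Delta> / 2
     \<or> cmod (est2 d (3 * \<kappa>) w (block_noise d (3 * \<kappa>) w)) \<ge> \<Delta> / 2"

lemma close_if_not_bad:
  assumes "\<not> bad_block d \<kappa> w" "d \<in> {1,2}" "\<kappa> < (n - 5) div 3"
  shows "close \<Delta> d \<kappa> (\<alpha> (if d = 1 then m1 else m2) \<kappa>) (csi_past w n) (restrict (\<lambda>s. YD (scheme \<alpha> M n D \<Delta>) d m1 m2 s w) {..<n})"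
proof -
  \<comment> \<open>The last use of block \<open>\<kappa>\<close> is
    \<open>3 * \<kappa> + 7\<close>; this is the origin of the count
    \<open>(n - 5) div 3\<close>.\<close>
  have k: "3 * \<kappa> + 7 < n" using assms(3) by presburger
  have "est1 d (3 * \<kappa>) (csi_past w n) (restrict (\<lambda>s. YD (scheme \<alpha> M n D \<Delta>) d m1 m2 s w) {..<n}) = est1 d (3 * \<kappa>) w (\<lambda>s. YD (scheme \<alpha> M n D \<Delta>) d m1 m2 s w)"
    "est2 d (3 * \<kappa>) (csi_past w n) (restrict (\<lambda>s. YD (scheme \<alpha> M n D \<Delta>) d m1 m2 s w) {..<n}) = est2 d (3 * \<kappa>) w (\<lambda>s. YD (scheme \<alpha> M n D \<Delta>) d m1 m2 s w)"
    unfolding est_csi_past[OF k assms(2)] using k by (intro est_cong_y; auto)+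
  moreover have nd: "nondeg d (3 * \<kappa>) w" using assms(1) by (simp add: bad_block_def)
  ultimately show ?thesis
    using assms(1) est_signal_noise[OF nd assms(2), of "\<lambda>s. YD (scheme \<alpha> M n D \<Delta>) d m1 m2 s w", OF scheme_YD]
    by (auto simp: close_def bad_block_def)
qed

text \<open>If two words are both close in a block, separation makes their symbols there equal.
  Hence two words with fewer than \<open>D / 2\<close> discrepancies each differ in fewer than
  \<open>D\<close> blocks, and the least admissible message is the only one.\<close>

lemma decoded_correct:
  assumes d: "d \<in> {1,2}" and m: "m1 < M" "m2 < M"
    and sep: "\<And>m \<kappa> m' \<kappa>'. m < M \<Longrightarrow> m' < M \<Longrightarrow> \<alpha> m \<kappa> \<noteq> \<alpha> m' \<kappa> \<Longrightarrow>
       cmod (fst (\<alpha> m \<kappa>) - fst (\<alpha> m' \<kappa>)) \<ge> \<Delta> \<or> cmod (snd (\<alpha> m \<kappa>) - snd (\<alpha> m' \<kappa>)) \<ge> \<Delta>"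
    and dist: "\<And>m m'. m < M \<Longrightarrow> m' < M \<Longrightarrow> m \<noteq> m' \<Longrightarrow> card {\<kappa>. \<kappa> < (n - 5) div 3 \<and> \<alpha> m \<kappa> \<noteq> \<alpha> m' \<kappa>} \<ge> D"
    and few: "2 * card {\<kappa>. \<kappa> < (n - 5) div 3 \<and> bad_block d \<kappa> w} < D"
  shows "decoded (scheme \<alpha> M n D \<Delta>) d m1 m2 w = (if d = 1 then m1 else m2)"
proof -
  define m where "m = (if d = 1 then m1 else m2)"
  define x where "x = csi_past w n"
  define y where "y = restrict (\<lambda>s. YD (scheme \<alpha> M n D \<Delta>) d m1 m2 s w) {..<n}"
  define F where "F m = {\<kappa>. \<kappa> < (n - 5) div 3 \<and> \<not> close \<Delta> d \<kappa> (\<alpha> m \<kappa>) x y}" for m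
  have fin: "finite (F m)" for m by (simp add: F_def)
  have mM: "m < M" using \<open>m1 < M\<close> \<open>m2 < M\<close> by (simp add: m_def)
  have "F m \<subseteq> {\<kappa>. \<kappa> < (n - 5) div 3 \<and> bad_block d \<kappa> w}"
  proof (rule subsetI, rule ccontr)
    fix \<kappa> assume k: "\<kappa> \<in> F m" and "\<kappa> \<notin> {\<kappa>. \<kappa> < (n - 5) div 3 \<and> bad_block d \<kappa> w}"
    then have "\<kappa> < (n - 5) div 3" "\<not> bad_block d \<kappa> w" by (auto simp: F_def)
    from close_if_not_bad[OF this(2) d this(1), of m1 m2] k show False
      by (simp add: F_def x_def y_def m_def)
  qed
  then have "card (F m) \<le> card {\<kappa>. \<kappa> < (n - 5) div 3 \<and> bad_block d \<kappa> w}"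
    by (intro card_mono) auto
  then have Pm: "2 * card (F m) < D" using few by simp
  have uniq: "m' = m" if "m' < M" "2 * card (F m') < D" for m'
  proof (rule ccontr)
    assume "m' \<noteq> m"
    have "{\<kappa>. \<kappa> < (n - 5) div 3 \<and> \<alpha> m' \<kappa> \<noteq> \<alpha> m \<kappa>} \<subseteq> F m' \<union> F m"
    proof (rule subsetI, rule ccontr)
      fix \<kappa> assume k: "\<kappa> \<in> {\<kappa>. \<kappa> < (n - 5) div 3 \<and> \<alpha> m' \<kappa> \<noteq> \<alpha> m \<kappa>}" and "\<kappa> \<notin> F m' \<union> F m"
      then have c: "close \<Delta> d \<kappa> (\<alpha> m' \<kappa>) x y" "close \<Delta> d \<kappa> (\<alpha> m \<kappa>) x y" by (auto simp: F_def)
      have tri: "cmod (u - u') < \<Delta>" if "cmod (e - u) < \<Delta> / 2" "cmod (e - u') < \<Delta> / 2" for u u' e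
      proof -
        have "cmod (u - u') \<le> cmod (e - u') + cmod (e - u)"
          using norm_triangle_ineq4[of "e - u'" "e - u"] by simp
        with that show ?thesis by simp
      qed
      have "cmod (fst (\<alpha> m' \<kappa>) - fst (\<alpha> m \<kappa>)) < \<Delta>" "cmod (snd (\<alpha> m' \<kappa>) - snd (\<alpha> m \<kappa>)) < \<Delta>"
        using c tri unfolding close_def by blast+
      then show False using sep[OF \<open>m' < M\<close> mM, of \<kappa>] k by auto
    qed
    then have "card {\<kappa>. \<kappa> < (n - 5) div 3 \<and> \<alpha> m' \<kappa> \<noteq> \<alpha> m \<kappa>} \<le> card (F m' \<union> F m)"
      using fin by (intro card_mono) auto
    also have "\<dots> \<le> card (F m') + card (F m)" by (rule card_Un_le)
    finally show False using dist[OF \<open>m' < M\<close> mM \<open>m' \<noteq> m\<close>] that Pm by simp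
  qed
  have "decoded (scheme \<alpha> M n D \<Delta>) d m1 m2 w = (LEAST m. m < M \<and> 2 * card (F m) < D)"
    unfolding decoded_def scheme_sel F_def x_def y_def fst_conv snd_conv ..
  also have "\<dots> = m"
  proof (rule Least_equality)
    show "m < M \<and> 2 * card (F m) < D" using mM Pm by blast
    show "m \<le> m'" if "m' < M \<and> 2 * card (F m') < D" for m'
      using uniq[of m'] that by simp
  qed
  finally show ?thesis by (simp add: m_def)
qed

end

section \<open>Measurability of the scheme\<close>

text \<open>As a sum of indicators the count is accessible to measurability and to the variance
  computation.\<close>

lemma card_less_eq_sum: "card {\<kappa>::nat. \<kappa> < K \<and> Q \<kappa>} = (\<Sum>\<kappa><K. if Q \<kappa> then 1 else 0)"
proof (induction K)
  case (Suc K)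
  have "{\<kappa>. \<kappa> < Suc K \<and> Q \<kappa>} = (if Q K then insert K {\<kappa>. \<kappa> < K \<and> Q \<kappa>} else {\<kappa>. \<kappa> < K \<and> Q \<kappa>})"
    by (auto simp: less_Suc_eq)
  then show ?case using Suc by simp
qed simp

lemma csi_coord: "s < t \<Longrightarrow> k < 8 \<Longrightarrow> (\<lambda>x. x s k) \<in> borel_measurable (csi_space t)"
  unfolding csi_space_def
  by (rule measurable_compose[OF measurable_component_singleton[of s] measurable_component_singleton[of k]]) auto

lemma HG_csi_meas:
  assumes F: "f \<in> measurable N (csi_space t)" and "s < t" "i \<in> {1,2}" "j \<in> {1,2}"
  shows "(\<lambda>x. Hc i j s (f x)) \<in> borel_measurable N" "(\<lambda>x. Gc i j s (f x)) \<in> borel_measurable N"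
  unfolding Hc_def Gc_def using assms(2-) by (auto intro!: measurable_compose[OF F csi_coord])

lemma gh_csi_meas:
  assumes "f \<in> measurable N (csi_space t)" "T + 2 < t" "i \<in> {1,2}" "j \<in> {1,2}"
  shows "(\<lambda>x. gh1 j i T (f x)) \<in> borel_measurable N" "(\<lambda>x. gh2 j i T (f x)) \<in> borel_measurable N"
  unfolding gh1_def gh2_def using assms by (auto intro!: borel_measurable_times HG_csi_meas)

lemma cramer_measurable:
  assumes "A \<in> borel_measurable N" "B \<in> borel_measurable N" "C \<in> borel_measurable N" "D \<in> borel_measurable N"
    "u \<in> borel_measurable N" "v \<in> borel_measurable N"
  shows "(\<lambda>x. cramer1 (A x) (B x) (C x) (D x) (u x) (v x)) \<in> borel_measurable N"
    "(\<lambda>x. cramer2 (A x) (B x) (C x) (D x) (u x) (v x)) \<in> borel_measurable N"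
  unfolding cramer1_def cramer2_def using assms
  by (auto intro!: borel_measurable_divide borel_measurable_diff borel_measurable_times)

lemma est_meas:
  assumes f: "f \<in> measurable N (csi_space t)" and T: "T + 7 < t" and d: "d \<in> {1,2}"
    and Y: "\<And>s. s \<in> {T + 2, T + 6, T + 7} \<Longrightarrow> (\<lambda>x. Y x s) \<in> borel_measurable N"
  shows "(\<lambda>x. est1 d T (f x) (Y x)) \<in> borel_measurable N" "(\<lambda>x. est2 d T (f x) (Y x)) \<in> borel_measurable N"
proof -
  have Y3: "(\<lambda>x. 3 * Y x s) \<in> borel_measurable N" if "s \<in> {T + 2, T + 6, T + 7}" for s
    using Y[OF that] by (intro borel_measurable_times) auto
  have G: "(\<lambda>x. Gc d j s (f x)) \<in> borel_measurable N" if "s \<in> {T + 6, T + 7}" "j \<in> {1,2}" for s j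
    using HG_csi_meas(2)[OF f _ d that(2), of s] that T by auto
  have H: "(\<lambda>x. Hc i j (T + 5) (f x)) \<in> borel_measurable N" if "i \<in> {1,2}" "j \<in> {1,2}" for i j
    using HG_csi_meas(1)[OF f _ that, of "T + 5"] T by simp
  have R: "(\<lambda>x. relay_est1 d T (f x) (Y x)) \<in> borel_measurable N" "(\<lambda>x. relay_est2 d T (f x) (Y x)) \<in> borel_measurable N"
    unfolding relay_est1_def relay_est2_def by (intro cramer_measurable G Y3; simp)+
  have v: "(\<lambda>x. overheard_est i d T (f x) (Y x)) \<in> borel_measurable N" for i
  proof -
    have mem: "1 \<in> {1, 2::nat}" "2 \<in> {1, 2::nat}" by simp_all
    note c = cramer_measurable[OF H[OF mem(1,1)] H[OF mem(1,2)] H[OF mem(2,1)] H[OF mem(2,2)] R]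
    show ?thesis
    proof (cases "i = 1")
      case True
      show ?thesis unfolding overheard_est_def if_P[OF True] by (rule c(1))
    next
      case False
      show ?thesis unfolding overheard_est_def if_not_P[OF False] by (rule c(2))
    qed
  qed
  have d': "3 - d \<in> {1,2}" using d by auto
  have g: "(\<lambda>x. gh1 j d T (f x)) \<in> borel_measurable N" "(\<lambda>x. gh2 j d T (f x)) \<in> borel_measurable N" if "j \<in> {1,2}" for j
    using gh_csi_meas[OF f _ d that] T by auto
  have u: "(\<lambda>x. 3 * Y x (T + 2) - overheard_est (3 - d) d T (f x) (Y x)) \<in> borel_measurable N"
    using Y3[of "T + 2"] v by (intro borel_measurable_diff) auto
  show "(\<lambda>x. est1 d T (f x) (Y x)) \<in> borel_measurable N"
    unfolding est1_def by (intro cramer_measurable(1) g d d' u v)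
  show "(\<lambda>x. est2 d T (f x) (Y x)) \<in> borel_measurable N"
    unfolding est2_def by (intro cramer_measurable(2) g d d' u v)
qed

lemma scheme_enc_meas:
  assumes "i \<in> {1,2}"
  shows "scheme_enc \<alpha> i t m \<in> borel_measurable (csi_space t)"
proof -
  have "(\<lambda>x. overheard i (3 * (t div 3 - 1)) x s) \<in> borel_measurable (csi_space t)" if "\<not> t < 3" for s
  proof -
    have "3 * (t div 3 - 1) + 2 < t" using that by presburger
    moreover have "3 - i \<in> {1,2}" using assms by auto
    ultimately show ?thesis
      unfolding overheard_def using assms
      by (intro borel_measurable_add borel_measurable_times gh_csi_meas[OF measurable_ident_sets[OF refl]] borel_measurable_const)
  qed
  then have "(\<lambda>x. if t < 3 then 0 else overheard i (3 * (t div 3 - 1)) x (\<alpha> m (t div 3 - 1))) \<in> borel_measurable (csi_space t)"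
    by (cases "t < 3") (simp_all only: if_True if_False borel_measurable_const not_False_eq_True)
  then show ?thesis
    unfolding scheme_enc_def[abs_def]
    by (cases "t mod 3 = 0"; cases "t mod 3 = 1") (simp_all only: if_True if_False borel_measurable_const simp_thms)
qed

lemma XS_scheme_meas: "i \<in> {1,2} \<Longrightarrow> XS (scheme \<alpha> M n D \<Delta>) i m t \<in> borel_measurable chan_meas"
  unfolding XS_def[abs_def] scheme_sel by (rule measurable_compose[OF measurable_csi_past scheme_enc_meas])

lemma scheme_rel_meas: "scheme_rel i t \<in> borel_measurable (sig_space t)"
proof -
  have c: "(\<lambda>y. y s / 3) \<in> borel_measurable (sig_space t)" if "s < t" for s
    unfolding sig_space_def using measurable_component_singleton[of s "{..<t}" "\<lambda>_. borel :: complex measure"] that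
    by (intro borel_measurable_divide) auto
  consider "t mod 3 = 2" | "t mod 3 \<noteq> 2" "t < 3" | "t mod 3 \<noteq> 2" "\<not> t < 3" by blast
  then show ?thesis
  proof cases
    case 1
    then have "t - 1 < t" "t - 2 < t" by presburger+
    then show ?thesis using 1 c by (auto simp: scheme_rel_def[abs_def])
  next
    case 3
    then have "3 * (t div 3) - 1 < t" by presburger
    then show ?thesis using 3 c by (simp add: scheme_rel_def[abs_def])
  qed (simp add: scheme_rel_def[abs_def])
qed

lemma dec_scheme_meas:
  assumes "d \<in> {1,2}"
  shows "dec (scheme \<alpha> M n D \<Delta>) d \<in> measurable (csi_space n \<Otimes>\<^sub>M sig_space n) (count_space UNIV)"
proof -
  let ?N = "csi_space n \<Otimes>\<^sub>M sig_space n"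
  have y: "(\<lambda>p. snd p s) \<in> borel_measurable ?N" if "s < n" for s
    using that unfolding sig_space_def
    by (intro measurable_compose[OF measurable_snd measurable_component_singleton]) auto
  have cl: "Measurable.pred ?N (\<lambda>p. close \<Delta> d \<kappa> s (fst p) (snd p))" if "\<kappa> < (n - 5) div 3" for \<kappa> s
  proof -
    have k: "3 * \<kappa> + 7 < n" using that by presburger
    note e = est_meas[OF measurable_fst k assms, where Y = snd]
    have e': "(\<lambda>p. est1 d (3 * \<kappa>) (fst p) (snd p)) \<in> borel_measurable ?N"
      "(\<lambda>p. est2 d (3 * \<kappa>) (fst p) (snd p)) \<in> borel_measurable ?N"
      using k by (auto intro!: e y)
    have [measurable]: "(\<lambda>p. cmod (est1 d (3 * \<kappa>) (fst p) (snd p) - fst s)) \<in> borel_measurable ?N"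
      "(\<lambda>p. cmod (est2 d (3 * \<kappa>) (fst p) (snd p) - snd s)) \<in> borel_measurable ?N"
      using e' by (auto intro!: borel_measurable_norm borel_measurable_diff)
    show ?thesis unfolding close_def by measurable
  qed
  have "Measurable.pred ?N (\<lambda>p. m < M \<and> 2 * card {\<kappa>. \<kappa> < (n - 5) div 3 \<and> \<not> close \<Delta> d \<kappa> (\<alpha> m \<kappa>) (fst p) (snd p)} < D)" for m
  proof -
    have "(\<lambda>p. \<Sum>\<kappa><(n - 5) div 3. if \<not> close \<Delta> d \<kappa> (\<alpha> m \<kappa>) (fst p) (snd p) then 1 else 0::nat) \<in> measurable ?N (count_space UNIV)"
      using cl by (intro measurable_sum_nat measurable_If) auto
    then show ?thesis unfolding card_less_eq_sum by measurable
  qed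
  then show ?thesis
    unfolding scheme_sel(5)[abs_def] by (rule measurable_Least)
qed

section \<open>Power constraints of the scheme\<close>

text \<open>The two coefficients belong to different channel uses, hence are independent of unit
  second moment and can be removed one after the other.\<close>

lemma gh_second_moment:
  assumes "i \<in> {1,2}" "j \<in> {1,2}"
  shows "(\<integral>\<^sup>+ w. ennreal ((cmod (gh1 j i T w * s))\<^sup>2) \<partial>chan_meas) = ennreal ((cmod s)\<^sup>2)"
    "(\<integral>\<^sup>+ w. ennreal ((cmod (gh2 j i T w * s))\<^sup>2) \<partial>chan_meas) = ennreal ((cmod s)\<^sup>2)"
proof -
  have main: "(\<integral>\<^sup>+ w. ennreal ((cmod (w a k * (w b l * s)))\<^sup>2) \<partial>chan_meas) = ennreal ((cmod s)\<^sup>2)"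
    if "k < 12" "l < 12" "a \<noteq> b" for a b k l
  proof -
    have [measurable]: "(\<lambda>w. w b l) \<in> borel_measurable chan_meas" using that by measurable
    have "(\<integral>\<^sup>+ w. ennreal ((cmod (w a k * (w b l * s)))\<^sup>2) \<partial>chan_meas) = (\<integral>\<^sup>+ w. ennreal ((cmod (w b l * s))\<^sup>2) \<partial>chan_meas)"
      by (rule second_moment_chan[OF that(1)]) (use that in \<open>auto simp: chan_upd_def\<close>)
    also have "\<dots> = (\<integral>\<^sup>+ w. ennreal ((cmod s)\<^sup>2) \<partial>chan_meas)"
      by (rule second_moment_chan[OF that(2)]) auto
    finally show ?thesis by (simp add: chan.emeasure_space_1)
  qed
  show "(\<integral>\<^sup>+ w. ennreal ((cmod (gh1 j i T w * s))\<^sup>2) \<partial>chan_meas) = ennreal ((cmod s)\<^sup>2)"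
    unfolding gh1_def Gc_def Hc_def mult.assoc using assms by (intro main) auto
  show "(\<integral>\<^sup>+ w. ennreal ((cmod (gh2 j i T w * s))\<^sup>2) \<partial>chan_meas) = ennreal ((cmod s)\<^sup>2)"
    unfolding gh2_def Gc_def Hc_def mult.assoc using assms by (intro main) auto
qed

lemma gh_chan_meas:
  assumes "i \<in> {1,2}" "j \<in> {1,2}"
  shows "gh1 j i T \<in> borel_measurable chan_meas" "gh2 j i T \<in> borel_measurable chan_meas"
  unfolding gh1_def[abs_def] gh2_def[abs_def] using assms
  by (auto intro!: borel_measurable_times Gc_measurable Hc_measurable)

context
  fixes \<alpha> :: "nat \<Rightarrow> nat \<Rightarrow> complex \<times> complex" and M n D :: nat and \<Delta> P :: real
  assumes \<alpha>: "\<And>m \<kappa>. (cmod (fst (\<alpha> m \<kappa>)))\<^sup>2 \<le> P / 8" "\<And>m \<kappa>. (cmod (snd (\<alpha> m \<kappa>)))\<^sup>2 \<le> P / 8"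
    and P: "P \<ge> 1" and n: "n \<ge> 1" and M: "M \<ge> 1"
begin

text \<open>The critical case is the repeated combination, with
  \<open>3 * (P / 8 + P / 8) \<le> P\<close>. Its coefficients are unbounded, so the constraint
  holds in expectation.\<close>

lemma scheme_XS_power:
  assumes i: "i \<in> {1,2}"
  shows "(\<integral>\<^sup>+ w. ennreal ((cmod (XS (scheme \<alpha> M n D \<Delta>) i m t w))\<^sup>2) \<partial>chan_meas) \<le> ennreal P"
proof -
  have const: "(\<integral>\<^sup>+ w. ennreal ((cmod z)\<^sup>2) \<partial>chan_meas) \<le> ennreal P" if "(cmod z)\<^sup>2 \<le> P / 8" for z
    using that P by (simp add: chan.emeasure_space_1 ennreal_leI)
  consider "t mod 3 = 0" | "t mod 3 = 1" | "t mod 3 = 2" "t < 3" | "t mod 3 = 2" "\<not> t < 3" by linarith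
  then show ?thesis
  proof cases
    case 1
    then show ?thesis using const \<alpha> by (simp add: XS_def scheme_sel scheme_enc_def)
  next
    case 2
    then show ?thesis using const \<alpha> by (simp add: XS_def scheme_sel scheme_enc_def)
  next
    case 3
    then show ?thesis by (simp add: XS_def scheme_sel scheme_enc_def)
  next
    case 4
    define T where "T = 3 * (t div 3 - 1)"
    define s where "s = \<alpha> m (t div 3 - 1)"
    have T: "T + 2 < t" using 4 unfolding T_def by presburger
    have i': "3 - i \<in> {1,2}" using i by auto
    have e: "XS (scheme \<alpha> M n D \<Delta>) i m t w = gh1 (3 - i) i T w * fst s + gh2 (3 - i) i T w * snd s + 0" for w
      using 4 overheard_csi_past[OF T i, of w s] by (simp add: XS_def scheme_sel scheme_enc_def T_def s_def overheard_def)
    have "(\<integral>\<^sup>+ w. ennreal ((cmod (XS (scheme \<alpha> M n D \<Delta>) i m t w))\<^sup>2) \<partial>chan_meas)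
      \<le> 3 * ((\<integral>\<^sup>+ w. ennreal ((cmod (gh1 (3 - i) i T w * fst s))\<^sup>2) \<partial>chan_meas)
         + (\<integral>\<^sup>+ w. ennreal ((cmod (gh2 (3 - i) i T w * snd s))\<^sup>2) \<partial>chan_meas)
         + (\<integral>\<^sup>+ w. ennreal ((cmod (0::complex))\<^sup>2) \<partial>chan_meas))"
      unfolding e using gh_chan_meas[OF i i']
      by (intro nn_integral_add3_sq borel_measurable_times borel_measurable_const)
    also have "\<dots> = 3 * (ennreal ((cmod (fst s))\<^sup>2) + ennreal ((cmod (snd s))\<^sup>2))"
      by (simp add: gh_second_moment[OF i i'])
    also have "\<dots> \<le> 3 * (ennreal (P / 8) + ennreal (P / 8))"
      using \<alpha> by (intro mult_left_mono add_mono ennreal_leI) (auto simp: s_def)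
    also have "\<dots> = ennreal 3 * ennreal (P / 8 + P / 8)"
      using P by (subst ennreal_plus) auto
    also have "\<dots> = ennreal (3 * (P / 8 + P / 8))"
      using P by (subst ennreal_mult) auto
    also have "\<dots> \<le> ennreal P" using P by (intro ennreal_leI) auto
    finally show ?thesis .
  qed
qed

text \<open>Two signals and the noise, each of power at most \<open>P\<close>, amount to at most
  \<open>9 * P\<close>; hence the division by 3 at the relays.\<close>

lemma scheme_YR_power:
  assumes i: "i \<in> {1,2}"
  shows "(\<integral>\<^sup>+ w. ennreal ((cmod (YR (scheme \<alpha> M n D \<Delta>) i m1 m2 t w / 3))\<^sup>2) \<partial>chan_meas) \<le> ennreal P"
proof -
  let ?S = "scheme \<alpha> M n D \<Delta>"
  have X: "(\<integral>\<^sup>+ w. ennreal ((cmod (Hc i j t w * XS ?S j m t w))\<^sup>2) \<partial>chan_meas) \<le> ennreal P" if "j \<in> {1,2}" for j m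
  proof -
    have "(\<integral>\<^sup>+ w. ennreal ((cmod (w t (2 * (i - 1) + (j - 1)) * XS ?S j m t w))\<^sup>2) \<partial>chan_meas)
      = (\<integral>\<^sup>+ w. ennreal ((cmod (XS ?S j m t w))\<^sup>2) \<partial>chan_meas)"
    proof (rule second_moment_chan[OF _ XS_scheme_meas[OF that]])
      show "2 * (i - 1) + (j - 1) < 12" using i that by auto
      show "XS ?S j m t (chan_upd t (2 * (i - 1) + (j - 1)) w z) = XS ?S j m t w" for w z
        by (rule XS_cong) (auto simp: chan_upd_def)
    qed
    then show ?thesis using scheme_XS_power[OF that, of m t] by (simp add: Hc_def)
  qed
  have Z: "(\<integral>\<^sup>+ w. ennreal ((cmod (ZR i t w))\<^sup>2) \<partial>chan_meas) \<le> ennreal P"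
    using second_moment_chan[of "7 + i" "\<lambda>_. 1" t] i P by (auto simp: ZR_def chan.emeasure_space_1)
  have Ym: "YR ?S i m1 m2 t \<in> borel_measurable chan_meas"
    unfolding YR_def[abs_def] using i
    by (intro borel_measurable_add borel_measurable_times Hc_measurable ZR_measurable XS_scheme_meas) auto
  have "(\<integral>\<^sup>+ w. ennreal ((cmod (YR ?S i m1 m2 t w))\<^sup>2) \<partial>chan_meas) \<le>
    3 * ((\<integral>\<^sup>+ w. ennreal ((cmod (Hc i 1 t w * XS ?S 1 m1 t w))\<^sup>2) \<partial>chan_meas)
       + (\<integral>\<^sup>+ w. ennreal ((cmod (Hc i 2 t w * XS ?S 2 m2 t w))\<^sup>2) \<partial>chan_meas)
       + (\<integral>\<^sup>+ w. ennreal ((cmod (ZR i t w))\<^sup>2) \<partial>chan_meas))"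
    unfolding YR_def using i
    by (intro nn_integral_add3_sq borel_measurable_times Hc_measurable ZR_measurable XS_scheme_meas) auto
  also have "\<dots> \<le> 3 * (ennreal P + ennreal P + ennreal P)"
    by (intro mult_left_mono add_mono X Z) auto
  also have "\<dots> = ennreal 3 * ennreal (P + P + P)"
  proof -
    have "0 \<le> P" using P by simp
    then show ?thesis by (simp only: ennreal_plus add_nonneg_nonneg ennreal_numeral)
  qed
  also have "\<dots> = ennreal (3 * (P + P + P))"
    using P by (subst ennreal_mult) auto
  finally have Y: "(\<integral>\<^sup>+ w. ennreal ((cmod (YR ?S i m1 m2 t w))\<^sup>2) \<partial>chan_meas) \<le> ennreal (9 * P)" by simp
  have "(\<integral>\<^sup>+ w. ennreal ((cmod (YR ?S i m1 m2 t w / 3))\<^sup>2) \<partial>chan_meas) =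
    (\<integral>\<^sup>+ w. ennreal (1 / 9) * ennreal ((cmod (YR ?S i m1 m2 t w))\<^sup>2) \<partial>chan_meas)"
    by (intro nn_integral_cong, subst ennreal_mult[symmetric]) (auto simp: norm_divide power_divide)
  also have "\<dots> = ennreal (1 / 9) * (\<integral>\<^sup>+ w. ennreal ((cmod (YR ?S i m1 m2 t w))\<^sup>2) \<partial>chan_meas)"
    using Ym by (intro nn_integral_cmult) auto
  also have "\<dots> \<le> ennreal (1 / 9) * ennreal (9 * P)"
    by (intro mult_left_mono Y) auto
  also have "\<dots> = ennreal (1 / 9 * (9 * P))"
    using P by (intro ennreal_mult[symmetric]) auto
  finally show ?thesis by simp
qed

lemma scheme_XR_power:
  assumes i: "i \<in> {1,2}"
  shows "(\<integral>\<^sup>+ w. ennreal ((cmod (XR (scheme \<alpha> M n D \<Delta>) i m1 m2 t w))\<^sup>2) \<partial>chan_meas) \<le> ennreal P"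
proof -
  let ?S = "scheme \<alpha> M n D \<Delta>"
  have e: "XR ?S i m1 m2 t w = YR ?S i m1 m2 s w / 3" if "scheme_rel i t = (\<lambda>y. y s / 3)" "s < t" for s w
    using that by (simp add: XR_def scheme_sel)
  consider "t mod 3 = 2" | "t mod 3 \<noteq> 2" "t < 3" | "t mod 3 \<noteq> 2" "\<not> t < 3" by blast
  then show ?thesis
  proof cases
    case 1
    then have t: "t - 1 < t" "t - 2 < t" by presburger+
    have sr: "scheme_rel i t = (\<lambda>y. y (if i = 1 then t - 2 else t - 1) / 3)"
      using 1 by (intro ext) (simp add: scheme_rel_def)
    have less: "(if i = 1 then t - 2 else t - 1) < t" using t by simp
    show ?thesis unfolding e[OF sr less] by (rule scheme_YR_power[OF i])
  next
    case 2
    then show ?thesis by (simp add: XR_def scheme_sel scheme_rel_def)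
  next
    case 3
    then have t: "3 * (t div 3) - 1 < t" by presburger
    have sr: "scheme_rel i t = (\<lambda>y. y (3 * (t div 3) - 1) / 3)"
      using 3 by (intro ext) (simp add: scheme_rel_def)
    show ?thesis unfolding e[OF sr t] by (rule scheme_YR_power[OF i])
  qed
qed

lemma scheme_valid: "valid_code P (scheme \<alpha> M n D \<Delta>)"
  unfolding valid_code_def scheme_sel(1-4)
proof (intro conjI ballI allI impI)
  fix i :: nat assume i: "i \<in> {1,2}"
  show "scheme_enc \<alpha> i t m \<in> borel_measurable (csi_space t)" for t m by (rule scheme_enc_meas[OF i])
  show "scheme_rel i t \<in> borel_measurable (sig_space t)" for t by (rule scheme_rel_meas)
  show "dec (scheme \<alpha> M n D \<Delta>) i \<in> measurable (csi_space n \<Otimes>\<^sub>M sig_space n) (count_space UNIV)"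
    by (rule dec_scheme_meas[OF i])
  have "(\<Sum>m<M. \<Sum>t<n. \<integral>\<^sup>+ w. ennreal ((cmod (XS (scheme \<alpha> M n D \<Delta>) i m t w))\<^sup>2) \<partial>chan_meas)
      \<le> (\<Sum>m<M. \<Sum>t<n. ennreal P)"
    by (intro sum_mono scheme_XS_power[OF i])
  also have "\<dots> = ennreal (real M * real n * P)"
    using P by (simp add: ennreal_of_nat_eq_real_of_nat ennreal_mult mult.assoc)
  finally show "(\<Sum>m<M. \<Sum>t<n. \<integral>\<^sup>+ w. ennreal ((cmod (XS (scheme \<alpha> M n D \<Delta>) i m t w))\<^sup>2) \<partial>chan_meas) \<le> ennreal (real M * real n * P)" .
  have "(\<Sum>m1<M. \<Sum>m2<M. \<Sum>t<n. \<integral>\<^sup>+ w. ennreal ((cmod (XR (scheme \<alpha> M n D \<Delta>) i m1 m2 t w))\<^sup>2) \<partial>chan_meas)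
      \<le> (\<Sum>m1<M. \<Sum>m2<M. \<Sum>t<n. ennreal P)"
    by (intro sum_mono scheme_XR_power[OF i])
  also have "\<dots> = ennreal (real M * real M * real n * P)"
    using P by (simp add: ennreal_of_nat_eq_real_of_nat ennreal_mult mult.assoc)
  finally show "(\<Sum>m1<M. \<Sum>m2<M. \<Sum>t<n. \<integral>\<^sup>+ w. ennreal ((cmod (XR (scheme \<alpha> M n D \<Delta>) i m1 m2 t w))\<^sup>2) \<partial>chan_meas)
      \<le> ennreal (real M * real M * real n * P)" .
qed (use n M in auto)

end

section \<open>Bad blocks have small probability\<close>

lemma emeasure_CN01_singleton: "emeasure CN01 {z} = 0"
proof -
  have "emeasure CN01 {z} = (\<integral>\<^sup>+ u. ennreal (Ndens u) * indicator {z} u \<partial>lborel)"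
    by (simp add: CN01_eq emeasure_density)
  also have "\<dots> = 0" by simp
  finally show ?thesis .
qed

text \<open>Given all other coordinates, the Gaussian coordinate would have to hit the single point
  \<open>- B / A\<close>.\<close>

lemma AE_affine_nonzero:
  assumes k: "k < 12" and [measurable]: "A \<in> borel_measurable chan_meas" "B \<in> borel_measurable chan_meas"
    and inv: "\<And>w z. A (chan_upd t k w z) = A w" "\<And>w z. B (chan_upd t k w z) = B w"
    and AE: "AE w in chan_meas. A w \<noteq> 0"
  shows "AE w in chan_meas. A w * w t k + B w \<noteq> 0"
proof -
  have [measurable]: "(\<lambda>w. w t k) \<in> borel_measurable chan_meas" using k by measurable
  define S where "S = {w \<in> space chan_meas. A w * w t k + B w = 0}"
  have S [measurable]: "S \<in> sets chan_meas" unfolding S_def by measurable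
  have "emeasure chan_meas S = (\<integral>\<^sup>+ w. indicator S w \<partial>chan_meas)" by simp
  also have "\<dots> = (\<integral>\<^sup>+ w. \<integral>\<^sup>+ z. indicator S (chan_upd t k w z) \<partial>CN01 \<partial>chan_meas)"
    by (rule nn_integral_chan_coord[OF _ k]) measurable
  also have "\<dots> = (\<integral>\<^sup>+ w. 0 \<partial>chan_meas)"
  proof (rule nn_integral_cong_AE)
    have "AE w in chan_meas. w \<in> space chan_meas" by simp
    with AE show "AE w in chan_meas. (\<integral>\<^sup>+ z. indicator S (chan_upd t k w z) \<partial>CN01) = 0"
    proof eventually_elim
      case (elim w)
      have "indicator S (chan_upd t k w z) \<le> (indicator {- B w / A w} z :: ennreal)" for z
        using elim(1) inv[of w z] by (auto simp: S_def indicator_def chan_upd_def field_simps eq_neg_iff_add_eq_0)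
      then have "(\<integral>\<^sup>+ z. indicator S (chan_upd t k w z) \<partial>CN01) \<le> (\<integral>\<^sup>+ z. indicator {- B w / A w} z \<partial>CN01)"
        by (intro nn_integral_mono)
      also have "\<dots> = 0" by (simp add: emeasure_CN01_singleton)
      finally show ?case by simp
    qed
  qed
  finally have "emeasure chan_meas S = 0" by simp
  then show ?thesis
    using S by (intro AE_I[of _ _ S]) (auto simp: S_def)
qed

lemma AE_coord_nonzero: "k < 12 \<Longrightarrow> AE w in chan_meas. w t k \<noteq> 0"
  using AE_affine_nonzero[of k "\<lambda>_. 1" "\<lambda>_. 0" t] by simp

text \<open>Each determinant is affine in one coefficient that is absent from its slope and its
  constant term, and the slope is a product of other coefficients, nonzero almost surely.\<close>

lemma AE_nondeg:
  assumes d: "d \<in> {1,2}"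
  shows "AE w in chan_meas. nondeg d T w"
proof -
  define e where "e = 3 - d"
  have e: "e \<in> {1,2}" "e \<noteq> d" using d by (auto simp: e_def)
  note ms = measurable_chan_coord
  have G: "AE w in chan_meas. Gc d 1 (T + 6) w * Gc d 2 (T + 7) w + - (Gc d 2 (T + 6) w * Gc d 1 (T + 7) w) \<noteq> 0"
    unfolding Gc_def using d
    by (intro AE_affine_nonzero borel_measurable_times borel_measurable_uminus ms AE_coord_nonzero)
      (auto simp: chan_upd_def)
  have H: "AE w in chan_meas. Hc 1 1 (T + 5) w * Hc 2 2 (T + 5) w + - (Hc 1 2 (T + 5) w * Hc 2 1 (T + 5) w) \<noteq> 0"
    unfolding Hc_def
    by (intro AE_affine_nonzero borel_measurable_times borel_measurable_uminus ms AE_coord_nonzero)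
      (auto simp: chan_upd_def)
  have "AE w in chan_meas. (Gc d 1 (T + 2) w * Hc 1 d T w * Hc 2 d (T + 1) w) * Gc e 2 (T + 2) w
      + - (gh2 d d T w * gh1 e d T w) \<noteq> 0"
    unfolding Gc_def[of e 2]
  proof (rule AE_affine_nonzero)
    show "(\<lambda>w. Gc d 1 (T + 2) w * Hc 1 d T w * Hc 2 d (T + 1) w) \<in> borel_measurable chan_meas"
      using d by (intro borel_measurable_times Gc_measurable Hc_measurable) auto
    show "(\<lambda>w. - (gh2 d d T w * gh1 e d T w)) \<in> borel_measurable chan_meas"
      using d e by (intro borel_measurable_times borel_measurable_uminus gh_chan_meas)
    have "AE w in chan_meas. Gc d 1 (T + 2) w \<noteq> 0" "AE w in chan_meas. Hc 1 d T w \<noteq> 0" "AE w in chan_meas. Hc 2 d (T + 1) w \<noteq> 0"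
      unfolding Gc_def Hc_def using d by (auto intro!: AE_coord_nonzero)
    then show "AE w in chan_meas. Gc d 1 (T + 2) w * Hc 1 d T w * Hc 2 d (T + 1) w \<noteq> 0"
      by eventually_elim simp
  qed (use d e in \<open>auto simp: chan_upd_def Gc_def Hc_def gh1_def gh2_def\<close>)
  with G H show ?thesis
  proof eventually_elim
    case (elim w)
    then show ?case unfolding nondeg_def e_def[symmetric] by (simp add: gh1_def gh2_def mult_ac)
  qed
qed

definition badset :: "real \<Rightarrow> nat \<Rightarrow> nat \<Rightarrow> (nat \<Rightarrow> nat \<Rightarrow> complex) set" where
  "badset \<Delta> d \<kappa> = {w \<in> space chan_meas. bad_block \<Delta> d \<kappa> w}"

lemma block_noise_meas: "d \<in> {1,2} \<Longrightarrow> (\<lambda>w. block_noise d T w s) \<in> borel_measurable chan_meas"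
proof (cases "s = T + 2")
  case True
  assume "d \<in> {1,2}"
  then show ?thesis
    unfolding block_noise_def if_P[OF True]
    by (intro borel_measurable_add borel_measurable_divide borel_measurable_times borel_measurable_const
        Gc_measurable ZR_measurable ZD_measurable) simp_all
next
  case False
  assume "d \<in> {1,2}"
  then show ?thesis
    unfolding block_noise_def if_not_P[OF False]
    by (intro borel_measurable_add borel_measurable_divide borel_measurable_times borel_measurable_const
        Gc_measurable ZR_measurable ZD_measurable) simp_all
qed

lemma est_block_noise_meas:
  assumes d: "d \<in> {1,2}"
  shows "(\<lambda>w. est1 d T w (block_noise d T w)) \<in> borel_measurable chan_meas" "(\<lambda>w. est2 d T w (block_noise d T w)) \<in> borel_measurable chan_meas"
  using est_meas[where f = "\<lambda>w. csi_past w (T + 8)" and Y = "block_noise d T" and T = T and d = d, OF measurable_csi_past _ d block_noise_meas[OF d]]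
  by (simp_all add: est_csi_past[OF _ d])

lemma sets_nonzero:
  fixes f :: "_ \<Rightarrow> complex"
  assumes [measurable]: "f \<in> borel_measurable M"
  shows "{w \<in> space M. f w \<noteq> 0} \<in> sets M"
  by measurable

lemma nondeg_meas:
  assumes d: "d \<in> {1,2}"
  shows "Measurable.pred chan_meas (nondeg d T)"
proof -
  have d': "3 - d \<in> {1,2}" using d by auto
  have "{w \<in> space chan_meas. nondeg d T w} \<in> sets chan_meas"
    unfolding nondeg_def
    by (intro sets.sets_Collect_conj sets_nonzero borel_measurable_diff borel_measurable_times gh_chan_meas d d'
        Gc_measurable Hc_measurable insertI1 insertI2 singletonI)
  then show ?thesis by (simp add: pred_def)
qed

lemma badset_meas: "d \<in> {1,2} \<Longrightarrow> badset \<Delta> d \<kappa> \<in> sets chan_meas"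
proof -
  assume d: "d \<in> {1,2}"
  note [measurable] = est_block_noise_meas[OF d] nondeg_meas[OF d]
  show ?thesis unfolding badset_def bad_block_def by measurable
qed

lemma badset_antimono: "\<Delta> \<le> \<Delta>' \<Longrightarrow> badset \<Delta>' d \<kappa> \<subseteq> badset \<Delta> d \<kappa>"
  by (auto simp: badset_def bad_block_def)

text \<open>Continuity from above: as the spacing grows, the bad sets shrink to the degenerate
  channels, a null set. No decay rate results; the outer code only asks for a small fraction of bad
  blocks.\<close>

lemma badset_small:
  assumes d: "d \<in> {1,2}" and "\<delta> > 0"
  shows "\<exists>\<Delta>0. \<forall>\<Delta>\<ge>\<Delta>0. measure chan_meas (badset \<Delta> d 0) \<le> \<delta>"
proof -
  have "(\<lambda>k. measure chan_meas (badset (real k) d 0)) \<longlonglongrightarrow> measure chan_meas (\<Inter>k. badset (real k) d 0)"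
  proof (rule chan.finite_Lim_measure_decseq)
    show "range (\<lambda>k. badset (real k) d 0) \<subseteq> sets chan_meas" using badset_meas[OF d] by auto
    show "decseq (\<lambda>k. badset (real k) d 0)" by (auto simp: decseq_def intro!: badset_antimono)
  qed
  moreover have "measure chan_meas (\<Inter>k. badset (real k) d 0) = 0"
  proof -
    have "AE w in chan_meas. w \<notin> (\<Inter>k. badset (real k) d 0)"
      using AE_nondeg[OF d, of 0]
    proof eventually_elim
      case (elim w)
      obtain k where k: "real k > 2 * (cmod (est1 d 0 w (block_noise d 0 w)) + cmod (est2 d 0 w (block_noise d 0 w)))"
        using reals_Archimedean2 by blast
      have half: "a < x / 2 \<and> b < x / 2" if "2 * (a + b) < x" "0 \<le> a" "0 \<le> b" for a b x :: real
        using that by auto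
      have "w \<notin> badset (real k) d 0"
        using elim half[OF k norm_ge_zero norm_ge_zero] by (simp add: badset_def bad_block_def)
      then show ?case by blast
    qed
    then have "AE w in chan_meas. w \<in> (\<Inter>k. badset (real k) d 0) \<longleftrightarrow> w \<in> {}" by simp
    then have "measure chan_meas (\<Inter>k. badset (real k) d 0) = measure chan_meas {}"
      using badset_meas[OF d] by (intro measure_eq_AE) auto
    then show ?thesis by simp
  qed
  ultimately have "\<forall>\<^sub>F k in sequentially. measure chan_meas (badset (real k) d 0) < \<delta>"
    using assms(2) by (auto dest: order_tendstoD(2))
  then obtain k where k: "measure chan_meas (badset (real k) d 0) < \<delta>"
    by (auto simp: eventually_sequentially)
  have "measure chan_meas (badset \<Delta> d 0) \<le> \<delta>" if "\<Delta> \<ge> real k" for \<Delta>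
    using chan.finite_measure_mono[OF badset_antimono[OF that] badset_meas[OF d]] k by (meson less_imp_le order_trans)
  then show ?thesis by blast
qed

section \<open>Stationarity and independence of distant blocks\<close>

text \<open>A block involves only the eight uses from \<open>3 * \<kappa>\<close> on, so every bad
  event is a translate of the one for block 0.\<close>

lemma bad_block_shift:
  assumes w: "\<And>s k. s < 8 \<Longrightarrow> w (3 * \<kappa> + s) k = w' s k" and d: "d \<in> {1,2}"
  shows "bad_block \<Delta> d \<kappa> w = bad_block \<Delta> d 0 w'"
proof -
  define T where "T = 3 * \<kappa>"
  have sh: "Hc i j (T + s) w = Hc i j s w'" "Gc i j (T + s) w = Gc i j s w'" "ZR i (T + s) w = ZR i s w'" "ZD i (T + s) w = ZD i s w'"
    if "s < 8" for i j s
    using w[OF that] by (simp_all add: Hc_def Gc_def ZR_def ZD_def T_def)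
  have sh0: "Hc i j T w = Hc i j 0 w'" "ZR i T w = ZR i 0 w'" for i j
    using sh[of 0] by simp_all
  have gh: "gh1 j i T w = gh1 j i 0 w'" "gh2 j i T w = gh2 j i 0 w'" for i j
    using sh(1,2)[of 1] sh(1,2)[of 2] by (simp_all add: gh1_def gh2_def sh0 del: add_2_eq_Suc add_2_eq_Suc')
  have block_noise: "block_noise d T w (T + s) = block_noise d 0 w' s" if "s \<in> {2, 6, 7}" for s
    using that sh[of 1] sh[of 2] sh[of 5] sh[of 6] sh[of 7] by (auto simp: block_noise_def sh0 simp del: add_2_eq_Suc add_2_eq_Suc')
  have R: "relay_est1 d T w (block_noise d T w) = relay_est1 d 0 w' (block_noise d 0 w')" "relay_est2 d T w (block_noise d T w) = relay_est2 d 0 w' (block_noise d 0 w')"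
    using sh(2)[of 6] sh(2)[of 7] block_noise[of 6] block_noise[of 7] by (simp_all add: relay_est1_def relay_est2_def del: add_2_eq_Suc add_2_eq_Suc')
  have v: "overheard_est i d T w (block_noise d T w) = overheard_est i d 0 w' (block_noise d 0 w')" for i
    using sh(1)[of 5] by (simp add: overheard_est_def R del: add_2_eq_Suc add_2_eq_Suc')
  have E: "est1 d T w (block_noise d T w) = est1 d 0 w' (block_noise d 0 w')" "est2 d T w (block_noise d T w) = est2 d 0 w' (block_noise d 0 w')"
    using block_noise[of 2] by (simp_all add: est1_def est2_def gh v del: add_2_eq_Suc add_2_eq_Suc')
  have nd: "nondeg d T w = nondeg d 0 w'"
    using sh(1)[of 5] sh(2)[of 6] sh(2)[of 7] by (simp add: nondeg_def gh del: add_2_eq_Suc add_2_eq_Suc')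
  show ?thesis unfolding bad_block_def T_def[symmetric] E nd by simp
qed

lemma bad_block_cong:
  assumes "\<And>t k. t < 3 * \<kappa> + 8 \<Longrightarrow> w t k = w' t k" and d: "d \<in> {1,2}"
  shows "bad_block \<Delta> d \<kappa> w = bad_block \<Delta> d \<kappa> w'"
  using bad_block_shift[OF _ d, of w \<kappa> "\<lambda>s. w (3 * \<kappa> + s)" \<Delta>] bad_block_shift[OF _ d, of w' \<kappa> "\<lambda>s. w (3 * \<kappa> + s)" \<Delta>] assms(1) by simp

interpretation seq: sequence_space slot_meas
  by unfold_locales

text \<open>\<open>comb_seq i\<close> continues the first \<open>i\<close> uses of one sample by a
  second sample restarted at time 0; for i.i.d. uses the law is unchanged.\<close>

lemma distr_comb_chan: "distr (chan_meas \<Otimes>\<^sub>M chan_meas) chan_meas (\<lambda>(w, w'). comb_seq i w w') = chan_meas"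
  using seq.PiM_comb_seq[of i] by (simp add: chan_meas_def)

lemma comb_chan_meas: "(\<lambda>(w, w'). comb_seq i w w') \<in> measurable (chan_meas \<Otimes>\<^sub>M chan_meas) chan_meas"
  unfolding chan_meas_def by (rule measurable_comb_seq)

text \<open>Independence of past and future combined with stationarity: \<open>A\<close> reads the
  first sample, and \<open>B\<close> reads the second one, whose clock is restarted at time
  \<open>i\<close>.\<close>

lemma prob_past_future:
  assumes "A \<in> sets chan_meas" "B \<in> sets chan_meas" "C \<in> sets chan_meas"
    and eq: "\<And>w w'. w \<in> space chan_meas \<Longrightarrow> w' \<in> space chan_meas \<Longrightarrow> comb_seq i w w' \<in> C \<longleftrightarrow> w \<in> A \<and> w' \<in> B"
  shows "measure chan_meas C = measure chan_meas A * measure chan_meas B"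
proof -
  have sp: "A \<subseteq> space chan_meas" "B \<subseteq> space chan_meas" using sets.sets_into_space[OF assms(1)] sets.sets_into_space[OF assms(2)] by simp_all
  have "emeasure chan_meas C = emeasure (distr (chan_meas \<Otimes>\<^sub>M chan_meas) chan_meas (\<lambda>(w, w'). comb_seq i w w')) C"
    by (simp add: distr_comb_chan)
  also have "\<dots> = emeasure (chan_meas \<Otimes>\<^sub>M chan_meas) ((\<lambda>(w, w'). comb_seq i w w') -` C \<inter> space (chan_meas \<Otimes>\<^sub>M chan_meas))"
    by (rule emeasure_distr[OF comb_chan_meas assms(3)])
  also have "(\<lambda>(w, w'). comb_seq i w w') -` C \<inter> space (chan_meas \<Otimes>\<^sub>M chan_meas) = A \<times> B"
    using eq sp by (auto simp: space_pair_measure subset_iff)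
  also have "emeasure (chan_meas \<Otimes>\<^sub>M chan_meas) (A \<times> B) = emeasure chan_meas A * emeasure chan_meas B"
    by (rule chan.emeasure_pair_measure_Times[OF assms(1,2)])
  finally show ?thesis
    by (simp add: chan.emeasure_eq_measure ennreal_mult[symmetric])
qed

lemma bad_block_comb:
  assumes "d \<in> {1,2}"
  shows "bad_block \<Delta> d \<kappa> (comb_seq (3 * \<kappa>) w w') = bad_block \<Delta> d 0 w'"
  using assms by (intro bad_block_shift) (simp_all add: comb_seq_def)

lemma space_comb: "w \<in> space chan_meas \<Longrightarrow> w' \<in> space chan_meas \<Longrightarrow> comb_seq i w w' \<in> space chan_meas"
  by (auto simp: space_chan comb_seq_def)

lemma badset_prob: "d \<in> {1,2} \<Longrightarrow> measure chan_meas (badset \<Delta> d \<kappa>) = measure chan_meas (badset \<Delta> d 0)"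
  using prob_past_future[of "space chan_meas" "badset \<Delta> d 0" "badset \<Delta> d \<kappa>" "3 * \<kappa>"] badset_meas[of d]
  by (simp add: badset_def bad_block_comb space_comb chan.prob_space)

text \<open>Three blocks apart means nine uses, more than the eight a block spans, so the first
  block ends before the second begins.\<close>

lemma badset_indep:
  assumes d: "d \<in> {1,2}" and "\<kappa> + 3 \<le> \<iota>"
  shows "measure chan_meas (badset \<Delta> d \<kappa> \<inter> badset \<Delta> d \<iota>) = (measure chan_meas (badset \<Delta> d 0))\<^sup>2"
proof -
  have "measure chan_meas (badset \<Delta> d \<kappa> \<inter> badset \<Delta> d \<iota>) = measure chan_meas (badset \<Delta> d \<kappa>) * measure chan_meas (badset \<Delta> d 0)"
  proof (rule prob_past_future[where i = "3 * \<iota>"])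
    fix w w' assume w: "w \<in> space chan_meas" "w' \<in> space chan_meas"
    have "bad_block \<Delta> d \<kappa> (comb_seq (3 * \<iota>) w w') = bad_block \<Delta> d \<kappa> w"
      using assms by (intro bad_block_cong) (auto simp: comb_seq_def)
    then show "comb_seq (3 * \<iota>) w w' \<in> badset \<Delta> d \<kappa> \<inter> badset \<Delta> d \<iota> \<longleftrightarrow> w \<in> badset \<Delta> d \<kappa> \<and> w' \<in> badset \<Delta> d 0"
      using w bad_block_comb[OF d] by (auto simp: badset_def space_comb)
  qed (use badset_meas[OF d] in auto)
  then show ?thesis using badset_prob[OF d] by (simp add: power2_eq_square)
qed

lemma sum_near_le:
  fixes \<kappa> N :: nat
  shows "(\<Sum>\<iota><N. if \<kappa> + 3 \<le> \<iota> \<or> \<iota> + 3 \<le> \<kappa> then 0 else 1) \<le> (5::real)"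
proof -
  let ?S = "{\<iota>. \<iota> < N \<and> \<not> (\<kappa> + 3 \<le> \<iota> \<or> \<iota> + 3 \<le> \<kappa>)}"
  have eq: "(\<Sum>\<iota><N. if \<kappa> + 3 \<le> \<iota> \<or> \<iota> + 3 \<le> \<kappa> then 0 else 1) = real (card ?S)"
    unfolding card_less_eq_sum of_nat_sum by (intro sum.cong) auto
  have "card ?S \<le> card {\<kappa> - 2..\<kappa> + 2}" by (intro card_mono) auto
  then show ?thesis unfolding eq by simp
qed

text \<open>Chebyshev's inequality: indicators of blocks at least three apart are uncorrelated, and
  at most five blocks, including the block itself, are nearer, so the variance is at most
  \<open>5 * N\<close>.\<close>

lemma many_bad_prob:
  assumes d: "d \<in> {1,2}" and N: "N \<ge> 1" and \<tau>: "\<tau> > 0"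
    and \<delta>: "measure chan_meas (badset \<Delta> d 0) \<le> \<delta>"
  shows "measure chan_meas {w \<in> space chan_meas. real (card {\<kappa>. \<kappa> < N \<and> bad_block \<Delta> d \<kappa> w}) \<ge> real N * (\<delta> + \<tau>)}
    \<le> 5 / (\<tau>\<^sup>2 * real N)"
proof -
  define \<delta>0 where "\<delta>0 = measure chan_meas (badset \<Delta> d 0)"
  define I where "I \<kappa> = (indicator (badset \<Delta> d \<kappa>) :: _ \<Rightarrow> real)" for \<kappa>
  define X where "X w = (\<Sum>\<kappa><N. I \<kappa> w)" for w
  note Bm [measurable] = badset_meas[OF d]
  have Iint: "integrable chan_meas (I \<kappa>)" and IIint: "integrable chan_meas (\<lambda>w. I \<kappa> w * I \<iota> w)" for \<kappa> \<iota>
    unfolding I_def by (auto simp: chan.emeasure_eq_measure indicator_inter_arith[symmetric])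
  have EI: "chan.expectation (I \<kappa>) = \<delta>0" for \<kappa>
    using badset_prob[OF d] by (simp add: I_def \<delta>0_def)
  have EII: "chan.expectation (\<lambda>w. I \<kappa> w * I \<iota> w) = measure chan_meas (badset \<Delta> d \<kappa> \<inter> badset \<Delta> d \<iota>)" for \<kappa> \<iota>
    by (simp add: I_def indicator_inter_arith[symmetric])
  have EX: "chan.expectation X = real N * \<delta>0"
    unfolding X_def using Iint by (simp add: EI)
  have cov: "chan.expectation (\<lambda>w. (I \<kappa> w - \<delta>0) * (I \<iota> w - \<delta>0)) \<le> (if \<kappa> + 3 \<le> \<iota> \<or> \<iota> + 3 \<le> \<kappa> then 0 else 1)" for \<kappa> \<iota>
  proof -
    have "chan.expectation (\<lambda>w. (I \<kappa> w - \<delta>0) * (I \<iota> w - \<delta>0)) = chan.expectation (\<lambda>w. I \<kappa> w * I \<iota> w - \<delta>0 * I \<kappa> w - \<delta>0 * I \<iota> w + \<delta>0\<^sup>2)"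
      by (simp add: algebra_simps power2_eq_square)
    also have "\<dots> = measure chan_meas (badset \<Delta> d \<kappa> \<inter> badset \<Delta> d \<iota>) - \<delta>0\<^sup>2"
      using Iint IIint by (simp add: EI EII chan.prob_space power2_eq_square)
    finally have eq: "chan.expectation (\<lambda>w. (I \<kappa> w - \<delta>0) * (I \<iota> w - \<delta>0)) = measure chan_meas (badset \<Delta> d \<kappa> \<inter> badset \<Delta> d \<iota>) - \<delta>0\<^sup>2" .
    show ?thesis
    proof (cases "\<kappa> + 3 \<le> \<iota> \<or> \<iota> + 3 \<le> \<kappa>")
      case True
      then have "measure chan_meas (badset \<Delta> d \<kappa> \<inter> badset \<Delta> d \<iota>) = \<delta>0\<^sup>2"
        using badset_indep[OF d, of \<kappa> \<iota> \<Delta>] badset_indep[OF d, of \<iota> \<kappa> \<Delta>] by (auto simp: \<delta>0_def Int_commute)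
      then show ?thesis using True by (simp add: eq)
    next
      case False
      have "measure chan_meas (badset \<Delta> d \<kappa> \<inter> badset \<Delta> d \<iota>) \<le> 1" by (rule chan.prob_le_1)
      then have "measure chan_meas (badset \<Delta> d \<kappa> \<inter> badset \<Delta> d \<iota>) - \<delta>0\<^sup>2 \<le> 1"
        using zero_le_power2[of \<delta>0] by linarith
      then show ?thesis using False by (simp only: eq if_False)
    qed
  qed
  have covint: "integrable chan_meas (\<lambda>w. (I \<kappa> w - \<delta>0) * (I \<iota> w - \<delta>0))" for \<kappa> \<iota>
  proof -
    have "integrable chan_meas (\<lambda>w. I \<kappa> w * I \<iota> w - \<delta>0 * I \<kappa> w - \<delta>0 * I \<iota> w + \<delta>0\<^sup>2)"
      using Iint IIint by simp
    then show ?thesis by (simp add: algebra_simps power2_eq_square)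
  qed
  have sq: "(X w - real N * \<delta>0)\<^sup>2 = (\<Sum>\<kappa><N. \<Sum>\<iota><N. (I \<kappa> w - \<delta>0) * (I \<iota> w - \<delta>0))" for w
  proof -
    have "X w - real N * \<delta>0 = (\<Sum>\<kappa><N. I \<kappa> w - \<delta>0)" by (simp add: X_def sum_subtractf)
    then show ?thesis by (simp only: power2_eq_square sum_product)
  qed
  have var: "chan.expectation (\<lambda>w. (X w - real N * \<delta>0)\<^sup>2) \<le> 5 * real N"
  proof -
    have "chan.expectation (\<lambda>w. (X w - real N * \<delta>0)\<^sup>2) = (\<Sum>\<kappa><N. \<Sum>\<iota><N. chan.expectation (\<lambda>w. (I \<kappa> w - \<delta>0) * (I \<iota> w - \<delta>0)))"
      unfolding sq using covint by simp
    also have "\<dots> \<le> (\<Sum>\<kappa><N. \<Sum>\<iota><N. if \<kappa> + 3 \<le> \<iota> \<or> \<iota> + 3 \<le> \<kappa> then 0 else 1)"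
      by (intro sum_mono cov)
    also have "\<dots> \<le> (\<Sum>\<kappa><N. 5)" by (intro sum_mono sum_near_le)
    finally show ?thesis by simp
  qed
  have Xm [measurable]: "X \<in> borel_measurable chan_meas" unfolding X_def[abs_def] I_def by measurable
  have X2: "integrable chan_meas (\<lambda>w. (X w)\<^sup>2)"
    unfolding X_def power2_eq_square sum_product using IIint by simp
  have cardX: "real (card {\<kappa>. \<kappa> < N \<and> bad_block \<Delta> d \<kappa> w}) = X w" if "w \<in> space chan_meas" for w
    unfolding card_less_eq_sum of_nat_sum X_def I_def using that
    by (intro sum.cong) (auto simp: badset_def indicator_def)
  have "{w \<in> space chan_meas. real (card {\<kappa>. \<kappa> < N \<and> bad_block \<Delta> d \<kappa> w}) \<ge> real N * (\<delta> + \<tau>)}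
     \<subseteq> {w \<in> space chan_meas. \<bar>X w - chan.expectation X\<bar> \<ge> real N * \<tau>}"
  proof safe
    fix w assume w: "w \<in> space chan_meas" and "real N * (\<delta> + \<tau>) \<le> real (card {\<kappa>. \<kappa> < N \<and> bad_block \<Delta> d \<kappa> w})"
    then have "real N * \<delta> + real N * \<tau> \<le> X w" by (simp add: cardX distrib_left)
    moreover have "real N * \<delta>0 \<le> real N * \<delta>" using \<delta> by (intro mult_left_mono) (auto simp: \<delta>0_def)
    ultimately show "\<bar>X w - chan.expectation X\<bar> \<ge> real N * \<tau>" unfolding EX by linarith
  qed
  then have "measure chan_meas {w \<in> space chan_meas. real (card {\<kappa>. \<kappa> < N \<and> bad_block \<Delta> d \<kappa> w}) \<ge> real N * (\<delta> + \<tau>)}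
     \<le> measure chan_meas {w \<in> space chan_meas. \<bar>X w - chan.expectation X\<bar> \<ge> real N * \<tau>}"
    by (intro chan.finite_measure_mono) measurable
  also have "\<dots> \<le> chan.variance X / (real N * \<tau>)\<^sup>2"
    by (rule chan.Chebyshev_inequality[OF Xm X2]) (use N \<tau> in auto)
  also have "\<dots> \<le> 5 * real N / (real N * \<tau>)\<^sup>2"
    unfolding EX using var by (intro divide_right_mono) auto
  also have "\<dots> = 5 / (\<tau>\<^sup>2 * real N)"
    using N by (simp add: power2_eq_square)
  finally show ?thesis .
qed

text \<open>A decoding error needs at least \<open>D / 2\<close> bad blocks, that is, a fraction
  exceeding the expected one by at least \<open>\<tau>\<close>.\<close>

lemma scheme_err_prob:
  assumes d: "d \<in> {1,2}" and N: "(n - 5) div 3 \<ge> 1" and \<tau>: "\<tau> > 0"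
    and \<delta>: "measure chan_meas (badset \<Delta> d 0) \<le> \<delta>"
    and sep: "\<And>m \<kappa> m'. m < M \<Longrightarrow> m' < M \<Longrightarrow> \<alpha> m \<kappa> \<noteq> \<alpha> m' \<kappa> \<Longrightarrow>
       cmod (fst (\<alpha> m \<kappa>) - fst (\<alpha> m' \<kappa>)) \<ge> \<Delta> \<or> cmod (snd (\<alpha> m \<kappa>) - snd (\<alpha> m' \<kappa>)) \<ge> \<Delta>"
    and dist: "\<And>m m'. m < M \<Longrightarrow> m' < M \<Longrightarrow> m \<noteq> m' \<Longrightarrow> card {\<kappa>. \<kappa> < (n - 5) div 3 \<and> \<alpha> m \<kappa> \<noteq> \<alpha> m' \<kappa>} \<ge> D"
    and D: "real D \<ge> 2 * (real ((n - 5) div 3) * (\<delta> + \<tau>))" and M: "M \<ge> 1"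
  shows "err_prob (scheme \<alpha> M n D \<Delta>) d \<le> 5 / (\<tau>\<^sup>2 * real ((n - 5) div 3))"
proof -
  let ?S = "scheme \<alpha> M n D \<Delta>" and ?N = "(n - 5) div 3"
  let ?B = "{w \<in> space chan_meas. real (card {\<kappa>. \<kappa> < ?N \<and> bad_block \<Delta> d \<kappa> w}) \<ge> real ?N * (\<delta> + \<tau>)}"
  have Bm: "?B \<in> sets chan_meas"
  proof -
    have [measurable]: "Measurable.pred chan_meas (bad_block \<Delta> d \<kappa>)" for \<kappa>
      using badset_meas[OF d, of \<Delta> \<kappa>] unfolding badset_def by (simp add: pred_def)
    show ?thesis unfolding card_less_eq_sum by measurable
  qed
  have one: "measure chan_meas {w \<in> space chan_meas. decoded ?S d m1 m2 w \<noteq> (if d = 1 then m1 else m2)} \<le> 5 / (\<tau>\<^sup>2 * real ?N)"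
    if m: "m1 < M" "m2 < M" for m1 m2
  proof -
    have "{w \<in> space chan_meas. decoded ?S d m1 m2 w \<noteq> (if d = 1 then m1 else m2)} \<subseteq> ?B"
    proof (rule subsetI, rule ccontr)
      fix w assume w: "w \<in> {w \<in> space chan_meas. decoded ?S d m1 m2 w \<noteq> (if d = 1 then m1 else m2)}" "w \<notin> ?B"
      then have "real (card {\<kappa>. \<kappa> < ?N \<and> bad_block \<Delta> d \<kappa> w}) < real ?N * (\<delta> + \<tau>)" by auto
      then have few: "2 * card {\<kappa>. \<kappa> < ?N \<and> bad_block \<Delta> d \<kappa> w} < D" using D by linarith
      have "decoded ?S d m1 m2 w = (if d = 1 then m1 else m2)"
        by (rule decoded_correct[OF d m sep dist few])
      with w show False by blast
    qed
    then have "measure chan_meas {w \<in> space chan_meas. decoded ?S d m1 m2 w \<noteq> (if d = 1 then m1 else m2)} \<le> measure chan_meas ?B"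
      by (rule chan.finite_measure_mono[OF _ Bm])
    also have "\<dots> \<le> 5 / (\<tau>\<^sup>2 * real ?N)" by (rule many_bad_prob[OF d N \<tau> \<delta>])
    finally show ?thesis .
  qed
  have "(\<Sum>m1<M. \<Sum>m2<M. measure chan_meas {w \<in> space chan_meas. decoded ?S d m1 m2 w \<noteq> (if d = 1 then m1 else m2)})
    \<le> (\<Sum>m1<M. \<Sum>m2<M. 5 / (\<tau>\<^sup>2 * real ?N))"
    by (intro sum_mono one) auto
  also have "\<dots> = (real M * real M) * (5 / (\<tau>\<^sup>2 * real ?N))" by simp
  finally have le: "(\<Sum>m1<M. \<Sum>m2<M. measure chan_meas {w \<in> space chan_meas. decoded ?S d m1 m2 w \<noteq> (if d = 1 then m1 else m2)})
    \<le> (real M * real M) * (5 / (\<tau>\<^sup>2 * real ?N))" .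
  have "real M * real M > 0" using M by simp
  then show ?thesis
    unfolding err_prob_def scheme_sel by (subst pos_divide_le_eq) (use le in \<open>simp_all only: mult.commute\<close>)
qed

section \<open>The outer code and the degrees of freedom\<close>

definition hamming :: "nat \<Rightarrow> (nat \<Rightarrow> 'a) \<Rightarrow> (nat \<Rightarrow> 'a) \<Rightarrow> nat" where
  "hamming N x y = card {\<kappa>. \<kappa> < N \<and> x \<kappa> \<noteq> y \<kappa>}"

text \<open>A word in the ball is determined by the set where it leaves the centre and by its values
  there. Counting all \<open>2 ^ N\<close> sets costs one bit per position, negligible against the
  growing logarithm of the alphabet size.\<close>

lemma hamming_ball:
  assumes A: "finite A" "card A \<ge> 1" and x: "x \<in> (\<Pi>\<^sub>E \<kappa>\<in>{..<N}. A)"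
  shows "card {y \<in> (\<Pi>\<^sub>E \<kappa>\<in>{..<N}. A). hamming N x y < D} \<le> 2 ^ N * card A ^ D"
proof -
  define W where "W = (\<Pi>\<^sub>E \<kappa>\<in>{..<N}. A)"
  define U where "U S = {y \<in> W. \<forall>\<kappa><N. \<kappa> \<notin> S \<longrightarrow> y \<kappa> = x \<kappa>}" for S
  define F where "F = {S. S \<subseteq> {..<N} \<and> card S \<le> D}"
  have fW: "finite W" unfolding W_def using A by (intro finite_PiE) auto
  have fU: "finite (U S)" for S unfolding U_def using fW by auto
  have cU: "card (U S) \<le> card A ^ D" if "S \<in> F" for S
  proof -
    have S: "S \<subseteq> {..<N}" "card S \<le> D" "finite S" using that finite_subset by (auto simp: F_def)
    have "inj_on (\<lambda>y. restrict y S) (U S)"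
    proof (rule inj_onI)
      fix y y' assume y: "y \<in> U S" "y' \<in> U S" and eq: "restrict y S = restrict y' S"
      show "y = y'"
      proof
        fix \<kappa>
        show "y \<kappa> = y' \<kappa>"
        proof (cases "\<kappa> < N")
          case True
          then show ?thesis using y fun_cong[OF eq, of \<kappa>] by (cases "\<kappa> \<in> S") (auto simp: U_def)
        next
          case False
          then show ?thesis using y PiE_arb[of y "{..<N}" "\<lambda>_. A" \<kappa>] PiE_arb[of y' "{..<N}" "\<lambda>_. A" \<kappa>]
            by (auto simp: U_def W_def)
        qed
      qed
    qed
    moreover have "(\<lambda>y. restrict y S) ` U S \<subseteq> (\<Pi>\<^sub>E \<kappa>\<in>S. A)"
      using S(1) by (auto simp: U_def W_def PiE_def Pi_def)
    moreover have "finite (\<Pi>\<^sub>E \<kappa>\<in>S. A)" using S A by (intro finite_PiE) auto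
    ultimately have "card (U S) \<le> card (\<Pi>\<^sub>E \<kappa>\<in>S. A)" by (rule card_inj_on_le)
    also have "\<dots> = card A ^ card S" using S by (simp add: card_PiE)
    also have "\<dots> \<le> card A ^ D" using S A by (intro power_increasing) auto
    finally show ?thesis .
  qed
  have "F \<subseteq> Pow {..<N}" by (auto simp: F_def)
  then have fF: "finite F" and cF: "card F \<le> 2 ^ N"
    using finite_subset[of F "Pow {..<N}"] card_mono[of "Pow {..<N}" F] by (auto simp: card_Pow)
  have "{y \<in> W. hamming N x y < D} \<subseteq> (\<Union>S\<in>F. U S)"
  proof
    fix y assume y: "y \<in> {y \<in> W. hamming N x y < D}"
    let ?S = "{\<kappa>. \<kappa> < N \<and> x \<kappa> \<noteq> y \<kappa>}"
    have "?S \<in> F" "y \<in> U ?S" using y by (auto simp: F_def U_def hamming_def)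
    then show "y \<in> (\<Union>S\<in>F. U S)" by blast
  qed
  then have "card {y \<in> W. hamming N x y < D} \<le> card (\<Union>S\<in>F. U S)"
    using fF fU by (intro card_mono) auto
  also have "\<dots> \<le> (\<Sum>S\<in>F. card (U S))" using fF by (rule card_UN_le)
  also have "\<dots> \<le> (\<Sum>S\<in>F. card A ^ D)" by (intro sum_mono cU)
  also have "\<dots> = card F * card A ^ D" by simp
  also have "\<dots> \<le> 2 ^ N * card A ^ D" using cF by (rule mult_le_mono1)
  finally show ?thesis by (simp add: W_def)
qed

text \<open>Greedy choice: while the balls around the chosen words do not exhaust the space, a
  further word exists.\<close>

lemma gilbert_varshamov:
  assumes A: "finite A" "card A \<ge> 1" and "M * (2 ^ N * card A ^ D) \<le> card A ^ N"
  shows "\<exists>f :: nat \<Rightarrow> nat \<Rightarrow> 'a. (\<forall>m<M. f m \<in> (\<Pi>\<^sub>E \<kappa>\<in>{..<N}. A)) \<and>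
    (\<forall>m<M. \<forall>m'<M. m \<noteq> m' \<longrightarrow> hamming N (f m) (f m') \<ge> D)"
  using assms(3)
proof (induction M)
  case (Suc M)
  let ?W = "\<Pi>\<^sub>E \<kappa>\<in>{..<N}. A" and ?V = "2 ^ N * card A ^ D"
  have fW: "finite ?W" using A by (intro finite_PiE) auto
  obtain f where f: "\<forall>m<M. f m \<in> ?W" "\<forall>m<M. \<forall>m'<M. m \<noteq> m' \<longrightarrow> hamming N (f m) (f m') \<ge> D"
    using Suc by auto
  let ?B = "\<Union>m<M. {y \<in> ?W. hamming N (f m) y < D}"
  have "card ?B \<le> (\<Sum>m<M. card {y \<in> ?W. hamming N (f m) y < D})" by (rule card_UN_le) simp
  also have "\<dots> \<le> (\<Sum>m<M. ?V)" using f(1) A by (intro sum_mono hamming_ball) auto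
  also have "\<dots> = M * ?V" by simp
  also have "\<dots> < Suc M * ?V" using A by simp
  also have "\<dots> \<le> card A ^ N" by (rule Suc.prems)
  also have "\<dots> = card ?W" by (simp add: card_PiE)
  finally have "card ?B < card ?W" .
  then have "\<not> ?W \<subseteq> ?B" using card_mono[of ?B ?W] fW by (auto simp: not_less[symmetric])
  then obtain y where y: "y \<in> ?W" "\<And>m. m < M \<Longrightarrow> hamming N (f m) y \<ge> D" by (force simp: not_less)
  have sym: "hamming N y z = hamming N z y" for z by (simp add: hamming_def eq_commute[of "y _"])
  show ?case
  proof (intro exI[of _ "f(M := y)"] conjI allI impI)
    show "(f(M := y)) m \<in> ?W" if "m < Suc M" for m using that f(1) y(1) by (cases "m = M") auto
    show "hamming N ((f(M := y)) m) ((f(M := y)) m') \<ge> D" if "m < Suc M" "m' < Suc M" "m \<noteq> m'" for m m'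
      using that f(2) y(2) sym by (cases "m = M"; cases "m' = M") auto
  qed
qed simp

section \<open>The QAM alphabet\<close>

text \<open>The square grid is placed in one quadrant instead of being centred; this costs only a
  constant factor in power.\<close>

definition qam :: "nat \<Rightarrow> real \<Rightarrow> complex set" where
  "qam L \<Delta> = (\<lambda>(a, b). Complex (\<Delta> * real a) (\<Delta> * real b)) ` ({..<L} \<times> {..<L})"

lemma finite_qam: "finite (qam L \<Delta>)"
  by (simp add: qam_def)

lemma card_qam:
  assumes "\<Delta> > 0" shows "card (qam L \<Delta>) = L\<^sup>2"
proof -
  have "inj_on (\<lambda>(a, b). Complex (\<Delta> * real a) (\<Delta> * real b)) ({..<L} \<times> {..<L})"
    using assms by (auto simp: inj_on_def)
  then show ?thesis by (simp add: qam_def card_image power2_eq_square)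
qed

lemma qam_power:
  assumes "z \<in> qam L \<Delta>" "\<Delta> > 0"
  shows "(cmod z)\<^sup>2 \<le> 2 * (\<Delta> * real L)\<^sup>2"
proof -
  obtain a b where z: "z = Complex (\<Delta> * real a) (\<Delta> * real b)" "a < L" "b < L"
    using assms(1) by (auto simp: qam_def)
  have "(\<Delta> * real a)\<^sup>2 \<le> (\<Delta> * real L)\<^sup>2" "(\<Delta> * real b)\<^sup>2 \<le> (\<Delta> * real L)\<^sup>2"
    using z assms(2) by (auto intro!: power_mono mult_left_mono)
  then show ?thesis by (simp add: z cmod_power2)
qed

lemma qam_separated:
  assumes "z \<in> qam L \<Delta>" "z' \<in> qam L \<Delta>" "z \<noteq> z'" "\<Delta> > 0"
  shows "cmod (z - z') \<ge> \<Delta>"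
proof -
  obtain a b where z: "z = Complex (\<Delta> * real a) (\<Delta> * real b)" using assms(1) by (auto simp: qam_def)
  obtain a' b' where z': "z' = Complex (\<Delta> * real a') (\<Delta> * real b')" using assms(2) by (auto simp: qam_def)
  have far: "\<bar>\<Delta> * real x - \<Delta> * real y\<bar> \<ge> \<Delta>" if "x \<noteq> y" for x y :: nat
  proof -
    have "\<bar>real x - real y\<bar> \<ge> 1" using that by linarith
    then have "\<Delta> * \<bar>real x - real y\<bar> \<ge> \<Delta> * 1" using assms(4) by (intro mult_left_mono) auto
    then show ?thesis using assms(4) by (simp add: right_diff_distrib[symmetric] abs_mult)
  qed
  have "a \<noteq> a' \<or> b \<noteq> b'" using assms(3) z z' by auto
  then show ?thesis
  proof
    assume "a \<noteq> a'"
    then show ?thesis using far[of a a'] abs_Re_le_cmod[of "z - z'"] by (simp add: z z')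
  next
    assume "b \<noteq> b'"
    then show ?thesis using far[of b b'] abs_Im_le_cmod[of "z - z'"] by (simp add: z z')
  qed
qed

lemma floor_ge_half:
  fixes x :: real
  assumes "x \<ge> 1" shows "real (nat \<lfloor>x\<rfloor>) \<ge> x / 2"
proof -
  have f: "\<lfloor>x\<rfloor> \<ge> 1" using assms by simp
  then have "real_of_int \<lfloor>x\<rfloor> \<ge> 1" by simp
  moreover have "real_of_int \<lfloor>x\<rfloor> > x - 1" by linarith
  moreover have "real (nat \<lfloor>x\<rfloor>) = real_of_int \<lfloor>x\<rfloor>" using f by simp
  ultimately show ?thesis by linarith
qed

section \<open>Choice of parameters and achievable rates\<close>

text \<open>Bit budget of an outer code with \<open>N\<close> letters of \<open>\<mu>\<close> bits:
  a fraction \<open>\<epsilon>\<close> goes to the distance and one bit per letter to the ball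
  volume. Three uses at rate \<open>r\<close> need \<open>(2 - 15 * \<epsilon>) * l\<close> bits,
  constellation and distance leave about \<open>(2 - 4 * \<epsilon>) * l\<close>, and the gap
  \<open>11 * \<epsilon> * l\<close> pays the constants 4 + 1 + 1. The bound
  \<open>7 * r + 1 \<le> N\<close> pays for the incomplete blocks and the rounding of the message
  number.\<close>

lemma rate_inequality:
  fixes \<epsilon> \<mu> l N n r :: real
  assumes \<epsilon>: "0 < \<epsilon>" "\<epsilon> \<le> 2 / 15" and l: "l \<ge> 0" "11 * \<epsilon> * l \<ge> 6" and \<mu>: "\<mu> \<ge> 2 * (1 - \<epsilon>) * l - 4"
    and r: "r = (2 / 3 - 5 * \<epsilon>) * l" and N: "7 * r + 1 \<le> N" "n \<le> 3 * N + 7"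
  shows "n * r + 1 \<le> N * ((1 - \<epsilon>) * \<mu> - 1)"
proof -
  have r0: "r \<ge> 0" unfolding r using \<epsilon> l by (intro mult_nonneg_nonneg) auto
  then have N0: "N \<ge> 0" using N by linarith
  have "n * r \<le> (3 * N + 7) * r" using N r0 by (intro mult_right_mono)
  also have "\<dots> = N * ((2 - 15 * \<epsilon>) * l) + 7 * r" by (simp add: r algebra_simps)
  finally have "n * r + 1 \<le> N * ((2 - 15 * \<epsilon>) * l) + (7 * r + 1)" by simp
  also have "\<dots> \<le> N * ((2 - 15 * \<epsilon>) * l) + N * 1" using N by simp
  also have "\<dots> = N * ((2 - 15 * \<epsilon>) * l + 1)" by (simp add: distrib_left)
  also have "\<dots> \<le> N * ((1 - \<epsilon>) * \<mu> - 1)"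
  proof (rule mult_left_mono[OF _ N0])
    have "(2 - 15 * \<epsilon>) * l + 1 \<le> (2 - 4 * \<epsilon>) * l - 5" using l by (simp add: algebra_simps)
    also have "\<dots> \<le> (1 - \<epsilon>) * (2 * (1 - \<epsilon>) * l - 4) - 1"
    proof -
      have "(1 - \<epsilon>) * (2 * (1 - \<epsilon>) * l - 4) - 1 - ((2 - 4 * \<epsilon>) * l - 5) = 2 * (\<epsilon>\<^sup>2 * l) + 4 * \<epsilon>"
        by (simp add: algebra_simps power2_eq_square)
      also have "\<dots> \<ge> 0" using \<epsilon> l by simp
      finally show ?thesis by simp
    qed
    also have "\<dots> \<le> (1 - \<epsilon>) * \<mu> - 1"
      using \<mu> \<epsilon> by (intro diff_right_mono mult_left_mono) auto
    finally show "(2 - 15 * \<epsilon>) * l + 1 \<le> (1 - \<epsilon>) * \<mu> - 1" .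
  qed
  finally show ?thesis .
qed

lemma achievable_symmetric_rate:
  fixes \<epsilon> :: real
  assumes \<epsilon>: "0 < \<epsilon>" "\<epsilon> \<le> 2 / 15"
  shows "\<forall>\<^sub>F P in at_top. achievable P ((2 / 3 - 5 * \<epsilon>) * log 2 P) ((2 / 3 - 5 * \<epsilon>) * log 2 P)"
proof -
  \<comment> \<open>With \<open>\<tau> = \<delta>\<close> a fraction \<open>2 * \<delta>\<close> of
    bad blocks must be corrected, which needs distance \<open>4 * \<delta> = \<epsilon> / 2\<close>
    per letter; the other half of \<open>\<epsilon>\<close> covers rounding in
    \<open>D\<close>.\<close>
  define \<delta> where "\<delta> = \<epsilon> / 8"
  have \<delta>0: "\<delta> > 0" using \<epsilon> by (simp add: \<delta>_def)
  obtain \<Delta>1 where \<Delta>1: "\<And>\<Delta>. \<Delta> \<ge> \<Delta>1 \<Longrightarrow> measure chan_meas (badset \<Delta> 1 0) \<le> \<delta>"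
    using badset_small[of 1 \<delta>] \<delta>0 by auto
  obtain \<Delta>2 where \<Delta>2: "\<And>\<Delta>. \<Delta> \<ge> \<Delta>2 \<Longrightarrow> measure chan_meas (badset \<Delta> 2 0) \<le> \<delta>"
    using badset_small[of 2 \<delta>] \<delta>0 by auto
  have "filterlim (\<lambda>P. P powr (\<epsilon> / 2) / 4) at_top at_top" using \<epsilon>(1) by real_asymp
  then have e1: "\<forall>\<^sub>F P in at_top. P powr (\<epsilon> / 2) / 4 \<ge> max \<Delta>1 \<Delta>2" by (simp add: filterlim_at_top)
  have "filterlim (\<lambda>P. 11 * \<epsilon> * log 2 P) at_top at_top" using \<epsilon>(1) unfolding log_def by real_asymp
  then have e2: "\<forall>\<^sub>F P in at_top. 11 * \<epsilon> * log 2 P \<ge> 6" by (simp add: filterlim_at_top)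
  show ?thesis
    using e1 e2 eventually_ge_at_top[of 1]
  proof eventually_elim
    case (elim P)
    define l where "l = log 2 P"
    define r where "r = (2 / 3 - 5 * \<epsilon>) * l"
    \<comment> \<open>Spacing times side length is at most \<open>sqrt P / 4\<close>, giving symbol
      energy at most \<open>P / 8\<close>. The exponent \<open>\<epsilon> / 2\<close> makes the
      spacing grow at a small cost in constellation size.\<close>
    define \<Delta> where "\<Delta> = P powr (\<epsilon> / 2) / 4"
    define L where "L = nat \<lfloor>P powr ((1 - \<epsilon>) / 2)\<rfloor>"
    \<comment> \<open>A letter of the outer code is the pair of symbols of one block.\<close>
    define A where "A = qam L \<Delta> \<times> qam L \<Delta>"
    define lam where "lam = log 2 (real (card A))"
    define K where "K n = (n - 5) div 3" for n :: nat
    define D where "D n = nat \<lfloor>\<epsilon> * real (K n)\<rfloor>" for n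
    define M where "M n = nat \<lceil>2 powr (real n * r)\<rceil>" for n
    have P: "P \<ge> 1" by (rule elim)
    have l0: "l \<ge> 0" using P by (simp add: l_def)
    have r0: "r \<ge> 0" unfolding r_def using \<epsilon> l0 by (intro mult_nonneg_nonneg) auto
    have \<Delta>0: "\<Delta> > 0" using P by (simp add: \<Delta>_def)
    have x1: "P powr ((1 - \<epsilon>) / 2) \<ge> 1" using P \<epsilon> by (intro ge_one_powr_ge_zero) auto
    have L: "real L \<ge> P powr ((1 - \<epsilon>) / 2) / 2" "real L \<le> P powr ((1 - \<epsilon>) / 2)"
      unfolding L_def using floor_ge_half[OF x1] x1 by (auto intro: of_nat_floor)
    have L1: "L \<ge> 1" using x1 by (simp add: L_def le_nat_floor)
    have cA: "card A = L ^ 4" using \<Delta>0 by (simp add: A_def card_cartesian_product card_qam power2_eq_square power4_eq_xxxx)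
    have fA: "finite A" by (simp add: A_def finite_qam)
    have cA1: "card A \<ge> 1" using L1 by (simp add: cA)
    have lam: "lam \<ge> 2 * (1 - \<epsilon>) * l - 4"
    proof -
      have "(1 - \<epsilon>) / 2 * l - 1 = log 2 (P powr ((1 - \<epsilon>) / 2) / 2)"
        using P by (simp add: log_divide_pos log_powr l_def)
      also have "\<dots> \<le> log 2 (real L)" using L(1) L1 P by (subst log_le_cancel_iff) auto
      finally have "4 * ((1 - \<epsilon>) / 2 * l - 1) \<le> 4 * log 2 (real L)" by (rule mult_left_mono) simp
      also have "4 * log 2 (real L) = lam" using L1 by (simp add: lam_def cA log_nat_power)
      finally show ?thesis by (simp add: algebra_simps)
    qed
    have lam0: "lam \<ge> 0" using cA1 by (simp add: lam_def)
    have power: "(cmod z)\<^sup>2 \<le> P / 8" if "z \<in> qam L \<Delta>" for z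
    proof -
      have "\<Delta> * real L \<le> P powr (\<epsilon> / 2) / 4 * P powr ((1 - \<epsilon>) / 2)"
        unfolding \<Delta>_def using L(2) by (intro mult_left_mono) auto
      also have "\<dots> = P powr (\<epsilon> / 2 + (1 - \<epsilon>) / 2) / 4" by (simp add: powr_add)
      also have "\<epsilon> / 2 + (1 - \<epsilon>) / 2 = 1 / 2" by (simp add: field_simps)
      also have "P powr (1 / 2) = sqrt P" using P by (simp add: powr_half_sqrt)
      finally have "(\<Delta> * real L)\<^sup>2 \<le> (sqrt P / 4)\<^sup>2" using \<Delta>0 by (intro power_mono) auto
      also have "\<dots> = P / 16" using P by (simp add: power_divide)
      finally show ?thesis using qam_power[OF that \<Delta>0] by simp
    qed
    have M1: "M n \<ge> 1" and Mge: "real (M n) \<ge> 2 powr (real n * r)" and Mle: "real (M n) \<le> 2 powr (real n * r + 1)" for n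
    proof -
      have g: "2 powr (real n * r) \<ge> 1" using r0 by (intro ge_one_powr_ge_zero) auto
      show "M n \<ge> 1" unfolding M_def using g by linarith
      show "real (M n) \<ge> 2 powr (real n * r)" unfolding M_def by linarith
      have "real (M n) \<le> 2 powr (real n * r) + 1" unfolding M_def using g by linarith
      also have "\<dots> \<le> 2 powr (real n * r + 1)" using g by (simp add: powr_add)
      finally show "real (M n) \<le> 2 powr (real n * r + 1)" .
    qed
    \<comment> \<open>Blocklengths too short for the counting argument get a constant word: the code
      must exist for every \<open>n\<close>, but its error matters only in the limit.\<close>
    define good where "good n \<longleftrightarrow> 7 * r + 1 \<le> real (K n) \<and> \<epsilon> * real (K n) \<ge> 2" for n
    have K_upper: "real n \<le> 3 * real (K n) + 7" for n
    proof -
      have "n \<le> 3 * ((n - 5) div 3) + 7" by presburger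
      then show ?thesis unfolding K_def by linarith
    qed
    have count: "M n * (2 ^ K n * card A ^ D n) \<le> card A ^ K n" if "good n" for n
    proof -
      have q: "real (card A) = 2 powr lam" using cA1 by (simp add: lam_def)
      have Dle: "real (D n) \<le> \<epsilon> * real (K n)" unfolding D_def using \<epsilon> by (intro of_nat_floor) auto
      have "real n * r + 1 \<le> real (K n) * ((1 - \<epsilon>) * lam - 1)"
        by (rule rate_inequality[OF \<epsilon> l0 _ lam r_def _ K_upper]) (use elim(2) that in \<open>auto simp: l_def good_def\<close>)
      then have "real n * r + 1 + real (K n) + (\<epsilon> * real (K n)) * lam \<le> real (K n) * lam"
        by (simp add: algebra_simps)
      moreover have "real (D n) * lam \<le> (\<epsilon> * real (K n)) * lam" using Dle lam0 by (rule mult_right_mono)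
      ultimately have ex: "real n * r + 1 + real (K n) + real (D n) * lam \<le> real (K n) * lam" by linarith
      have pw: "real (card A) ^ k = 2 powr (real k * lam)" for k
        unfolding q by (simp add: powr_realpow[symmetric] powr_powr mult.commute)
      have "real (M n * (2 ^ K n * card A ^ D n)) = real (M n) * (2 powr real (K n) * 2 powr (real (D n) * lam))"
        by (simp add: pw powr_realpow)
      also have "\<dots> \<le> 2 powr (real n * r + 1) * (2 powr real (K n) * 2 powr (real (D n) * lam))"
        by (intro mult_right_mono Mle) auto
      also have "\<dots> = 2 powr (real n * r + 1 + real (K n) + real (D n) * lam)" by (simp add: powr_add)
      also have "\<dots> \<le> 2 powr (real (K n) * lam)" using ex by (intro powr_mono) auto
      also have "\<dots> = real (card A ^ K n)" by (simp add: pw)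
      finally show ?thesis by (simp only: of_nat_le_iff)
    qed
    have "\<exists>\<alpha>. (\<forall>m \<kappa>. \<alpha> m \<kappa> \<in> A) \<and> (good n \<longrightarrow> (\<forall>m<M n. \<forall>m'<M n. m \<noteq> m' \<longrightarrow>
        card {\<kappa>. \<kappa> < K n \<and> \<alpha> m \<kappa> \<noteq> \<alpha> m' \<kappa>} \<ge> D n))" for n
    proof -
      have "A \<noteq> {}" using cA1 by auto
      then obtain a0 where a0: "a0 \<in> A" by blast
      show ?thesis
      proof (cases "good n")
        case False
        then show ?thesis using a0 by (intro exI[of _ "\<lambda>_ _. a0"]) auto
      next
        case True
        obtain f where f: "\<forall>m<M n. f m \<in> (\<Pi>\<^sub>E \<kappa>\<in>{..<K n}. A)" "\<forall>m<M n. \<forall>m'<M n. m \<noteq> m' \<longrightarrow> hamming (K n) (f m) (f m') \<ge> D n"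
          using gilbert_varshamov[OF fA cA1 count[OF True]] by auto
        define \<alpha> where "\<alpha> m \<kappa> = (if m < M n \<and> \<kappa> < K n then f m \<kappa> else a0)" for m \<kappa>
        have "\<alpha> m \<kappa> \<in> A" for m \<kappa> using f(1) a0 by (auto simp: \<alpha>_def)
        moreover have "card {\<kappa>. \<kappa> < K n \<and> \<alpha> m \<kappa> \<noteq> \<alpha> m' \<kappa>} \<ge> D n" if "m < M n" "m' < M n" "m \<noteq> m'" for m m'
        proof -
          have "{\<kappa>. \<kappa> < K n \<and> \<alpha> m \<kappa> \<noteq> \<alpha> m' \<kappa>} = {\<kappa>. \<kappa> < K n \<and> f m \<kappa> \<noteq> f m' \<kappa>}"
            using that by (auto simp: \<alpha>_def)
          then show ?thesis using f(2) that by (simp add: hamming_def)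
        qed
        ultimately show ?thesis by blast
      qed
    qed
    then obtain \<alpha> where \<alpha>A: "\<And>n m \<kappa>. \<alpha> n m \<kappa> \<in> A"
      and \<alpha>d: "\<And>n m m'. good n \<Longrightarrow> m < M n \<Longrightarrow> m' < M n \<Longrightarrow> m \<noteq> m' \<Longrightarrow> card {\<kappa>. \<kappa> < K n \<and> \<alpha> n m \<kappa> \<noteq> \<alpha> n m' \<kappa>} \<ge> D n"
      by metis
    define C where "C n = scheme (\<alpha> n) (M n) n (D n) \<Delta>" for n
    have \<alpha>q: "fst (\<alpha> n m \<kappa>) \<in> qam L \<Delta>" "snd (\<alpha> n m \<kappa>) \<in> qam L \<Delta>" for n m \<kappa>
      using \<alpha>A[of n m \<kappa>] by (auto simp: A_def mem_Times_iff)
    have valid: "valid_code P (C n)" if "n \<ge> 1" for n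
      unfolding C_def using \<alpha>q power P that M1 by (intro scheme_valid) auto
    have err: "err_prob (C n) d \<le> 5 / (\<delta>\<^sup>2 * real (K n))" if d: "d \<in> {1,2}" and g: "good n" for n d
    proof -
      have K1: "(n - 5) div 3 \<ge> 1" using g r0 by (simp add: good_def K_def)
      have dl: "measure chan_meas (badset \<Delta> d 0) \<le> \<delta>"
        using d \<Delta>1[of \<Delta>] \<Delta>2[of \<Delta>] elim(1) by (auto simp: \<Delta>_def)
      have DD: "real (D n) \<ge> 2 * (real ((n - 5) div 3) * (\<delta> + \<delta>))"
      proof -
        have "\<epsilon> * real (K n) \<ge> 2" using g by (simp add: good_def)
        then have "real (D n) \<ge> \<epsilon> * real (K n) - 1" unfolding D_def by linarith
        also have "\<epsilon> * real (K n) - 1 \<ge> \<epsilon> * real (K n) / 2" using g by (simp add: good_def)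
        also have "\<epsilon> * real (K n) / 2 = 2 * (real ((n - 5) div 3) * (\<delta> + \<delta>))" by (simp add: \<delta>_def K_def)
        finally show ?thesis by simp
      qed
      show ?thesis
        unfolding C_def K_def
      proof (rule scheme_err_prob[OF d K1 \<delta>0 dl _ _ DD M1])
        fix m \<kappa> m' assume "\<alpha> n m \<kappa> \<noteq> \<alpha> n m' \<kappa>"
        then have "fst (\<alpha> n m \<kappa>) \<noteq> fst (\<alpha> n m' \<kappa>) \<or> snd (\<alpha> n m \<kappa>) \<noteq> snd (\<alpha> n m' \<kappa>)" by (metis prod_eqI)
        then show "\<Delta> \<le> cmod (fst (\<alpha> n m \<kappa>) - fst (\<alpha> n m' \<kappa>)) \<or> \<Delta> \<le> cmod (snd (\<alpha> n m \<kappa>) - snd (\<alpha> n m' \<kappa>))"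
          using qam_separated \<alpha>q \<Delta>0 by blast
      next
        fix m m' assume "m < M n" "m' < M n" "m \<noteq> m'"
        then show "D n \<le> card {\<kappa>. \<kappa> < (n - 5) div 3 \<and> \<alpha> n m \<kappa> \<noteq> \<alpha> n m' \<kappa>}"
          using \<alpha>d[OF g] by (simp add: K_def)
      qed
    qed
    have Klim: "filterlim (\<lambda>n. real (K n)) at_top sequentially"
    proof (rule filterlim_at_top_mono[of "\<lambda>n. (real n - 7) / 3"])
      show "filterlim (\<lambda>n. (real n - 7) / 3) at_top sequentially" by real_asymp
      show "\<forall>\<^sub>F n in sequentially. (real n - 7) / 3 \<le> real (K n)"
      proof (rule always_eventually, rule allI)
        fix n show "(real n - 7) / 3 \<le> real (K n)" using K_upper[of n] by simp
      qed
    qed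
    have evgood: "\<forall>\<^sub>F n in sequentially. good n"
    proof -
      have "\<forall>\<^sub>F n in sequentially. real (K n) \<ge> max (7 * r + 1) (2 / \<epsilon>)"
        using Klim unfolding filterlim_at_top by (rule spec)
      then show ?thesis
      proof eventually_elim
        case (elim n)
        then have "2 / \<epsilon> \<le> real (K n)" by simp
        then have "2 \<le> \<epsilon> * real (K n)" using \<epsilon> by (simp add: divide_le_eq mult.commute)
        then show ?case using elim by (simp add: good_def)
      qed
    qed
    have errlim: "(\<lambda>n. err_prob (C n) d) \<longlonglongrightarrow> 0" if d: "d \<in> {1,2}" for d
    proof (rule tendsto_sandwich[of "\<lambda>_. 0" _ _ "\<lambda>n. 5 / (\<delta>\<^sup>2 * real (K n))"])
      show "\<forall>\<^sub>F n in sequentially. 0 \<le> err_prob (C n) d"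
        by (rule always_eventually) (simp add: err_prob_def sum_nonneg)
      show "\<forall>\<^sub>F n in sequentially. err_prob (C n) d \<le> 5 / (\<delta>\<^sup>2 * real (K n))"
        using evgood by eventually_elim (rule err[OF d])
      have "filterlim (\<lambda>n. \<delta>\<^sup>2 * real (K n)) at_top sequentially"
        using \<delta>0 by (intro filterlim_tendsto_pos_mult_at_top[OF tendsto_const _ Klim]) simp
      then show "(\<lambda>n. 5 / (\<delta>\<^sup>2 * real (K n))) \<longlonglongrightarrow> 0"
        by (intro real_tendsto_divide_at_top[OF tendsto_const])
    qed simp
    have "achievable P r r"
      unfolding achievable_def
    proof (intro conjI exI[of _ C] allI impI)
      fix n :: nat assume "1 \<le> n"
      then show "valid_code P (C n)" by (rule valid)
      show "blen (C n) = n" by (simp add: C_def scheme_sel)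
      show "2 powr (real n * r) \<le> real (nmsg (C n) 1)" "2 powr (real n * r) \<le> real (nmsg (C n) 2)"
        using Mge by (simp_all add: C_def scheme_sel)
    qed (use r0 errlim in auto)
    then show ?case by (simp add: r_def l_def)
  qed
qed

theorem theorem2:
  shows "DoF_dCSI_is (4 / 3)"
  unfolding DoF_dCSI_is_def
proof (rule tendstoI)
  fix e :: real assume e: "e > 0"
  define c where "c = 4 / 3 * (9 + ln pi) / ln 2"
  \<comment> \<open>The two users together lose \<open>10 * \<epsilon> \<le> e / 2\<close>; the cap
    \<open>2 / 15\<close> keeps the symmetric rate nonnegative.\<close>
  define \<epsilon> where "\<epsilon> = min (2 / 15) (e / 20)"
  have \<epsilon>: "0 < \<epsilon>" "\<epsilon> \<le> 2 / 15" "10 * \<epsilon> < e" using e by (auto simp: \<epsilon>_def)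
  have "((\<lambda>P. c / log 2 P) \<longlongrightarrow> 0) at_top" unfolding log_def by real_asymp
  then have small: "\<forall>\<^sub>F P in at_top. c / log 2 P < e" using e by (rule order_tendstoD)
  show "\<forall>\<^sub>F P in at_top. dist (Csum P / log 2 P) (4 / 3) < e"
    using achievable_symmetric_rate[OF \<epsilon>(1,2)] small eventually_gt_at_top[of 1]
  proof eventually_elim
    case (elim P)
    define l where "l = log 2 P"
    have l: "l > 0" using elim(3) by (simp add: l_def)
    let ?S = "{r1 + r2 | r1 r2. achievable P r1 r2}"
    have up: "x \<le> 4 / 3 * l + c" if "x \<in> ?S" for x
      using that achievable_sum_le[of P] elim(3) by (auto simp: l_def c_def)
    \<comment> \<open>This element gives the lower bound and also the nonemptiness that makes the
      supremum in \<open>Csum\<close> meaningful.\<close>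
    have mem: "(2 / 3 - 5 * \<epsilon>) * l + (2 / 3 - 5 * \<epsilon>) * l \<in> ?S" using elim(1) unfolding l_def by blast
    have "(2 / 3 - 5 * \<epsilon>) * l + (2 / 3 - 5 * \<epsilon>) * l \<le> Csum P"
      unfolding Csum_def by (rule cSup_upper[OF mem]) (use up in \<open>auto simp: bdd_above_def\<close>)
    then have "(4 / 3 - 10 * \<epsilon>) * l \<le> Csum P" by (simp add: algebra_simps)
    then have lo: "4 / 3 - 10 * \<epsilon> \<le> Csum P / l" using l by (simp add: pos_le_divide_eq)
    have "Csum P \<le> 4 / 3 * l + c"
      unfolding Csum_def by (rule cSup_least) (use mem up in auto)
    then have "Csum P / l \<le> (4 / 3 * l + c) / l" using l by (intro divide_right_mono) auto
    also have "\<dots> = 4 / 3 + c / l" using l by (simp add: add_divide_distrib)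
    finally have "Csum P / l < 4 / 3 + e" using elim(2) by (simp add: l_def)
    with lo \<epsilon>(3) show ?case unfolding dist_real_def l_def[symmetric] abs_less_iff by linarith
  qed
qed

end
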